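(* Let $m\ge 2$ and $k\ge 1$ be integers. Suppose $X_1,\ldots,X_k\in\mathfrak{su}(m)$ (respectively $x_1,\ldots,x_k\in SU(m)$), and let $q_i$ denote the highest multiplicity of an eigenvalue of $X_i$ (respectively of $x_i$). Then the sum of adjoint orbits $\sum_{i=1}^k O_{X_i}\subset\mathfrak{su}(m)$ (respectively the product of conjugacy classes $\prod_{i=1}^k C_{x_i}\subset SU(m)$) contains a non-empty open subset of $\mathfrak{su}(m)$ (respectively of $SU(m)$) if and only if both of the following hold: (1) $\sum_{i=1}^k \frac{q_i}{m}\le k-1$; and (2) the tuple of $X_i$ (respectively $x_i$) does not consist of exactly two matrices each with exactly two distinct eigenvalues of equal multiplicity at least two (that is, it is not the case that $k=2$ and each of the two matrices has exactly two distinct eigenvalues, both of multiplicity $m/2\ge 2$).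
   Context: $SU(m)$ is the group of $m\times m$ complex unitary matrices of determinant one and $\mathfrak{su}(m)$ its Lie algebra of traceless skew-Hermitian matrices. For $X\in\mathfrak{su}(m)$ the adjoint orbit is $O_X=\{gXg^{-1}: g\in SU(m)\}$; for $x\in SU(m)$ the conjugacy class is $C_x=\{gxg^{-1}:g\in SU(m)\}$. The sum of orbits is the set $\{Y_1+\cdots+Y_k: Y_i\in O_{X_i}\}$ and the product of classes is $\{y_1\cdots y_k: y_i\in C_{x_i}\}$.
   Formalization: Condition (2) is imposed on the tuple after discarding scalar matrices; read literally with k=2 the claim fails, e.g. m=4, k=3, X_1=X_2=diag(i,i,-i,-i), X_3=0 (or x_3=1 in the group case). For k≤2 or tuples without scalar matrices nothing changes. *)

theory Defs
  imports "HOL-Analysis.Analysis"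
begin

type_synonym 'm cmatrix = "complex^'m^'m"

definition conj_transpose :: "'m::finite cmatrix \<Rightarrow> 'm cmatrix" where
  "conj_transpose A = (\<chi> i j. cnj (A $ j $ i))"

definition su_algebra :: "'m::finite cmatrix set" where
  "su_algebra = {X. conj_transpose X = - X \<and> trace X = 0}"

definition SU_group :: "'m::finite cmatrix set" where
  "SU_group = {g. conj_transpose g ** g = mat 1 \<and> g ** conj_transpose g = mat 1 \<and> det g = 1}"

text \<open>The same formula gives the adjoint orbit of an element of the Lie algebra and the conjugacy
  class of an element of the group.\<close>

definition SU_orbit :: "'m::finite cmatrix \<Rightarrow> 'm cmatrix set" where
  "SU_orbit A = {g ** A ** matrix_inv g | g. g \<in> SU_group}"

definition orbit_sum :: "'m::finite cmatrix list \<Rightarrow> 'm cmatrix set" where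
  "orbit_sum Xs = {sum_list Ys | Ys. list_all2 (\<lambda>Y X. Y \<in> SU_orbit X) Ys Xs}"

text \<open>The library multiplication \<open>(*)\<close> on vectors is componentwise, so \<open>prod_list\<close> would not be
  the matrix product.\<close>

definition class_product :: "'m::finite cmatrix list \<Rightarrow> 'm cmatrix set" where
  "class_product xs = {foldr (**) ys (mat 1) | ys. list_all2 (\<lambda>y x. y \<in> SU_orbit x) ys xs}"

definition contains_nonempty_open_of :: "'a::topological_space set \<Rightarrow> 'a set \<Rightarrow> bool" where
  "contains_nonempty_open_of M S \<longleftrightarrow> (\<exists>U. U \<noteq> {} \<and> openin (top_of_set M) U \<and> U \<subseteq> S)"

definition eigenvalues :: "'m::finite cmatrix \<Rightarrow> complex set" where
  "eigenvalues A = {c. \<exists>v. v \<noteq> 0 \<and> A *v v = c *s v}"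

text \<open>Multiplicity is the complex dimension of the eigenspace. Skew-Hermitian and unitary matrices
  are diagonalizable, so for them it agrees with the algebraic multiplicity.\<close>

definition eig_mult :: "'m::finite cmatrix \<Rightarrow> complex \<Rightarrow> nat" where
  "eig_mult A c = vec.dim {v. A *v v = c *s v}"

definition max_eig_mult :: "'m::finite cmatrix \<Rightarrow> nat" where
  "max_eig_mult A = Max (eig_mult A ` eigenvalues A)"

definition two_equal_eigenvalues :: "'m::finite cmatrix \<Rightarrow> bool" where
  "two_equal_eigenvalues A \<longleftrightarrow> card (eigenvalues A) = 2 \<and>
     (\<forall>c \<in> eigenvalues A. 2 \<le> eig_mult A c \<and> 2 * eig_mult A c = CARD('m))"

definition exceptional_pair :: "'m::finite cmatrix list \<Rightarrow> bool" where
  "exceptional_pair Xs \<longleftrightarrow> length Xs = 2 \<and> (\<forall>X \<in> set Xs. two_equal_eigenvalues X)"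

text \<open>Scalar matrices have one-point orbits. Adjoining such an entry \<open>X\<close> to a tuple only translates
  the sum (or product) and preserves the inequality between the multiplicities, as it adds \<open>m/m = 1\<close>
  to the left-hand side and increases \<open>k\<close> by one. An exceptional pair padded with scalar matrices is
  therefore as exceptional as the pair itself, and the exceptional condition has to be read on the
  tuple of nonscalar entries. The two lemmas after the definition show that this changes nothing
  unless \<open>k \<ge> 3\<close> and some entry is scalar.\<close>

definition nonscalar_entries :: "'m::finite cmatrix list \<Rightarrow> 'm cmatrix list" where
  "nonscalar_entries Xs = filter (\<lambda>X. X \<notin> range mat) Xs"

lemma exceptional_pair_nonscalar_entries_id:
  assumes "\<forall>X \<in> set Xs. X \<notin> range mat"
  shows "exceptional_pair (nonscalar_entries Xs) \<longleftrightarrow> exceptional_pair Xs"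
  using assms by (simp add: nonscalar_entries_def)

lemma eigenvalues_mat: "eigenvalues (mat c :: 'm::finite cmatrix) \<subseteq> {c}"
proof -
  have "(mat c :: 'm cmatrix) *v v = c *s v" for v
    by (simp add: vec_eq_iff matrix_vector_mult_def mat_def if_distrib if_distribR sum.delta
        cong: if_cong)
  then show ?thesis
    by (auto simp: eigenvalues_def vec.scale_right_imp_eq)
qed

lemma exceptional_pair_nonscalar_entries_short:
  assumes "length Xs \<le> 2"
  shows "exceptional_pair (nonscalar_entries Xs) \<longleftrightarrow> exceptional_pair Xs"
proof
  assume *: "exceptional_pair (nonscalar_entries Xs)"
  then have "length (filter (\<lambda>X. X \<notin> range mat) Xs) = length Xs"
    using assms length_filter_le[of "\<lambda>X. X \<notin> range mat" Xs]
    by (simp add: exceptional_pair_def nonscalar_entries_def)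
  then have "\<forall>X \<in> set Xs. X \<notin> range mat"
    using length_filter_less[of _ Xs "\<lambda>X. X \<notin> range mat"] by fastforce
  then show "exceptional_pair Xs"
    using * exceptional_pair_nonscalar_entries_id by blast
next
  assume *: "exceptional_pair Xs"
  have "X \<notin> range mat" if "X \<in> set Xs" for X
  proof
    assume "X \<in> range mat"
    then obtain c where "eigenvalues X \<subseteq> {c}"
      using eigenvalues_mat by blast
    then have "card (eigenvalues X) \<le> 1"
      using card_mono[of "{c}"] by fastforce
    moreover have "card (eigenvalues X) = 2"
      using * that by (simp add: exceptional_pair_def two_equal_eigenvalues_def)
    ultimately show False by simp
  qed
  then show "exceptional_pair (nonscalar_entries Xs)"
    using * exceptional_pair_nonscalar_entries_id by blast
qed

end

theory Submission
  imports Defs "HOL-Computational_Algebra.Fundamental_Theorem_Algebra"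
begin

text \<open>Moving the entries \<open>Y\<^sub>i\<close> of a tuple inside their orbits, the differential of the sum (and, after
  translation to the identity, of the product) is onto if and only if no nonscalar matrix commutes
  with all \<open>Y\<^sub>i\<close>. So an irreducible tuple in the orbits yields an open subset, by the open mapping theorem.

  To find one, choose the \<open>Y\<^sub>i\<close> such that the span of all \<open>[H, Y\<^sub>i]\<close> has maximal dimension. The
  first-order condition for the maximum says that \<open>\<Sum>\<^sub>i [H\<^sub>i, Y\<^sub>i] = 0\<close> implies \<open>[[K, H\<^sub>j], Y\<^sub>j] = 0\<close> for
  every \<open>K\<close> commuting with all \<open>Y\<^sub>i\<close>. If \<open>K = P\<close> is a projection of rank \<open>p\<close>, and \<open>r = m - p\<close>, this makes
  the subspaces \<open>[P M (1 - P), Y\<^sub>i]\<close> of the \<open>pr\<close>-dimensional space \<open>P M (1 - P)\<close> independent, where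
  \<open>M\<close> is the space of all matrices. The \<open>i\<close>-th of them has codimension
  \<open>\<Sum>\<^sub>c p\<^sub>c r\<^sub>c\<close>, where the eigenvalue \<open>c\<close> of \<open>Y\<^sub>i\<close> has multiplicity \<open>p\<^sub>c\<close> in the range and \<open>r\<^sub>c\<close> in
  the kernel of \<open>P\<close>, and this is at most \<open>q\<^sub>i p r / m\<close>. Hence \<open>\<Sum>\<^sub>i q\<^sub>i / m \<ge> k - 1\<close>, and equality forces
  all eigenvalues of each \<open>Y\<^sub>i\<close> to have equal multiplicities, which leaves only the exceptional pairs.

  Conversely, if \<open>\<Sum>\<^sub>i q\<^sub>i > (k - 1) m\<close> then the largest eigenspaces have a common vector, so that one
  eigenvalue of the sum or product is constant. For an exceptional pair \<open>A, B\<close> the commutator \<open>[A, B]\<close>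
  maps eigenvectors of \<open>A + B\<close> to eigenvectors whose eigenvalues have a fixed sum with the original
  ones, and \<open>A [A, B]\<close> does the same for \<open>A B\<close> with a fixed product; for \<open>m \<ge> 3\<close> an open set contains a
  matrix without such pairs of eigenvalues.\<close>

subsection \<open>Matrix algebra\<close>

text \<open>The span of all commutators \<open>[H, Y_i]\<close> and the commutant of the tuple are
  annihilators of each other under the trace form, so irreducibility is a statement about rank. Rank
  cannot drop under small perturbations, which turns a maximum into a first-order identity, and the
  maximum exists because ranks are bounded integers. A nonscalar Hermitian matrix commuting with the
  tuple has a spectral projection P that is diagonal in a suitable eigenbasis of each entry. On the
  block P M (1 - P) the map [P, -] is the identity, and this converts the first-order identity into
  linear independence. The open mapping theorem used here asks for a derivative at a single point
  only, so Cayley transforms can replace the exponential map: they are rational in G, unitary for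
  skew-Hermitian G, and have derivative 2 G at 0. Neither the Lie algebra nor the group is open
  among all matrices. The orbit map is therefore extended by complementary coordinates to the whole
  matrix space, arranged so that near 0 any value in the Lie algebra or group comes from the
  orbits.\<close>

lemma matrix_mul_add_right: "(A + B) ** C = A ** C + B ** (C :: 'm::finite cmatrix)"
  by (vector matrix_matrix_mult_def sum.distrib[symmetric] field_simps)

lemma matrix_mul_diff_left: "A ** (B - C) = A ** B - A ** (C :: 'm::finite cmatrix)"
  by (vector matrix_matrix_mult_def sum_subtractf[symmetric] field_simps)

lemma matrix_mul_diff_right: "(A - B) ** C = A ** C - B ** (C :: 'm::finite cmatrix)"
  by (vector matrix_matrix_mult_def sum_subtractf[symmetric] field_simps)

lemma matrix_mul_minus_left: "(- A) ** B = - (A ** (B :: 'm::finite cmatrix))"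
  by (vector matrix_matrix_mult_def sum_negf)

lemma matrix_mul_minus_right: "A ** (- B) = - (A ** (B :: 'm::finite cmatrix))"
  by (vector matrix_matrix_mult_def sum_negf)

lemma matrix_mul_scaleR_left: "(r *\<^sub>R A) ** B = r *\<^sub>R (A ** (B :: 'm::finite cmatrix))"
  by (simp add: scalar_matrix_assoc)

lemmas matrix_ring_simps = matrix_add_ldistrib matrix_mul_add_right matrix_mul_diff_left
  matrix_mul_diff_right matrix_mul_minus_left matrix_mul_minus_right matrix_mul_assoc
  matrix_mul_scaleR_left matrix_scalar_ac

lemma matrix_mul_sum_left: "A ** sum f I = (\<Sum>i\<in>I. A ** (f i :: 'm::finite cmatrix))"
  by (induction I rule: infinite_finite_induct) (simp_all add: matrix_add_ldistrib)

lemma matrix_mul_sum_right: "sum f I ** A = (\<Sum>i\<in>I. f i ** (A :: 'm::finite cmatrix))"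
  by (induction I rule: infinite_finite_induct) (simp_all add: matrix_mul_add_right)

lemma mat_nth: "mat c $ i $ j = (if i = j then c else 0)"
  by (simp add: mat_def)

lemma mat_mul_nth [simp]: "(mat c ** A) $ i $ j = c * (A :: 'm::finite cmatrix) $ i $ j"
  by (simp add: matrix_matrix_mult_def mat_def if_distrib[of "\<lambda>x. x * _"] cong: if_cong)

lemma mul_mat_nth [simp]: "(A ** mat c) $ i $ j = c * (A :: 'm::finite cmatrix) $ i $ j"
  by (simp add: matrix_matrix_mult_def mat_def if_distrib[of "\<lambda>x. _ * x"] mult.commute cong: if_cong)

lemma mat_commute: "A ** mat c = mat c ** (A :: 'm::finite cmatrix)"
  by (simp add: vec_eq_iff)

lemma mat_mul_mat: "mat a ** mat b = (mat (a * b) :: 'm::finite cmatrix)"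
  by (simp add: vec_eq_iff mat_nth)

lemma mat_add: "mat a + mat b = (mat (a + b) :: 'm::finite cmatrix)"
  by (simp add: vec_eq_iff mat_def)

lemma mat_vector [simp]: "(mat c :: 'm::finite cmatrix) *v v = c *s v"
  by (simp add: vec_eq_iff matrix_vector_mult_def mat_def if_distrib if_distribR sum.delta
      cong: if_cong)

lemma matrix_vector_scale: "A *v (c *s v) = c *s ((A :: 'm::finite cmatrix) *v v)"
  by (simp add: vec_eq_iff matrix_vector_mult_def sum_distrib_left mult_ac)

section \<open>Conjugate transpose and the real trace inner product\<close>

abbreviation adj :: "'m::finite cmatrix \<Rightarrow> 'm cmatrix"  ("_\<^sup>H" [1000] 1000)
  where "adj \<equiv> conj_transpose"

lemma adj_nth [simp]: "A\<^sup>H $ i $ j = cnj (A $ j $ i)"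
  by (simp add: conj_transpose_def)

lemma adj_adj [simp]: "A\<^sup>H\<^sup>H = A"
  by (simp add: vec_eq_iff)

lemma adj_mul: "(A ** B)\<^sup>H = B\<^sup>H ** A\<^sup>H"
  by (simp add: vec_eq_iff matrix_matrix_mult_def mult.commute)

lemma adj_add: "(A + B)\<^sup>H = A\<^sup>H + B\<^sup>H"
  by (simp add: vec_eq_iff)

lemma adj_diff: "(A - B)\<^sup>H = A\<^sup>H - B\<^sup>H"
  by (simp add: vec_eq_iff)

lemma adj_minus: "(- A)\<^sup>H = - A\<^sup>H"
  by (simp add: vec_eq_iff)

lemma adj_scaleR: "(r *\<^sub>R A)\<^sup>H = r *\<^sub>R A\<^sup>H"
  by (simp add: vec_eq_iff)

lemma adj_mat [simp]: "(mat c)\<^sup>H = mat (cnj c)"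
  by (simp add: vec_eq_iff mat_def)

lemma adj_0 [simp]: "0\<^sup>H = 0"
  by (simp add: vec_eq_iff)

lemmas adj_simps = adj_mul adj_add adj_diff adj_minus adj_scaleR

lemma inner_cmatrix: "A \<bullet> B = Re (trace (A\<^sup>H ** (B :: 'm::finite cmatrix)))"
proof -
  have "A \<bullet> B = (\<Sum>j\<in>UNIV. \<Sum>i\<in>UNIV. A $ i $ j \<bullet> B $ i $ j)"
    unfolding inner_vec_def by (rule sum.swap)
  then show ?thesis
    by (simp add: trace_def matrix_matrix_mult_def inner_complex_def)
qed

lemma norm_cmatrix_sq: "norm A ^ 2 = Re (trace (A\<^sup>H ** (A :: 'm::finite cmatrix)))"
  by (simp add: power2_norm_eq_inner inner_cmatrix)

lemma inner_mul_left: "((A :: 'm::finite cmatrix) ** B) \<bullet> C = B \<bullet> (A\<^sup>H ** (C :: 'm::finite cmatrix))"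
  by (simp add: inner_cmatrix adj_mul matrix_mul_assoc)

lemma inner_mul_right: "((A :: 'm::finite cmatrix) ** B) \<bullet> C = A \<bullet> (C ** (B :: 'm::finite cmatrix)\<^sup>H)"
  using trace_mul_sym[of "B\<^sup>H" "A\<^sup>H ** C"] by (simp add: inner_cmatrix adj_mul matrix_mul_assoc)

lemma bounded_bilinear_cmatrix_mul:
  "bounded_bilinear ((**) :: 'm::finite cmatrix \<Rightarrow> 'm cmatrix \<Rightarrow> 'm cmatrix)"
proof -
  have "bilinear ((**) :: 'm cmatrix \<Rightarrow> 'm cmatrix \<Rightarrow> 'm cmatrix)"
    by (auto simp: bilinear_def intro!: linearI simp: matrix_ring_simps)
  then show ?thesis
    by (simp add: bilinear_conv_bounded_bilinear)
qed

lemmas continuous_on_cmatrix_mul [continuous_intros] =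
  bounded_bilinear.continuous_on [OF bounded_bilinear_cmatrix_mul]

lemmas tendsto_cmatrix_mul [tendsto_intros] =
  bounded_bilinear.tendsto [OF bounded_bilinear_cmatrix_mul]

lemmas has_derivative_cmatrix_mul =
  bounded_bilinear.FDERIV [OF bounded_bilinear_cmatrix_mul]

lemma bounded_linear_adj: "bounded_linear (adj :: 'm::finite cmatrix \<Rightarrow> 'm cmatrix)"
  by (rule linear_conv_bounded_linear[THEN iffD1]) (auto intro!: linearI simp: adj_simps)

lemmas continuous_on_adj [continuous_intros] =
  bounded_linear.continuous_on [OF bounded_linear_adj]

lemmas has_derivative_adj = bounded_linear.has_derivative [OF bounded_linear_adj]

section \<open>Unitary conjugation and orbits\<close>

definition unitary :: "'m::finite cmatrix \<Rightarrow> bool" where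
  "unitary U \<longleftrightarrow> U\<^sup>H ** U = mat 1 \<and> U ** U\<^sup>H = mat 1"

lemma unitaryI: "U\<^sup>H ** U = mat 1 \<Longrightarrow> unitary U"
  using matrix_left_right_inverse unfolding unitary_def by blast

lemma unitary_cancel [simp]:
  assumes "unitary U"
  shows "U\<^sup>H ** U = mat 1" "U ** U\<^sup>H = mat 1" "A ** U\<^sup>H ** U = A" "A ** U ** U\<^sup>H = A"
  using assms by (simp_all add: unitary_def flip: matrix_mul_assoc)

lemma unitary_adj: "unitary U \<Longrightarrow> unitary U\<^sup>H"
  by (intro unitaryI) simp

lemma unitary_mul: "unitary U \<Longrightarrow> unitary V \<Longrightarrow> unitary (U ** V)"
  by (intro unitaryI) (simp add: adj_mul matrix_mul_assoc)

lemma matrix_inv_eq: "A ** B = mat 1 \<Longrightarrow> matrix_inv (A :: 'm::finite cmatrix) = B"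
proof -
  assume AB: "A ** B = mat 1"
  then have BA: "B ** A = mat 1"
    using matrix_left_right_inverse by blast
  have "A ** matrix_inv A = mat 1 \<and> matrix_inv A ** A = mat 1"
    unfolding matrix_inv_def by (rule someI[of _ B]) (use AB BA in blast)
  then show "matrix_inv A = B"
    using BA matrix_mul_assoc[of B A "matrix_inv A"] by simp
qed

lemma matrix_inv_unitary: "unitary U \<Longrightarrow> matrix_inv U = U\<^sup>H"
  by (rule matrix_inv_eq) simp

lemma det_adj: "det (A\<^sup>H) = cnj (det A)"
proof -
  have "det (A\<^sup>H) = det (\<chi> i j. cnj (transpose A $ i $ j))"
    by (simp add: conj_transpose_def transpose_def)
  also have "\<dots> = cnj (det (transpose A))"
    by (simp add: det_def)
  finally show ?thesis by simp
qed

lemma det_mat_mul: "det (mat c ** A) = c ^ CARD('m) * det (A :: 'm::finite cmatrix)"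
proof -
  have "det (mat c :: 'm cmatrix) = c ^ CARD('m)"
    by (subst det_diagonal) (simp_all add: mat_def)
  then show ?thesis by (simp add: det_mul)
qed

lemma norm_det_unitary: "unitary U \<Longrightarrow> cmod (det U) = 1"
proof -
  assume "unitary U"
  then have "det U\<^sup>H * det U = 1"
    by (simp flip: det_mul)
  then have "cnj (det U) * det U = 1" by (simp add: det_adj)
  then have "of_real ((cmod (det U))\<^sup>2) = (1::complex)"
    unfolding complex_norm_square by (simp add: mult.commute)
  then have "(cmod (det U))\<^sup>2 = 1"
    using of_real_eq_1_iff by blast
  then show ?thesis
    using norm_ge_zero[of "det U"] by (auto simp: power2_eq_1_iff simp del: norm_ge_zero)
qed

lemma SU_group_iff: "g \<in> SU_group \<longleftrightarrow> unitary g \<and> det g = 1"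
  unfolding SU_group_def unitary_def by blast

text \<open>Scalars cancel under conjugation, so any unitary matrix can be normalized to determinant
  one by a scalar of modulus one. From here on only unitarity of the conjugating matrix
  matters.\<close>

lemma SU_orbit_iff: "(A :: 'm::finite cmatrix) \<in> SU_orbit X \<longleftrightarrow> (\<exists>U. unitary U \<and> A = U ** X ** U\<^sup>H)"
proof
  assume "A \<in> SU_orbit X"
  then show "\<exists>U. unitary U \<and> A = U ** X ** U\<^sup>H"
    by (auto simp: SU_orbit_def SU_group_iff matrix_inv_unitary)
next
  assume "\<exists>U. unitary U \<and> A = U ** X ** U\<^sup>H"
  then obtain U where U: "unitary U" and A: "A = U ** X ** U\<^sup>H" by blast
  \<comment> \<open>An m-th root of the inverse of \<open>det U\<close>, which has modulus
    one.\<close>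
  define c where "c = cis (- Arg (det U) / CARD('m))"
  define g where "g = mat c ** U"
  have cc: "c * cnj c = 1" "cnj c * c = 1"
    unfolding c_def by (simp_all add: cis_cnj cis_mult)
  have "c ^ CARD('m) = cis (- Arg (det U))"
    unfolding c_def by (subst Complex.DeMoivre) simp
  moreover have "det U = cis (Arg (det U))"
    using norm_det_unitary[OF U] cis_Arg[of "det U"] by (cases "det U = 0") (auto simp: sgn_eq)
  ultimately have "det g = 1"
    unfolding g_def det_mat_mul by (metis add.left_inverse cis_mult cis_zero)
  have gH: "g\<^sup>H = U\<^sup>H ** mat (cnj c)"
    by (simp add: g_def adj_mul)
  have ug: "unitary g"
  proof (rule unitaryI)
    have "g\<^sup>H ** g = U\<^sup>H ** (mat (cnj c) ** mat c) ** U"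
      unfolding gH by (simp add: g_def matrix_mul_assoc)
    then show "g\<^sup>H ** g = mat 1"
      using U by (simp add: mat_mul_mat cc)
  qed
  have "g ** X ** matrix_inv g = (mat c ** (U ** X ** U\<^sup>H)) ** mat (cnj c)"
    unfolding matrix_inv_unitary[OF ug] gH unfolding g_def
    by (simp only: matrix_mul_assoc)
  also have "\<dots> = mat (c * cnj c) ** (U ** X ** U\<^sup>H)"
    unfolding vec_eq_iff by (simp only: mul_mat_nth mat_mul_nth mult_ac) simp
  finally have "g ** X ** matrix_inv g = mat (c * cnj c) ** (U ** X ** U\<^sup>H)" .
  then have "A = g ** X ** matrix_inv g"
    by (simp add: A cc)
  then show "A \<in> SU_orbit X"
    using ug \<open>det g = 1\<close> by (auto simp: SU_orbit_def SU_group_iff)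
qed

section \<open>Diagonal matrices and eigenvalue multiplicities\<close>

definition diag_matrix :: "('m::finite \<Rightarrow> complex) \<Rightarrow> 'm cmatrix" where
  "diag_matrix d = (\<chi> i j. if i = j then d i else 0)"

lemma diag_mul_nth [simp]: "(diag_matrix d ** A) $ i $ j = d i * A $ i $ j"
  by (simp add: matrix_matrix_mult_def diag_matrix_def if_distrib[of "\<lambda>x. x * _"] cong: if_cong)

lemma mul_diag_nth [simp]: "(A ** diag_matrix d) $ i $ j = A $ i $ j * d j"
  by (simp add: matrix_matrix_mult_def diag_matrix_def if_distrib[of "\<lambda>x. _ * x"] cong: if_cong)

lemma diag_vector_nth [simp]: "(diag_matrix d *v v) $ i = d i * v $ i"
  by (simp add: matrix_vector_mult_def diag_matrix_def if_distrib[of "\<lambda>x. x * _"] cong: if_cong)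

lemma diag_nth: "diag_matrix d $ i $ j = (if i = j then d i else 0)"
  by (simp add: diag_matrix_def)

lemma adj_diag: "(diag_matrix d)\<^sup>H = diag_matrix (\<lambda>i. cnj (d i))"
  by (auto simp: vec_eq_iff diag_nth)

lemma det_diag_matrix: "det (diag_matrix d) = (\<Prod>i\<in>UNIV. d i)"
  by (subst det_diagonal) (simp_all add: diag_nth)

lemma trace_conj_unitary: "unitary U \<Longrightarrow> trace (U ** A ** U\<^sup>H) = trace A"
  using trace_mul_sym[of "U ** A" "U\<^sup>H"] by (simp add: matrix_mul_assoc)

text \<open>U carries the coordinate subspace of the indices j with \<open>d j = c\<close> onto the
  eigenspace of c. This reduces all later multiplicities to counting indices.\<close>

lemma eig_mult_diag:
  assumes "unitary U" "X = U ** diag_matrix d ** U\<^sup>H"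
  shows "eig_mult X c = card {j. d j = c}"
proof -
  let ?W = "{w :: complex^'a. \<forall>j. j \<notin> {j. d j = c} \<longrightarrow> w $ j = 0}"
  have "{v. X *v v = c *s v} = (*v) U ` ?W"
  proof (intro set_eqI iffI)
    fix v assume "v \<in> {v. X *v v = c *s v}"
    then have v: "X *v v = c *s v" by simp
    have "diag_matrix d *v (U\<^sup>H *v v) = U\<^sup>H *v (X *v v)"
      using assms by (simp add: matrix_vector_mul_assoc matrix_mul_assoc)
    also have "\<dots> = c *s (U\<^sup>H *v v)"
      by (simp add: v matrix_vector_scale)
    finally have "d j * (U\<^sup>H *v v) $ j = c * (U\<^sup>H *v v) $ j" for j
      by (metis diag_vector_nth vector_smult_component)
    then have "U\<^sup>H *v v \<in> ?W" by auto
    moreover have "v = U *v (U\<^sup>H *v v)"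
      using assms(1) by (simp add: matrix_vector_mul_assoc)
    ultimately show "v \<in> (*v) U ` ?W" by blast
  next
    fix v assume "v \<in> (*v) U ` ?W"
    then obtain w where w: "w \<in> ?W" and v: "v = U *v w" by blast
    have "diag_matrix d *v w = c *s w"
      using w by (auto simp: vec_eq_iff)
    moreover have "X *v v = U *v (diag_matrix d *v w)"
      using assms v by (simp add: matrix_vector_mul_assoc)
    ultimately show "v \<in> {v. X *v v = c *s v}"
      by (simp add: v matrix_vector_scale)
  qed
  moreover have "inj ((*v) U)"
    using assms(1) by (intro inj_on_inverseI[of _ "(*v) U\<^sup>H"]) (simp add: matrix_vector_mul_assoc)
  then have "vec.dim ((*v) U ` ?W) = vec.dim ?W"
    by (intro vec.dim_image_eq) (auto intro: inj_on_subset)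
  ultimately show ?thesis
    using dim_substandard_cart[of "{j. d j = c}"] by (simp add: eig_mult_def)
qed

lemma eigenvalues_eq: "eigenvalues (X :: 'm::finite cmatrix) = {c. eig_mult X c > 0}"
proof -
  have "(\<exists>v. v \<noteq> 0 \<and> X *v v = c *s v) \<longleftrightarrow> vec.dim {v. X *v v = c *s v} > 0" for c
  proof -
    have "vec.dim {v. X *v v = c *s v} = 0 \<longleftrightarrow> {v. X *v v = c *s v} \<subseteq> {0}"
      by (rule vec.dim_eq_0)
    moreover have "(\<exists>v. v \<noteq> 0 \<and> X *v v = c *s v) \<longleftrightarrow> \<not> {v. X *v v = c *s v} \<subseteq> {0}"
      by blast
    ultimately show ?thesis by (simp only: zero_less_iff_neq_zero not_not simp_thms)
  qed
  then show ?thesis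
    by (simp add: eigenvalues_def eig_mult_def)
qed

lemma eigenvalues_diag:
  assumes "unitary U" "X = U ** diag_matrix d ** U\<^sup>H"
  shows "eigenvalues X = range d"
  unfolding eigenvalues_eq eig_mult_diag[OF assms] by (auto simp: card_gt_0_iff)

subsection \<open>Unitary diagonalization\<close>

lemma cdim_le: "vec.dim (S :: (complex^'m::finite) set) \<le> CARD('m)"
  using vec.dim_subset[OF subset_UNIV, of S] by (simp add: vec_dim_card card_cart_basis)

text \<open>The Hermitian inner product, conjugate-linear in the first argument. The type class
  \<open>inner\<close> is only its real part and does not express complex orthogonality.\<close>

definition cinner :: "complex^'m::finite \<Rightarrow> complex^'m \<Rightarrow> complex" where
  "cinner x y = (\<Sum>i\<in>UNIV. cnj (x $ i) * y $ i)"

lemma cinner_add_right: "cinner x (y + z) = cinner x y + cinner x z"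
  by (simp add: cinner_def distrib_left sum.distrib)

lemma cinner_diff_right: "cinner x (y - z) = cinner x y - cinner x z"
  by (simp add: cinner_def right_diff_distrib sum_subtractf)

lemma cinner_scale_right: "cinner x (c *s y) = c * cinner x y"
  by (simp add: cinner_def sum_distrib_left mult_ac)

lemma cinner_scale_left: "cinner (c *s x) y = cnj c * cinner x y"
  by (simp add: cinner_def sum_distrib_left mult_ac)

lemma cinner_0_right [simp]: "cinner x 0 = 0"
  by (simp add: cinner_def)

lemma cinner_sum_right: "cinner x (sum f I) = (\<Sum>i\<in>I. cinner x (f i))"
  by (induction I rule: infinite_finite_induct) (simp_all add: cinner_add_right)

lemma cinner_commute: "cinner y x = cnj (cinner x y)"
  by (simp add: cinner_def mult.commute)

lemma cinner_adj: "cinner x (A *v y) = cinner (A\<^sup>H *v x) y"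
proof -
  have "cinner x (A *v y) = (\<Sum>i\<in>UNIV. \<Sum>j\<in>UNIV. cnj (x $ i) * A $ i $ j * y $ j)"
    by (simp add: cinner_def matrix_vector_mult_def sum_distrib_left mult.assoc)
  also have "\<dots> = (\<Sum>j\<in>UNIV. \<Sum>i\<in>UNIV. cnj (x $ i) * A $ i $ j * y $ j)"
    by (rule sum.swap)
  also have "\<dots> = cinner (A\<^sup>H *v x) y"
    by (simp add: cinner_def matrix_vector_mult_def sum_distrib_left sum_distrib_right mult_ac)
  finally show ?thesis .
qed

lemma cinner_self: "cinner x x = of_real (\<Sum>i\<in>UNIV. (cmod (x $ i))\<^sup>2)"
  unfolding cinner_def of_real_sum by (intro sum.cong refl) (simp add: complex_norm_square[unfolded of_real_power] mult.commute)

lemma cinner_self_eq_0: "cinner x x = 0 \<longleftrightarrow> x = 0"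
  unfolding cinner_self of_real_eq_0_iff by (subst sum_nonneg_eq_0_iff) (auto simp: vec_eq_iff)

text \<open>This is the vector p(A) v, by Horner's rule. The type class multiplication of matrices
  is componentwise, so \<open>poly\<close> would not evaluate p at A.\<close>

definition poly_act :: "'m::finite cmatrix \<Rightarrow> complex poly \<Rightarrow> complex^'m \<Rightarrow> complex^'m" where
  "poly_act A p v = fold_coeffs (\<lambda>a w. a *s v + A *v w) p 0"

lemma poly_act_0 [simp]: "poly_act A 0 v = 0"
  by (simp add: poly_act_def)

lemma poly_act_pCons [simp]: "poly_act A (pCons a p) v = a *s v + A *v poly_act A p v"
  by (cases "p = 0 \<and> a = 0") (auto simp: poly_act_def)

lemma poly_act_add: "poly_act A (p + q) v = poly_act A p v + poly_act A q v"
  by (induction p q rule: poly_induct2)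
    (simp_all add: matrix_vector_right_distrib vec.scale_left_distrib algebra_simps)

lemma poly_act_smult: "poly_act A (smult c p) v = c *s poly_act A p v"
  by (induction p)
    (simp_all add: matrix_vector_scale vec.scale_right_distrib)

lemma poly_act_sum: "poly_act A (sum f I) v = (\<Sum>i\<in>I. poly_act A (f i) v)"
  by (induction I rule: infinite_finite_induct) (simp_all add: poly_act_add)

lemma poly_act_diff: "poly_act A (p - q) v = poly_act A p v - poly_act A q v"
  using poly_act_add[of A "p - q" q v] by (simp add: algebra_simps)

lemma poly_act_linear_mul:
  "poly_act A ([:- r, 1:] * q) v = A *v poly_act A q v - r *s poly_act A q v"
  by (simp add: poly_act_diff poly_act_smult)

lemma poly_act_in_subspace:
  assumes "vec.subspace W" "\<And>x. x \<in> W \<Longrightarrow> A *v x \<in> W" "v \<in> W"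
  shows "poly_act A p v \<in> W"
  using assms by (induction p) (simp_all add: vec.subspace_0 vec.subspace_add vec.subspace_scale)

text \<open>The m + 1 vectors v, A v, ..., A^m v in a space of dimension m satisfy a linear
  relation.\<close>

lemma annihilating_poly:
  fixes v :: "complex^'m::finite"
  obtains p where "p \<noteq> 0" "poly_act A p v = 0"
proof -
  define f where "f = (\<lambda>i. poly_act A (monom 1 i) v)"
  \<comment> \<open>Two equal vectors in the list are treated apart: they make the set of vectors
    smaller, not dependent.\<close>
  show thesis
  proof (cases "inj_on f {..CARD('m)}")
    case False
    then obtain i j where ij: "i \<noteq> j" "f i = f j"
      by (auto simp: inj_on_def)
    have "poly_act A (monom 1 i - monom 1 j) v = 0"
      using ij(2) by (simp add: poly_act_diff f_def)
    moreover have "coeff (monom 1 i - monom (1::complex) j) i \<noteq> 0"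
      using ij(1) by simp
    then have "monom 1 i - monom (1::complex) j \<noteq> 0"
      by (metis coeff_0)
    ultimately show thesis using that by blast
  next
    case True
    then have "card (f ` {..CARD('m)}) = CARD('m) + 1"
      by (simp add: card_image)
    moreover have "vec.dim (f ` {..CARD('m)}) \<le> CARD('m)"
      by (rule cdim_le)
    ultimately have "vec.dependent (f ` {..CARD('m)})"
      using vec.dim_eq_card_independent by fastforce
    then obtain u w where u: "w \<in> f ` {..CARD('m)}" "u w \<noteq> 0"
      "(\<Sum>v\<in>f ` {..CARD('m)}. u v *s v) = 0"
      by (subst (asm) vec.dependent_finite) auto
    define p where "p = (\<Sum>i\<le>CARD('m). monom (u (f i)) i)"
    have "poly_act A p v = (\<Sum>i\<le>CARD('m). u (f i) *s f i)"
      unfolding p_def poly_act_sum f_def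
      by (intro sum.cong refl) (metis mult.right_neutral poly_act_smult smult_monom)
    also have "\<dots> = 0"
      using u(3) by (simp add: sum.reindex[OF True])
    finally have "poly_act A p v = 0" .
    moreover obtain i where i: "i \<le> CARD('m)" "w = f i"
      using u(1) by auto
    have "coeff p i = u (f i)"
      unfolding p_def coeff_sum using i(1) by (simp add: coeff_monom)
    then have "p \<noteq> 0"
      using u(2) i(2) by auto
    ultimately show thesis using that by blast
  qed
qed

text \<open>For a nonzero v in W take p of least degree with p(A) v = 0 and split off a root z, so
  that p = (t - z) q. By minimality q(A) v is nonzero, hence an eigenvector for z, and invariance
  keeps it in W.\<close>

lemma eigenvector_in_invariant_subspace:
  fixes W :: "(complex^'m::finite) set"
  assumes W: "vec.subspace W" "\<And>x. x \<in> W \<Longrightarrow> A *v x \<in> W" "W \<noteq> {0}"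
  obtains v c where "v \<in> W" "v \<noteq> 0" "A *v v = c *s v"
proof -
  obtain v where v: "v \<in> W" "v \<noteq> 0"
    using W(1,3) vec.subspace_0 by blast
  define P where "P p \<longleftrightarrow> p \<noteq> 0 \<and> poly_act A p v = 0" for p
  obtain p0 where "P p0"
    using annihilating_poly unfolding P_def by blast
  then obtain p where p: "P p" and min: "\<And>q. P q \<Longrightarrow> degree p \<le> degree q"
    using ex_has_least_nat[of P p0 degree] by blast
  have "\<not> constant (poly p)"
  proof
    assume "constant (poly p)"
    then have "degree p = 0"
      by (simp add: constant_degree)
    then obtain a where "p = [:a:]"
      by (rule degree_eq_zeroE)
    then show False
      using p v by (simp add: P_def)
  qed
  then obtain z where "poly p z = 0"
    using fundamental_theorem_of_algebra by blast
  then obtain q where q: "p = [:- z, 1:] * q"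
    unfolding poly_eq_0_iff_dvd by blast
  have "q \<noteq> 0"
    using p q by (auto simp: P_def)
  then have "degree q < degree p"
    unfolding q by (subst degree_mult_eq) auto
  then have "poly_act A q v \<noteq> 0"
    using min[of q] \<open>q \<noteq> 0\<close> by (auto simp: P_def)
  moreover have "A *v poly_act A q v = z *s poly_act A q v"
    using p by (simp add: P_def q poly_act_linear_mul del: mult_pCons_left)
  ultimately show thesis
    using that poly_act_in_subspace[OF W(1,2) v(1)] by blast
qed

text \<open>Descent on the dimension: if some A in S is not scalar on W, an eigenspace of A inside W
  is a smaller nonzero subspace, still invariant because S is commutative.\<close>

lemma common_eigenvector:
  fixes W :: "(complex^'m::finite) set"
  assumes comm: "\<And>A B. A \<in> S \<Longrightarrow> B \<in> S \<Longrightarrow> A ** B = B ** A"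
  assumes "vec.subspace W" "\<And>A x. A \<in> S \<Longrightarrow> x \<in> W \<Longrightarrow> A *v x \<in> W" "W \<noteq> {0}"
  shows "\<exists>v\<in>W. v \<noteq> 0 \<and> (\<forall>A\<in>S. \<exists>c. A *v v = c *s v)"
  using assms(2-)
proof (induction "vec.dim W" arbitrary: W rule: less_induct)
  case (less W)
  show ?case
  proof (cases "\<forall>A\<in>S. \<exists>c. \<forall>x\<in>W. A *v x = c *s x")
    case True
    then show ?thesis
      using less.prems vec.subspace_0 by blast
  next
    case False
    then obtain A where A: "A \<in> S" "\<And>c. \<exists>x\<in>W. A *v x \<noteq> c *s x" by blast
    obtain v c where v: "v \<in> W" "v \<noteq> 0" "A *v v = c *s v"
      using eigenvector_in_invariant_subspace[of W A] less.prems A(1) by metis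
    define W' where "W' = {x \<in> W. A *v x = c *s x}"
    have sub: "vec.subspace W'"
      using less.prems(1) unfolding W'_def vec.subspace_def
      by (auto simp: matrix_vector_right_distrib matrix_vector_scale vec.scale_right_distrib
          mult.commute)
    have "W' \<noteq> W"
      using A(2)[of c] by (auto simp: W'_def)
    then have "vec.dim W' < vec.dim W"
      using vec.subspace_dim_equal[OF sub less.prems(1)] by (force simp: W'_def)
    moreover have "B *v x \<in> W'" if "B \<in> S" "x \<in> W'" for B x
      using that less.prems(2) comm[OF A(1) that(1)]
      by (auto simp: W'_def matrix_vector_mul_assoc)
        (metis matrix_vector_mul_assoc matrix_vector_scale)
    moreover have "W' \<noteq> {0}"
      using v by (auto simp: W'_def)
    ultimately obtain x where "x \<in> W'" "x \<noteq> 0" "\<forall>A\<in>S. \<exists>c. A *v x = c *s x"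
      using less.hyps[of W'] sub by blast
    then show ?thesis by (auto simp: W'_def)
  qed
qed

definition orthonormal :: "(complex^'m::finite) set \<Rightarrow> bool" where
  "orthonormal B \<longleftrightarrow> (\<forall>x\<in>B. \<forall>y\<in>B. cinner x y = (if x = y then 1 else 0))"

lemma orthonormal_independent:
  assumes "orthonormal B"
  shows "vec.independent B"
proof
  assume "vec.dependent B"
  then obtain T u w where T: "finite T" "T \<subseteq> B" "(\<Sum>v\<in>T. u v *s v) = 0" "w \<in> T" "u w \<noteq> 0"
    unfolding vec.dependent_explicit by blast
  have "0 = (\<Sum>v\<in>T. u v * cinner w v)"
    using arg_cong[OF T(3), of "cinner w"] by (simp add: cinner_sum_right cinner_scale_right)
  also have "\<dots> = (\<Sum>v\<in>T. if v = w then u w else 0)"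
    using assms T(2,4) unfolding orthonormal_def by (intro sum.cong refl) (simp add: subset_iff)
  also have "\<dots> = u w"
    using T by simp
  finally show False using T by simp
qed

text \<open>A maximal orthonormal set of common eigenvectors is a basis. Since S is closed under
  adjoints, its orthogonal complement is invariant, and a nonzero complement would contain one more
  common eigenvector.\<close>

theorem unitary_diagonalization:
  fixes S :: "'m::finite cmatrix set"
  assumes comm: "\<And>A B. A \<in> S \<Longrightarrow> B \<in> S \<Longrightarrow> A ** B = B ** A"
    and adj: "\<And>A. A \<in> S \<Longrightarrow> A\<^sup>H \<in> S"
  obtains U d where "unitary U" "\<And>A. A \<in> S \<Longrightarrow> A = U ** diag_matrix (d A) ** U\<^sup>H"
proof -
  define E where "E = {v :: complex^'m. \<forall>A\<in>S. \<exists>c. A *v v = c *s v}"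
  define P where "P B \<longleftrightarrow> orthonormal B \<and> B \<subseteq> E" for B
  have card: "finite B \<and> card B \<le> CARD('m)" if "P B" for B
    using vec.independent_bound_general[OF orthonormal_independent, of B] that
      cdim_le[of B] by (auto simp: P_def)
  have "P {}" by (simp add: P_def orthonormal_def)
  then obtain B where B: "P B" and max: "\<And>C. P C \<Longrightarrow> card C \<le> card B"
    using ex_has_greatest_nat[of P "{}" card "Suc CARD('m)"] card less_Suc_eq_le by blast
  have finB: "finite B" using card[OF B] by simp
  define W where "W = {x. \<forall>b\<in>B. cinner b x = 0}"
  have subW: "vec.subspace W"
    by (auto simp: W_def vec.subspace_def cinner_add_right cinner_scale_right)
  have inv: "A *v x \<in> W" if "A \<in> S" "x \<in> W" for A x
  proof -
    have "cinner b (A *v x) = 0" if "b \<in> B" for b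
    proof -
      obtain c where "A\<^sup>H *v b = c *s b"
        using B \<open>b \<in> B\<close> adj[OF \<open>A \<in> S\<close>] unfolding P_def E_def by blast
      then show ?thesis
        using \<open>x \<in> W\<close> that by (simp add: cinner_adj cinner_scale_left W_def)
    qed
    then show ?thesis by (simp add: W_def)
  qed
  have "W = {0}"
  proof (rule ccontr)
    assume "W \<noteq> {0}"
    then obtain v where v: "v \<in> W" "v \<noteq> 0" "v \<in> E"
      using common_eigenvector[of S W] comm subW inv by (auto simp: E_def)
    define r where "r = sqrt (\<Sum>i\<in>UNIV. (cmod (v $ i))\<^sup>2)"
    have rr: "cinner v v = of_real r * of_real r" "r \<noteq> 0"
    proof -
      have "r * r = (\<Sum>i\<in>UNIV. (cmod (v $ i))\<^sup>2)"
        unfolding r_def by (simp add: sum_nonneg)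
      then show rv: "cinner v v = of_real r * of_real r"
        by (metis cinner_self of_real_mult)
      then show "r \<noteq> 0"
        using cinner_self_eq_0[of v] v(2) by auto
    qed
    define w where "w = of_real (1 / r) *s v"
    have ww: "cinner w w = 1"
      using rr by (simp add: w_def cinner_scale_left cinner_scale_right)
    have wW: "w \<in> W"
      unfolding w_def using v(1) subW by (simp add: vec.subspace_scale)
    have wE: "w \<in> E"
      using v(3) by (auto simp: w_def E_def matrix_vector_scale)
    have "w \<notin> B"
      using wW ww by (auto simp: W_def)
    have "cinner b w = 0 \<and> cinner w b = 0" if "b \<in> B" for b
      using wW that cinner_commute[of w b] by (auto simp: W_def)
    then have "P (insert w B)"
      using B ww wE \<open>w \<notin> B\<close> unfolding P_def orthonormal_def by auto
    then show False
      using max[of "insert w B"] \<open>w \<notin> B\<close> finB by simp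
  qed
  have "x \<in> vec.span B" for x
  proof -
    define y where "y = (\<Sum>b\<in>B. cinner b x *s b)"
    have "cinner b (x - y) = 0" if b: "b \<in> B" for b
    proof -
      have "cinner b y = (\<Sum>b'\<in>B. if b' = b then cinner b x else 0)"
        unfolding y_def cinner_sum_right cinner_scale_right
        using B b unfolding P_def orthonormal_def by (intro sum.cong refl) auto
      then show ?thesis using b finB by (simp add: cinner_diff_right)
    qed
    then have "x - y \<in> W" by (simp add: W_def)
    then have "x = y" using \<open>W = {0}\<close> by simp
    moreover have "y \<in> vec.span B"
      unfolding y_def by (intro vec.span_sum vec.span_scale vec.span_base)
    ultimately show ?thesis by simp
  qed
  then have "vec.span B = UNIV" by blast
  then have "card B = CARD('m)"
    using vec.dim_eq_card[of B UNIV] orthonormal_independent[of B] B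
    by (simp add: P_def vec_dim_card card_cart_basis)
  then obtain h where h: "bij_betw h (UNIV :: 'm set) B"
    using finB by (metis finite_same_card_bij finite)
  define U :: "'m cmatrix" where "U = (\<chi> i j. h j $ i)"
  have hB: "h j \<in> B" for j
    using h by (auto simp: bij_betw_def)
  have hh: "h i = h j \<longleftrightarrow> i = j" for i j
    using h by (auto simp: bij_betw_def inj_on_def)
  have "U\<^sup>H ** U = mat 1"
  proof -
    have "(U\<^sup>H ** U) $ i $ j = cinner (h i) (h j)" for i j
      by (simp add: matrix_matrix_mult_def U_def cinner_def)
    then show ?thesis
      using B hB hh by (auto simp: vec_eq_iff mat_nth P_def orthonormal_def)
  qed
  then have U: "unitary U" by (rule unitaryI)
  have "\<exists>d. A = U ** diag_matrix d ** U\<^sup>H" if A: "A \<in> S" for A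
  proof -
    have "\<forall>j. \<exists>c. A *v h j = c *s h j"
      using B hB A by (auto simp: P_def E_def)
    then obtain d where d: "\<And>j. A *v h j = d j *s h j" by metis
    have "(A ** U) $ i $ j = (U ** diag_matrix d) $ i $ j" for i j
    proof -
      have "(A ** U) $ i $ j = (A *v h j) $ i"
        by (simp add: matrix_matrix_mult_def matrix_vector_mult_def U_def)
      then show ?thesis by (simp add: d U_def)
    qed
    then have "A ** U = U ** diag_matrix d"
      by (simp add: vec_eq_iff)
    then have "A = U ** diag_matrix d ** U\<^sup>H"
      using U by (metis unitary_cancel(4))
    then show ?thesis by blast
  qed
  then obtain d where "\<And>A. A \<in> S \<Longrightarrow> A = U ** diag_matrix (d A) ** U\<^sup>H"
    by metis
  with U show thesis by (rule that)
qed

corollary normal_diagonalization: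
  fixes X :: "'m::finite cmatrix"
  assumes "X ** X\<^sup>H = X\<^sup>H ** X"
  obtains U d where "unitary U" "X = U ** diag_matrix d ** U\<^sup>H"
proof -
  have 1: "A ** B = B ** A" if "A \<in> {X, X\<^sup>H}" "B \<in> {X, X\<^sup>H}" for A B
    using that assms by auto
  have 2: "A\<^sup>H \<in> {X, X\<^sup>H}" if "A \<in> {X, X\<^sup>H}" for A
    using that by auto
  show thesis
    by (rule unitary_diagonalization[OF 1 2]) (use that in blast)+
qed

text \<open>Taking adjoints shows that K commutes with the adjoint of X too, so X, its adjoint and K
  form a commuting family closed under adjoints.\<close>

corollary commuting_diagonalization:
  fixes X :: "'m::finite cmatrix"
  assumes "X ** X\<^sup>H = X\<^sup>H ** X" "K\<^sup>H = K" "K ** X = X ** K"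
  obtains U d e where "unitary U" "X = U ** diag_matrix d ** U\<^sup>H" "K = U ** diag_matrix e ** U\<^sup>H"
proof -
  have c: "K ** X\<^sup>H = X\<^sup>H ** K"
    using arg_cong[OF assms(3), of adj] assms(2) by (simp add: adj_mul)
  have 1: "A ** B = B ** A" if "A \<in> {X, X\<^sup>H, K}" "B \<in> {X, X\<^sup>H, K}" for A B
    using that assms(1,3) c by auto
  have 2: "A\<^sup>H \<in> {X, X\<^sup>H, K}" if "A \<in> {X, X\<^sup>H, K}" for A
    using that assms(2) by auto
  show thesis
    by (rule unitary_diagonalization[OF 1 2]) (use that in blast)+
qed

subsection \<open>Counting and linear independence\<close>

text \<open>If the value c is taken u_c times on E and w_c times outside, then N is the sum of the
  products u_c w_c. The identity \<open>key\<close> writes the defect of the inequality as a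
  combination of three sums of nonnegative terms. Equality makes all three vanish: every value that
  occurs is taken exactly q times, divided between E and its complement in the ratio p : r.\<close>

lemma level_set_count:
  fixes d :: "'m::finite \<Rightarrow> 'c" and E :: "'m set" and q :: nat and N p r :: real
  assumes q: "\<And>c. card {j. d j = c} \<le> q"
  defines "N \<equiv> real (card {(a, b). a \<in> E \<and> b \<notin> E \<and> d a = d b})"
    and "p \<equiv> real (card E)" and "r \<equiv> real (card (- E))"
  shows level_set_count_le: "CARD('m) * N \<le> q * p * r"
    and level_set_count_eq: "CARD('m) * N = q * p * r \<Longrightarrow> 0 < p \<Longrightarrow> 0 < r \<Longrightarrow>
      card {l. d l = d j} = q \<and> r * card {l \<in> E. d l = d j} = p * card {l \<in> - E. d l = d j}"
proof -
  define u where "u c = real (card {l \<in> E. d l = c})" for c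
  define w where "w c = real (card {l \<in> - E. d l = c})" for c
  let ?R = "range d"
  have su: "sum u ?R = p"
  proof -
    have "(\<Sum>c\<in>?R. \<Sum>l\<in>{l \<in> E. d l = c}. 1::real) = (\<Sum>l\<in>E. 1)"
      by (rule sum.group) auto
    then show ?thesis by (simp add: u_def p_def)
  qed
  have sw: "sum w ?R = r"
  proof -
    have "(\<Sum>c\<in>?R. \<Sum>l\<in>{l \<in> - E. d l = c}. 1::real) = (\<Sum>l\<in>- E. 1)"
      by (rule sum.group) auto
    then show ?thesis by (simp add: w_def r_def)
  qed
  have suw: "(\<Sum>c\<in>?R. u c * w c) = N"
  proof -
    let ?S = "{(a, b). a \<in> E \<and> b \<notin> E \<and> d a = d b}"
    have "(\<Sum>c\<in>?R. \<Sum>x\<in>{x \<in> ?S. (d \<circ> fst) x = c}. 1::real) = (\<Sum>x\<in>?S. 1)"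
      by (rule sum.group) (auto intro: finite_subset[OF subset_UNIV])
    moreover have "(\<Sum>x\<in>{x \<in> ?S. (d \<circ> fst) x = c}. 1::real) = u c * w c" for c
    proof -
      have "{x \<in> ?S. (d \<circ> fst) x = c} = {l \<in> E. d l = c} \<times> {l \<in> - E. d l = c}"
        by auto
      then show ?thesis by (simp add: u_def w_def card_cartesian_product)
    qed
    ultimately show ?thesis by (simp add: N_def)
  qed
  have lam: "real (card {j. d j = c}) = u c + w c" for c
  proof -
    have "{j. d j = c} = {l \<in> E. d l = c} \<union> {l \<in> - E. d l = c}" by auto
    then have "card {j. d j = c} = card {l \<in> E. d l = c} + card {l \<in> - E. d l = c}"
      by (simp only:) (subst card_Un_disjoint, auto)
    then show ?thesis by (simp add: u_def w_def)
  qed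
  have le: "u c + w c \<le> q" for c
    using q[of c] lam[of c] by linarith
  have u0: "u c \<ge> 0" and w0: "w c \<ge> 0" for c
    by (simp_all add: u_def w_def)
  \<comment> \<open>\<open>A1\<close> and \<open>A2\<close> measure how far the level sets are from
    having q elements, \<open>A3\<close> how far E is from cutting all of them in the same
    proportion.\<close>
  define A1 where "A1 = (\<Sum>c\<in>?R. u c * (q - (u c + w c)))"
  define A2 where "A2 = (\<Sum>c\<in>?R. w c * (q - (u c + w c)))"
  define A3 where "A3 = (\<Sum>c\<in>?R. (r * u c - p * w c)\<^sup>2)"
  have A0: "A1 \<ge> 0" "A2 \<ge> 0" "A3 \<ge> 0"
    unfolding A1_def A2_def A3_def using u0 w0 le by (auto intro!: sum_nonneg mult_nonneg_nonneg)
  have m: "real (CARD('m)) = p + r"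
  proof -
    have "card (UNIV :: 'm set) = card (E \<union> - E)" by simp
    also have "\<dots> = card E + card (- E)"
      by (rule card_Un_disjoint) auto
    finally show ?thesis by (simp add: p_def r_def)
  qed
  have A1: "A1 = q * p - (\<Sum>c\<in>?R. (u c)\<^sup>2) - N"
    unfolding A1_def su[symmetric] suw[symmetric]
    by (simp add: sum_distrib_left sum_subtractf[symmetric] algebra_simps power2_eq_square
        sum.distrib)
  have A2: "A2 = q * r - (\<Sum>c\<in>?R. (w c)\<^sup>2) - N"
    unfolding A2_def sw[symmetric] suw[symmetric]
    by (simp add: sum_distrib_left sum_subtractf[symmetric] algebra_simps power2_eq_square
        sum.distrib)
  have "A3 = (\<Sum>c\<in>?R. r\<^sup>2 * (u c)\<^sup>2 + p\<^sup>2 * (w c)\<^sup>2 - 2 * p * r * (u c * w c))"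
    unfolding A3_def by (intro sum.cong refl) (simp add: power2_eq_square algebra_simps)
  also have "\<dots> = r\<^sup>2 * (\<Sum>c\<in>?R. (u c)\<^sup>2) + p\<^sup>2 * (\<Sum>c\<in>?R. (w c)\<^sup>2) - 2 * p * r * N"
    by (simp only: sum_subtractf sum.distrib sum_distrib_left[symmetric] suw)
  finally have A3: "A3 = r\<^sup>2 * (\<Sum>c\<in>?R. (u c)\<^sup>2) + p\<^sup>2 * (\<Sum>c\<in>?R. (w c)\<^sup>2) - 2 * p * r * N" .
  have key: "(p + r) * (q * p * r - (p + r) * N) = r\<^sup>2 * A1 + p\<^sup>2 * A2 + A3"
    unfolding A1 A2 A3 by (simp add: power2_eq_square algebra_simps)
  have pos: "p + r > 0"
    unfolding m[symmetric] by simp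
  have "(p + r) * (q * p * r - (p + r) * N) \<ge> 0"
    unfolding key using A0 by simp
  then show "CARD('m) * N \<le> q * p * r"
    unfolding m using pos by (simp add: zero_le_mult_iff)
  assume eq: "CARD('m) * N = q * p * r" and p: "0 < p" and r: "0 < r"
  have "r\<^sup>2 * A1 + p\<^sup>2 * A2 + A3 = 0"
    unfolding key[symmetric] using eq m by simp
  moreover have "r\<^sup>2 * A1 \<ge> 0" "p\<^sup>2 * A2 \<ge> 0"
    using A0 by simp_all
  ultimately have "r\<^sup>2 * A1 = 0" "p\<^sup>2 * A2 = 0" "A3 = 0"
    using A0 by linarith+
  then have z: "A1 = 0" "A2 = 0" "A3 = 0"
    using p r by simp_all
  have "u (d j) * (q - (u (d j) + w (d j))) = 0"
    using z(1) unfolding A1_def by (subst (asm) sum_nonneg_eq_0_iff) (use u0 le in auto)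
  moreover have "w (d j) * (q - (u (d j) + w (d j))) = 0"
    using z(2) unfolding A2_def by (subst (asm) sum_nonneg_eq_0_iff) (use w0 le in auto)
  moreover have "u (d j) + w (d j) > 0"
    unfolding lam[symmetric] by (auto simp: card_gt_0_iff)
  ultimately have "u (d j) + w (d j) = q"
    by (smt (verit) mult_eq_0_iff)
  then have 1: "card {l. d l = d j} = q"
    using lam[of "d j"] by linarith
  have "(r * u (d j) - p * w (d j))\<^sup>2 = 0"
    using z(3) unfolding A3_def by (subst (asm) sum_nonneg_eq_0_iff) auto
  then have "r * u (d j) = p * w (d j)" by simp
  with 1 show "card {l. d l = d j} = q \<and>
      r * card {l \<in> E. d l = d j} = p * card {l \<in> - E. d l = d j}"
    by (simp add: u_def w_def)
qed

text \<open>Independence is an open condition: the linear map L moves each b to its perturbation and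
  stays so close to the identity that it is injective.\<close>

lemma independent_perturbation:
  fixes B :: "'a::euclidean_space set" and f :: "'b \<Rightarrow> 'a \<Rightarrow> 'a"
  assumes B: "independent B" and lim: "\<And>b. b \<in> B \<Longrightarrow> ((\<lambda>t. f t b) \<longlongrightarrow> b) F"
  shows "\<forall>\<^sub>F t in F. independent (f t ` B) \<and> card (f t ` B) = card B"
proof -
  have fin: "finite B" using B by (rule independent_imp_finite)
  define B' where "B' = extend_basis B"
  have B': "independent B'" "B \<subseteq> B'" "span B' = UNIV" "finite B'"
    using B by (simp_all add: B'_def independent_extend_basis extend_basis_superset
        independent_imp_finite)
  define g where "g b x = representation B' x b" for b x
  have lin: "linear (g b)" for b
    unfolding g_def using B' by (intro linearI) (simp_all add: representation_add representation_scale)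
  then have bl: "bounded_linear (g b)" for b
    by (simp add: linear_conv_bounded_linear)
  define K where "K = (\<Sum>b\<in>B. onorm (g b)) + 1"
  have K: "K > 0"
    unfolding K_def using bl by (intro add_nonneg_pos sum_nonneg onorm_pos_le) auto
  define L where "L t x = x + (\<Sum>b\<in>B. g b x *\<^sub>R (f t b - b))" for t x
  have linL: "linear (L t)" for t
    unfolding L_def using lin
    by (intro linearI) (auto simp: linear_add linear_scale algebra_simps sum.distrib
        scaleR_sum_right simp flip: sum.distrib)
  have LB: "L t b = f t b" if "b \<in> B" for t b
  proof -
    have "g b' b = (if b' = b then 1 else 0)" for b'
      unfolding g_def using B' that by (subst representation_basis) auto
    then have "L t b = b + (\<Sum>b'\<in>B. if b' = b then f t b - b else 0)"
      unfolding L_def by (intro arg_cong2[where f=plus] sum.cong) auto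
    then show ?thesis using fin that by simp
  qed
  \<comment> \<open>K exceeds the sum of the norms of the coordinate functionals, so this bound lets
    L displace x by at most half of its norm.\<close>
  have "\<forall>\<^sub>F t in F. \<forall>b\<in>B. norm (f t b - b) < 1 / (2 * K)"
    using lim K fin unfolding tendsto_iff dist_norm by (auto intro!: eventually_ball_finite)
  then show ?thesis
  proof eventually_elim
    case (elim t)
    have "x = 0" if "L t x = 0" for x
    proof -
      have "norm x = norm (\<Sum>b\<in>B. g b x *\<^sub>R (f t b - b))"
        using that unfolding L_def by (metis add_eq_0_iff norm_minus_cancel)
      also have "\<dots> \<le> (\<Sum>b\<in>B. onorm (g b) * norm x * (1 / (2 * K)))"
      proof (intro order.trans[OF norm_sum] sum_mono)
        fix b assume "b \<in> B"
        then have "norm (f t b - b) \<le> 1 / (2 * K)" using elim by fastforce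
        moreover have "\<bar>g b x\<bar> \<le> onorm (g b) * norm x"
          using onorm[OF bl, of b x] by simp
        ultimately have "\<bar>g b x\<bar> * norm (f t b - b) \<le> onorm (g b) * norm x * (1 / (2 * K))"
          by (intro mult_mono) (auto intro: order_trans[OF abs_ge_zero])
        then show "norm (g b x *\<^sub>R (f t b - b)) \<le> onorm (g b) * norm x * (1 / (2 * K))"
          by simp
      qed
      also have "\<dots> = (K - 1) / (2 * K) * norm x"
        unfolding sum_distrib_right[symmetric] by (simp add: K_def)
      also have "\<dots> \<le> 1 / 2 * norm x"
        using K by (intro mult_right_mono) (auto simp: field_simps)
      finally show "x = 0" by simp
    qed
    then have "inj (L t)"
      using linL linear_injective_0 by blast
    moreover have "f t ` B = L t ` B"
      using LB by simp
    ultimately show ?case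
      using B linL by (metis linear_independent_injective_image card_image inj_on_subset subset_UNIV)
  qed
qed

text \<open>The complex vector space of matrices. The plain \<open>span\<close> and
  \<open>dim\<close> are real, whereas the block count below needs complex coefficients.\<close>

interpretation cmat: vector_space "\<lambda>c A. mat c ** (A :: 'm::finite cmatrix)"
  by unfold_locales (simp_all add: matrix_ring_simps mat_mul_mat matrix_mul_add_right[symmetric] mat_add)

text \<open>The Steinitz bound for families: independence is a property of sets, so the absence of
  nontrivial relations must first be used to see that no member is repeated.\<close>

lemma independent_family_card_le:
  fixes f :: "'i \<Rightarrow> 'm::finite cmatrix"
  assumes J: "finite J" and T: "finite T" and f: "\<And>j. j \<in> J \<Longrightarrow> f j \<in> cmat.span T"
    and ind: "\<And>c. (\<Sum>j\<in>J. mat (c j) ** f j) = 0 \<Longrightarrow> \<forall>j\<in>J. c j = 0"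
  shows "card J \<le> card T"
proof -
  have inj: "inj_on f J"
  proof (rule inj_onI, rule ccontr)
    fix i j assume ij: "i \<in> J" "j \<in> J" "f i = f j" "i \<noteq> j"
    define c where "c k = (if k = i then 1 else if k = j then - 1 else (0::complex))" for k
    have "(\<Sum>k\<in>J. mat (c k) ** f k) = (\<Sum>k\<in>{i, j}. mat (c k) ** f k)"
      using ij J by (intro sum.mono_neutral_right) (auto simp: c_def)
    also have "\<dots> = 0"
      using ij cmat.scale_minus_left[of 1] by (simp add: c_def)
    finally have "c i = 0" using ind[of c] ij by blast
    then show False by (simp add: c_def)
  qed
  have "cmat.independent (f ` J)"
  proof (rule cmat.independent_if_scalars_zero)
    show "finite (f ` J)" using J by simp
    fix c x assume "(\<Sum>x\<in>f ` J. mat (c x) ** x) = 0" "x \<in> f ` J"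
    then show "c x = 0"
      using ind[of "c \<circ> f"] by (auto simp: sum.reindex[OF inj])
  qed
  then have "card (f ` J) \<le> card T"
    using cmat.independent_span_bound[OF T, of "f ` J"] f by blast
  then show ?thesis by (simp add: card_image[OF inj])
qed

subsection \<open>Cayley transforms\<close>

definition skew :: "'m::finite cmatrix \<Rightarrow> bool" where
  "skew G \<longleftrightarrow> G\<^sup>H = - G"

lemma skew_scaleR: "skew G \<Longrightarrow> skew (r *\<^sub>R G)"
  by (simp add: skew_def adj_simps)

lemma skew_0 [simp]: "skew 0"
  by (simp add: skew_def)

definition resolvent :: "'m::finite cmatrix \<Rightarrow> 'm cmatrix" where
  "resolvent G = matrix_inv (mat 1 - G)"

text \<open>The Cayley transform (1 + G)(1 - G)^(-1). Its expansion 1 + 2 G + ... is the source of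
  the factors 2 in the derivatives below.\<close>

definition cayley :: "'m::finite cmatrix \<Rightarrow> 'm cmatrix" where
  "cayley G = (mat 1 + G) ** resolvent G"

text \<open>Left multiplication by a skew-Hermitian matrix is antisymmetric for the real inner
  product, so G X is orthogonal to X and Pythagoras applies. The resulting lower bound gives both
  the existence and the continuity of the resolvent.\<close>

lemma norm_skew_shift:
  fixes G X :: "'m::finite cmatrix"
  assumes "skew G"
  shows "norm ((mat 1 - G) ** X) ^ 2 = norm X ^ 2 + norm (G ** X) ^ 2"
proof -
  have "(G ** X) \<bullet> X = X \<bullet> (G\<^sup>H ** X)"
    by (rule inner_mul_left)
  also have "\<dots> = - ((G ** X) \<bullet> X)"
    using assms by (simp add: skew_def matrix_mul_minus_left inner_commute)
  finally have "(G ** X) \<bullet> X = 0" by simp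
  then show ?thesis
    by (simp add: matrix_mul_diff_right power2_norm_eq_inner inner_diff_left inner_diff_right
        inner_commute)
qed

lemma norm_le_skew_shift:
  fixes G X :: "'m::finite cmatrix"
  assumes "skew G"
  shows "norm X \<le> norm ((mat 1 - G) ** X)"
  by (rule power2_le_imp_le) (simp_all add: norm_skew_shift[OF assms])

lemma resolvent_right:
  fixes G :: "'m::finite cmatrix"
  assumes "skew G"
  shows "(mat 1 - G) ** resolvent G = mat 1"
proof -
  have lin: "linear (\<lambda>X :: 'm cmatrix. (mat 1 - G) ** X)"
    by (auto intro!: linearI simp: matrix_ring_simps scaleR_diff_right)
  have "X = 0" if "(mat 1 - G) ** X = 0" for X :: "'m cmatrix"
    using norm_le_skew_shift[OF assms, of X] that by simp
  then have "inj (\<lambda>X :: 'm cmatrix. (mat 1 - G) ** X)"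
    using lin linear_injective_0 by blast
  then have "surj (\<lambda>X :: 'm cmatrix. (mat 1 - G) ** X)"
    using lin linear_injective_imp_surjective by blast
  then obtain R :: "'m cmatrix" where R: "(mat 1 - G) ** R = mat 1"
    by (metis surjD)
  then have "resolvent G = R"
    unfolding resolvent_def by (rule matrix_inv_eq)
  then show ?thesis
    using R by simp
qed

lemma resolvent_0 [simp]: "resolvent 0 = mat 1"
  unfolding resolvent_def by (rule matrix_inv_eq) simp

text \<open>Applying 1 - G' to the difference of the resolvents at G' and G leaves (G' - G) times
  the resolvent at G, and 1 - G' does not decrease norms.\<close>

lemma continuous_on_resolvent:
  "continuous_on {G :: 'm::finite cmatrix. skew G} resolvent"
  unfolding continuous_on_def
proof
  fix G :: "'m cmatrix" assume "G \<in> {G. skew G}"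
  then have G: "skew G" by simp
  have lim: "((\<lambda>G'. (G' - G) ** resolvent G) \<longlongrightarrow> 0) (at G within {G. skew G})"
    by (auto intro!: tendsto_eq_intros)
  have le: "norm (resolvent G' - resolvent G) \<le> norm ((G' - G) ** resolvent G)"
    if G': "skew G'" for G'
  proof -
    have "(mat 1 - G') ** (resolvent G' - resolvent G) = mat 1 - (mat 1 - G') ** resolvent G"
      by (simp add: matrix_mul_diff_left resolvent_right[OF G'])
    also have "\<dots> = (mat 1 - G) ** resolvent G - (mat 1 - G') ** resolvent G"
      by (simp add: resolvent_right[OF G])
    also have "\<dots> = (G' - G) ** resolvent G"
      by (simp add: matrix_mul_diff_right)
    finally show ?thesis
      using norm_le_skew_shift[OF G', of "resolvent G' - resolvent G"] by simp
  qed
  have "((\<lambda>G'. resolvent G' - resolvent G) \<longlongrightarrow> 0) (at G within {G. skew G})"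
    by (rule Lim_null_comparison[OF _ tendsto_norm_zero[OF lim]])
      (auto simp: eventually_at_filter intro!: always_eventually le)
  then show "(resolvent \<longlongrightarrow> resolvent G) (at G within {G. skew G})"
    by (simp add: LIM_zero_iff)
qed

lemma continuous_on_cayley: "continuous_on {G :: 'm::finite cmatrix. skew G} cayley"
  unfolding cayley_def by (intro continuous_intros continuous_on_resolvent)

text \<open>Taking adjoints exchanges 1 + G and 1 - G, and these two matrices commute.\<close>

lemma unitary_cayley:
  assumes "skew G"
  shows "unitary (cayley G)"
proof (rule unitaryI)
  have adj: "(mat 1 + G)\<^sup>H = mat 1 - G" "(mat 1 - G)\<^sup>H = mat 1 + G"
    using assms by (simp_all add: adj_simps skew_def)
  have "(cayley G)\<^sup>H ** cayley G = (resolvent G)\<^sup>H ** ((mat 1 - G) ** (mat 1 + G)) ** resolvent G"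
    by (simp add: cayley_def adj_mul adj matrix_mul_assoc)
  also have "(mat 1 - G) ** (mat 1 + G) = (mat 1 + G) ** (mat 1 - G)"
    by (simp add: matrix_ring_simps)
  also have "(resolvent G)\<^sup>H ** ((mat 1 + G) ** (mat 1 - G)) ** resolvent G =
      ((resolvent G)\<^sup>H ** (mat 1 - G)\<^sup>H) ** ((mat 1 - G) ** resolvent G)"
    unfolding adj by (simp only: matrix_mul_assoc)
  also have "\<dots> = mat 1"
    by (simp add: adj_mul[symmetric] resolvent_right[OF assms])
  finally show "(cayley G)\<^sup>H ** cayley G = mat 1" .
qed

lemma cayley_eq:
  assumes "skew G"
  shows "cayley G = mat 1 + 2 *\<^sub>R (G ** resolvent G)"
proof -
  have "resolvent G = mat 1 + G ** resolvent G"
    using resolvent_right[OF assms] by (simp add: matrix_mul_diff_right algebra_simps)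
  then show ?thesis
    unfolding cayley_def matrix_mul_add_right matrix_mul_lid scaleR_2 by (simp add: algebra_simps)
qed

lemma cayley_0 [simp]: "cayley 0 = mat 1"
  by (simp add: cayley_def)

text \<open>By \<open>cayley_eq\<close> the remainder is 2 G(h) times the difference of the
  resolvent from the identity: a factor of order h times one that tends to 0. Continuity of the
  resolvent is therefore enough.\<close>

lemma has_derivative_cayley:
  fixes G :: "'a::euclidean_space \<Rightarrow> 'm::finite cmatrix"
  assumes G: "linear G" "\<And>x. skew (G x)"
  shows "((\<lambda>x. cayley (G x)) has_derivative (\<lambda>x. 2 *\<^sub>R G x)) (at 0)"
proof -
  have bl: "bounded_linear G"
    using G by (simp add: linear_conv_bounded_linear)
  have G0: "G 0 = 0" using G(1) by (rule linear_0)
  have R: "continuous_on UNIV (\<lambda>x. resolvent (G x))"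
    by (rule continuous_on_compose2[OF continuous_on_resolvent])
      (use bl G in \<open>auto intro: linear_continuous_on\<close>)
  then have "((\<lambda>x. resolvent (G x)) \<longlongrightarrow> resolvent (G 0)) (at 0)"
    by (simp add: continuous_on_def)
  then have lim: "((\<lambda>x. resolvent (G x) - mat 1) \<longlongrightarrow> 0) (at 0)"
    by (simp add: G0 LIM_zero)
  obtain K where K: "\<And>A B. norm (A ** (B :: 'm cmatrix)) \<le> norm (A :: 'm cmatrix) * norm B * K" "K \<ge> 0"
    using bounded_bilinear.nonneg_bounded[OF bounded_bilinear_cmatrix_mul] by auto
  have eq: "cayley (G h) - mat 1 - 2 *\<^sub>R G h = 2 *\<^sub>R (G h ** (resolvent (G h) - mat 1))" for h
    by (simp add: cayley_eq G matrix_mul_diff_left scaleR_diff_right)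
  have "((\<lambda>h. norm (cayley (G h) - mat 1 - 2 *\<^sub>R G h) / norm h) \<longlongrightarrow> 0) (at 0)"
  proof (rule Lim_null_comparison)
    show "\<forall>\<^sub>F h in at 0. norm (norm (cayley (G h) - mat 1 - 2 *\<^sub>R G h) / norm h) \<le>
        2 * onorm G * K * norm (resolvent (G h) - mat 1)"
    proof (rule always_eventually, rule allI)
      fix h
      have "norm (G h ** (resolvent (G h) - mat 1)) \<le> norm (G h) * norm (resolvent (G h) - mat 1) * K"
        by (rule K)
      also have "\<dots> \<le> (onorm G * norm h) * norm (resolvent (G h) - mat 1) * K"
        by (intro mult_right_mono onorm bl K(2) norm_ge_zero)
      finally show "norm (norm (cayley (G h) - mat 1 - 2 *\<^sub>R G h) / norm h) \<le>
          2 * onorm G * K * norm (resolvent (G h) - mat 1)"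
        unfolding eq using K(2) onorm_pos_le[OF bl]
        by (cases "h = 0") (auto simp: field_simps)
    qed
    show "((\<lambda>h. 2 * onorm G * K * norm (resolvent (G h) - mat 1)) \<longlongrightarrow> 0) (at 0)"
      using tendsto_mult_right_zero[OF tendsto_norm_zero[OF lim]] by simp
  qed
  then show ?thesis
    using bl by (auto simp: has_derivative_at G0 intro!: bounded_linear_intros)
qed

definition rotate_by :: "'m::finite cmatrix \<Rightarrow> 'm cmatrix \<Rightarrow> 'm cmatrix" where
  "rotate_by G Y = cayley G ** Y ** (cayley G)\<^sup>H"

lemma rotate_by_0 [simp]: "rotate_by 0 Y = Y"
  by (simp add: rotate_by_def)

lemma rotate_by_in_orbit:
  assumes "skew G" "Y \<in> SU_orbit X"
  shows "rotate_by G Y \<in> SU_orbit X"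
proof -
  obtain U where U: "unitary U" "Y = U ** X ** U\<^sup>H"
    using assms(2) by (auto simp: SU_orbit_iff)
  have "rotate_by G Y = (cayley G ** U) ** X ** (cayley G ** U)\<^sup>H"
    by (simp add: rotate_by_def U adj_mul matrix_mul_assoc)
  then show ?thesis
    using unitary_mul[OF unitary_cayley[OF assms(1)] U(1)] SU_orbit_iff by blast
qed

lemma continuous_on_rotate_by:
  fixes G :: "'a::euclidean_space \<Rightarrow> 'm::finite cmatrix"
  assumes "linear G" "\<And>x. skew (G x)"
  shows "continuous_on S (\<lambda>x. rotate_by (G x) Y)"
proof -
  have "continuous_on S (\<lambda>x. cayley (G x))"
    by (rule continuous_on_compose2[OF continuous_on_cayley])
      (use assms in \<open>auto intro!: linear_continuous_on simp: linear_conv_bounded_linear\<close>)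
  then show ?thesis
    unfolding rotate_by_def by (intro continuous_intros)
qed

lemma has_derivative_rotate_by:
  fixes G :: "'a::euclidean_space \<Rightarrow> 'm::finite cmatrix"
  assumes "linear G" "\<And>x. skew (G x)"
  shows "((\<lambda>x. rotate_by (G x) Y) has_derivative (\<lambda>x. 2 *\<^sub>R (G x ** Y - Y ** G x))) (at 0)"
proof -
  have G0: "G 0 = 0" using assms(1) by (rule linear_0)
  note d = has_derivative_cayley[OF assms]
  have "((\<lambda>x. rotate_by (G x) Y) has_derivative
      (\<lambda>x. cayley (G 0) ** Y ** (2 *\<^sub>R G x)\<^sup>H + (cayley (G 0) ** 0 + 2 *\<^sub>R G x ** Y) ** (cayley (G 0))\<^sup>H))
      (at 0)"
    unfolding rotate_by_def
    by (intro has_derivative_cmatrix_mul has_derivative_adj d has_derivative_const)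
  then show ?thesis
    using assms(2) by (simp add: G0 skew_def adj_scaleR matrix_ring_simps algebra_simps scaleR_diff_right)
qed

lemma rotate_by_quotient:
  fixes G :: "'m::finite cmatrix"
  assumes G: "skew G"
  shows "((\<lambda>t. rotate_by (t *\<^sub>R G) Y) \<longlongrightarrow> Y) (at_right 0)"
    and "((\<lambda>t. (1 / t) *\<^sub>R (rotate_by (t *\<^sub>R G) Y - Y)) \<longlongrightarrow> 2 *\<^sub>R (G ** Y - Y ** G)) (at_right 0)"
proof -
  have lin: "linear (\<lambda>t :: real. t *\<^sub>R G)"
    by (intro linearI) (simp_all add: scaleR_left_distrib)
  have sk: "skew (t *\<^sub>R G)" for t :: real
    using G by (rule skew_scaleR)
  have "continuous_on UNIV (\<lambda>t :: real. rotate_by (t *\<^sub>R G) Y)"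
    by (rule continuous_on_rotate_by[OF lin sk])
  then have "((\<lambda>t :: real. rotate_by (t *\<^sub>R G) Y) \<longlongrightarrow> rotate_by (0 *\<^sub>R G) Y) (at 0)"
    unfolding continuous_on_def by blast
  then show "((\<lambda>t. rotate_by (t *\<^sub>R G) Y) \<longlongrightarrow> Y) (at_right 0)"
    by (simp add: filterlim_at_split)
  have "((\<lambda>t :: real. rotate_by (t *\<^sub>R G) Y) has_derivative
      (\<lambda>t. 2 *\<^sub>R (t *\<^sub>R G ** Y - Y ** t *\<^sub>R G))) (at 0)"
    by (rule has_derivative_rotate_by[OF lin sk])
  then have "((\<lambda>t :: real. rotate_by (t *\<^sub>R G) Y) has_vector_derivative
      2 *\<^sub>R (G ** Y - Y ** G)) (at 0 within {0<..})"
    by (auto simp: has_vector_derivative_def matrix_ring_simps algebra_simps intro: has_derivative_at_withinI)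
  then have "((\<lambda>t. (1 / \<bar>t\<bar>) *\<^sub>R (rotate_by (t *\<^sub>R G) Y - (Y + t *\<^sub>R 2 *\<^sub>R (G ** Y - Y ** G)))) \<longlongrightarrow> 0)
      (at_right 0)"
    by (simp add: has_vector_derivative_def has_derivative_within)
  from tendsto_add[OF this tendsto_const, of "2 *\<^sub>R (G ** Y - Y ** G)"]
  show "((\<lambda>t. (1 / t) *\<^sub>R (rotate_by (t *\<^sub>R G) Y - Y)) \<longlongrightarrow> 2 *\<^sub>R (G ** Y - Y ** G)) (at_right 0)"
    unfolding add_0_left
    by (rule Lim_transform_eventually)
      (auto simp: eventually_at_filter algebra_simps intro!: always_eventually)
qed

subsection \<open>Tuples of maximal rank\<close>

definition commutator :: "'m::finite cmatrix \<Rightarrow> 'm cmatrix \<Rightarrow> 'm cmatrix" where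
  "commutator A B = A ** B - B ** A"

lemma commutator_diff_right: "commutator A (B - C) = commutator A B - commutator A C"
  by (simp add: commutator_def matrix_ring_simps)

lemma commutator_scaleR_right: "commutator A (r *\<^sub>R B) = r *\<^sub>R commutator A B"
  by (simp add: commutator_def matrix_ring_simps scaleR_diff_right)

lemma tendsto_commutator [tendsto_intros]:
  "(f \<longlongrightarrow> A) F \<Longrightarrow> (g \<longlongrightarrow> B) F \<Longrightarrow> ((\<lambda>x. commutator (f x) (g x)) \<longlongrightarrow> commutator A B) F"
  unfolding commutator_def by (intro tendsto_intros)

text \<open>The common property of skew-Hermitian and unitary matrices that allows one search for an
  irreducible tuple to serve both halves of the theorem.\<close>

definition normal :: "'m::finite cmatrix \<Rightarrow> bool" where
  "normal X \<longleftrightarrow> X ** X\<^sup>H = X\<^sup>H ** X"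

lemma normal_orbit:
  assumes "normal X" "Y \<in> SU_orbit X"
  shows "normal Y"
proof -
  obtain U where U: "unitary U" "Y = U ** X ** U\<^sup>H"
    using assms(2) by (auto simp: SU_orbit_iff)
  have "Y ** Y\<^sup>H = U ** (X ** X\<^sup>H) ** U\<^sup>H"
    using U(1) by (simp add: U(2) adj_mul matrix_mul_assoc)
  moreover have "Y\<^sup>H ** Y = U ** (X\<^sup>H ** X) ** U\<^sup>H"
    using U(1) by (simp add: U(2) adj_mul matrix_mul_assoc)
  ultimately show ?thesis
    using assms(1) by (simp add: normal_def)
qed

lemma eig_mult_orbit:
  assumes "normal X" "Y \<in> SU_orbit X"
  shows "eig_mult Y c = eig_mult X c"
proof -
  obtain U where U: "unitary U" "Y = U ** X ** U\<^sup>H"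
    using assms(2) by (auto simp: SU_orbit_iff)
  obtain V d where V: "unitary V" "X = V ** diag_matrix d ** V\<^sup>H"
    using normal_diagonalization assms(1) unfolding normal_def by blast
  have "Y = (U ** V) ** diag_matrix d ** (U ** V)\<^sup>H"
    by (simp add: U(2) V(2) adj_mul matrix_mul_assoc)
  then show ?thesis
    using eig_mult_diag[OF V] eig_mult_diag[OF unitary_mul[OF U(1) V(1)]] by simp
qed

lemma eigenvalues_orbit: "normal X \<Longrightarrow> Y \<in> SU_orbit X \<Longrightarrow> eigenvalues Y = eigenvalues X"
  by (simp add: eigenvalues_eq eig_mult_orbit)

lemma max_eig_mult_orbit: "normal X \<Longrightarrow> Y \<in> SU_orbit X \<Longrightarrow> max_eig_mult Y = max_eig_mult X"
  unfolding max_eig_mult_def by (simp add: eigenvalues_orbit eig_mult_orbit cong: image_cong)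

lemma card_le_max_eig_mult:
  assumes "unitary U" "X = U ** diag_matrix d ** U\<^sup>H"
  shows "card {j. d j = c} \<le> max_eig_mult X"
proof (cases "c \<in> range d")
  case True
  then have "eig_mult X c \<le> max_eig_mult X"
    unfolding max_eig_mult_def eigenvalues_diag[OF assms] by (intro Max_ge) auto
  then show ?thesis by (simp add: eig_mult_diag[OF assms])
next
  case False
  then have "{j. d j = c} = {}" by auto
  then show ?thesis by simp
qed

text \<open>H runs over all matrices, not only skew-Hermitian ones, so the span is a complex
  subspace. Its annihilator under the trace form is the commutant of the tuple, and a larger
  \<open>dim\<close> means a smaller commutant.\<close>

definition commutator_set :: "nat \<Rightarrow> (nat \<Rightarrow> 'm::finite cmatrix) \<Rightarrow> 'm cmatrix set" where
  "commutator_set k Y = {commutator H (Y i) | H i. i < k}"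

definition maximal_tuple :: "nat \<Rightarrow> (nat \<Rightarrow> 'm::finite cmatrix) \<Rightarrow> (nat \<Rightarrow> 'm cmatrix) \<Rightarrow> bool" where
  "maximal_tuple k X Y \<longleftrightarrow> (\<forall>i<k. Y i \<in> SU_orbit (X i)) \<and>
     (\<forall>Z. (\<forall>i<k. Z i \<in> SU_orbit (X i)) \<longrightarrow> dim (commutator_set k Z) \<le> dim (commutator_set k Y))"

text \<open>The quantity maximized is a bounded natural number, so compactness of the orbits does
  not enter.\<close>

lemma maximal_tuple_exists:
  fixes X :: "nat \<Rightarrow> 'm::finite cmatrix"
  obtains Y where "maximal_tuple k X Y"
proof -
  define P where "P Y \<longleftrightarrow> (\<forall>i<k. Y i \<in> SU_orbit (X i))" for Y
  have "X i \<in> SU_orbit (X i)" for i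
    unfolding SU_orbit_iff by (rule exI[of _ "mat 1"]) (simp add: unitary_def)
  then have "P X" by (simp add: P_def)
  moreover have "\<forall>Y. P Y \<longrightarrow> dim (commutator_set k Y) < Suc DIM('m cmatrix)"
    using dim_subset_UNIV less_Suc_eq_le by blast
  ultimately obtain Y where "P Y" "\<And>Z. P Z \<Longrightarrow> dim (commutator_set k Z) \<le> dim (commutator_set k Y)"
    using ex_has_greatest_nat[of P X "\<lambda>Y. dim (commutator_set k Y)" "Suc DIM('m cmatrix)"] by blast
  then show thesis
    using that unfolding maximal_tuple_def P_def by blast
qed

text \<open>The first-order condition at a maximum of a rank: moving one entry along \<open>G\<close> must not produce a
  new direction outside the span.\<close>

lemma maximal_tuple_first_order:
  fixes X Y H :: "nat \<Rightarrow> 'm::finite cmatrix"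
  assumes max: "maximal_tuple k X Y" and rel: "(\<Sum>i<k. commutator (H i) (Y i)) = 0"
    and j: "j < k" and G: "skew G"
  shows "commutator (H j) (commutator G (Y j)) \<in> span (commutator_set k Y)"
proof (rule ccontr)
  \<comment> \<open>The factor 2 makes w the exact limit of the difference quotient of the Cayley
    rotation.\<close>
  define w where "w = 2 *\<^sub>R commutator (H j) (commutator G (Y j))"
  assume "commutator (H j) (commutator G (Y j)) \<notin> span (commutator_set k Y)"
  moreover have "commutator (H j) (commutator G (Y j)) = (1/2) *\<^sub>R w"
    by (simp add: w_def)
  ultimately have w: "w \<notin> span (commutator_set k Y)"
    using span_scale by metis
  obtain B where B: "B \<subseteq> commutator_set k Y" "independent B"
    "commutator_set k Y \<subseteq> span B" "card B = dim (commutator_set k Y)"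
    using basis_exists by blast
  have "w \<notin> span B"
    using w span_mono[OF B(1)] by blast
  then have ind: "independent (insert w B)" and wB: "w \<notin> B"
    using B(2) by (auto simp: independent_insert span_base)
  have finB: "finite B"
    using B(2) by (rule independent_imp_finite)
  have "\<forall>b\<in>B. \<exists>H i. i < k \<and> b = commutator H (Y i)"
    using B(1) unfolding commutator_set_def by blast
  then obtain Hb ib where b: "\<And>b. b \<in> B \<Longrightarrow> ib b < k \<and> b = commutator (Hb b) (Y (ib b))"
    by metis
  define Z where "Z t = Y(j := rotate_by (t *\<^sub>R G) (Y j))" for t
  \<comment> \<open>A deformation of the independent set \<open>insert w B\<close> that will lie in
    the span belonging to the moved tuple \<open>Z t\<close>: elements of B keep their coefficient
    matrices, and w becomes a difference quotient.\<close>
  define f where "f t b = (if b = w then (1 / t) *\<^sub>R commutator (H j) (rotate_by (t *\<^sub>R G) (Y j) - Y j)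
      else commutator (Hb b) (Z t (ib b)))" for t b
  have Zlim: "((\<lambda>t. Z t i) \<longlongrightarrow> Y i) (at_right 0)" for i
    using rotate_by_quotient(1)[OF G, of "Y j"] by (cases "i = j") (simp_all add: Z_def)
  have lim: "((\<lambda>t. f t b) \<longlongrightarrow> b) (at_right 0)" if "b \<in> insert w B" for b
  proof (cases "b = w")
    case True
    have "((\<lambda>t. commutator (H j) ((1 / t) *\<^sub>R (rotate_by (t *\<^sub>R G) (Y j) - Y j))) \<longlongrightarrow>
        commutator (H j) (2 *\<^sub>R (G ** Y j - Y j ** G))) (at_right 0)"
      by (intro tendsto_intros rotate_by_quotient(2)[OF G])
    then have "((\<lambda>t. (1 / t) *\<^sub>R commutator (H j) (rotate_by (t *\<^sub>R G) (Y j) - Y j)) \<longlongrightarrow> w) (at_right 0)"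
      unfolding commutator_scaleR_right w_def by (simp add: commutator_def)
    then show ?thesis
      using True by (simp add: f_def)
  next
    case False
    then have "b \<in> B" using that by blast
    then have "b = commutator (Hb b) (Y (ib b))" using b by blast
    moreover have "((\<lambda>t. commutator (Hb b) (Z t (ib b))) \<longlongrightarrow> commutator (Hb b) (Y (ib b))) (at_right 0)"
      by (intro tendsto_intros Zlim)
    ultimately show ?thesis
      using False by (simp add: f_def)
  qed
  have "\<forall>\<^sub>F t in at_right (0::real). independent (f t ` insert w B) \<and> card (f t ` insert w B) = card (insert w B)"
    by (rule independent_perturbation[OF ind lim])
  then obtain t where t: "independent (f t ` insert w B)" "card (f t ` insert w B) = card (insert w B)"
    using eventually_happens'[OF trivial_limit_at_right_real] by blast
  have mem: "commutator A (Z t i) \<in> span (commutator_set k (Z t))" if "i < k" for A i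
    using that by (auto simp: commutator_set_def intro: span_base)
  \<comment> \<open>The relation \<open>rel\<close> is what puts the difference quotient into the
    new span: subtracting it turns one increment into a sum of commutators with the moved tuple.
    That span then contains more independent vectors than the maximum permits.\<close>
  have "commutator (H j) (rotate_by (t *\<^sub>R G) (Y j) - Y j) =
      (\<Sum>i<k. if i = j then commutator (H j) (rotate_by (t *\<^sub>R G) (Y j) - Y j) else 0)"
    using j by simp
  also have "\<dots> = (\<Sum>i<k. commutator (H i) (Z t i) - commutator (H i) (Y i))"
    by (intro sum.cong refl) (auto simp: Z_def commutator_diff_right)
  also have "\<dots> = (\<Sum>i<k. commutator (H i) (Z t i))"
    using rel by (simp add: sum_subtractf)
  also have "\<dots> \<in> span (commutator_set k (Z t))"
    by (intro span_sum mem) auto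
  finally have "f t w \<in> span (commutator_set k (Z t))"
    by (simp add: f_def span_scale)
  moreover have "f t b \<in> span (commutator_set k (Z t))" if "b \<in> B" for b
    using that wB b mem by (auto simp: f_def)
  ultimately have "f t ` insert w B \<subseteq> span (commutator_set k (Z t))"
    by auto
  then have "card (insert w B) \<le> dim (commutator_set k (Z t))"
    using t independent_card_le_dim by (metis dim_span)
  moreover have "card (insert w B) = Suc (dim (commutator_set k Y))"
    using B(4) finB wB by simp
  moreover have "\<forall>i<k. Z t i \<in> SU_orbit (X i)"
    using max rotate_by_in_orbit[OF skew_scaleR[OF G]] by (auto simp: Z_def maximal_tuple_def)
  then have "dim (commutator_set k (Z t)) \<le> dim (commutator_set k Y)"
    using max by (auto simp: maximal_tuple_def)
  ultimately show False by simp
qed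

lemma trace_commutator: "trace (A ** commutator B C) = trace (commutator A B ** (C :: 'm::finite cmatrix))"
proof -
  have "trace (A ** (C ** B)) = trace (B ** A ** C)"
    using trace_mul_sym[of "A ** C" B] by (simp add: matrix_mul_assoc)
  then show ?thesis
    by (simp add: commutator_def matrix_ring_simps trace_sub)
qed

text \<open>By invariance of the trace form, pairing K with a commutator of Y_i moves the bracket
  onto K, where it vanishes.\<close>

lemma trace_commutant:
  assumes K: "\<And>i. i < k \<Longrightarrow> commutator K (Y i) = 0" and W: "W \<in> span (commutator_set k Y)"
  shows "trace (K ** W) = 0"
proof -
  have "subspace {W. trace (K ** W) = 0}"
    unfolding subspace_def
    by (auto simp: trace_add matrix_ring_simps trace_def scaleR_sum_right[symmetric] sum.distrib)
  moreover have "commutator_set k Y \<subseteq> {W. trace (K ** W) = 0}"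
  proof
    fix W assume "W \<in> commutator_set k Y"
    then obtain H i where i: "i < k" and W: "W = commutator H (Y i)"
      by (auto simp: commutator_set_def)
    have "trace (K ** W) = - trace (K ** commutator (Y i) H)"
      unfolding W by (simp add: commutator_def matrix_ring_simps trace_sub)
    also have "\<dots> = - trace (commutator K (Y i) ** H)"
      by (simp add: trace_commutator)
    finally show "W \<in> {W. trace (K ** W) = 0}"
      by (simp add: K[OF i] trace_0[unfolded mat_0])
  qed
  ultimately have "span (commutator_set k Y) \<subseteq> {W. trace (K ** W) = 0}"
    by (simp add: span_minimal)
  then show ?thesis using W by blast
qed

lemma eq_0_if_trace_skew:
  fixes Q :: "'m::finite cmatrix"
  assumes "\<And>G. skew G \<Longrightarrow> trace (Q ** G) = 0"
  shows "Q = 0"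
proof -
  have 1: "trace (Q ** (Q\<^sup>H - Q)) = 0"
    by (rule assms) (simp add: skew_def adj_simps)
  have "trace (Q ** (mat \<i> ** (Q\<^sup>H + Q))) = 0"
    by (rule assms) (simp add: skew_def adj_simps vec_eq_iff algebra_simps mat_commute)
  moreover have "Q ** (mat \<i> ** (Q\<^sup>H + Q)) = mat \<i> ** (Q ** (Q\<^sup>H + Q))"
    by (simp add: matrix_mul_assoc mat_commute)
  ultimately have 2: "trace (Q ** (Q\<^sup>H + Q)) = 0"
    by (simp add: trace_def sum_distrib_left[symmetric])
  have "trace (Q ** Q\<^sup>H) = 0"
    using 1 2 by (simp add: matrix_add_ldistrib matrix_mul_diff_left trace_add trace_sub)
  then have "norm (Q\<^sup>H) ^ 2 = 0"
    by (simp add: norm_cmatrix_sq)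
  then show ?thesis
    by (metis adj_0 adj_adj norm_eq_zero power_eq_0_iff)
qed

text \<open>K annihilates the span, which contains [H_j, [G, Y_j]] for every skew-Hermitian G.
  Moving both brackets across the trace leaves [[K, H_j], Y_j] paired with an arbitrary G.\<close>

lemma maximal_tuple_commutant:
  fixes X Y H :: "nat \<Rightarrow> 'm::finite cmatrix"
  assumes max: "maximal_tuple k X Y" and rel: "(\<Sum>i<k. commutator (H i) (Y i)) = 0"
    and K: "\<And>i. i < k \<Longrightarrow> commutator K (Y i) = 0" and j: "j < k"
  shows "commutator (commutator K (H j)) (Y j) = 0"
proof (rule eq_0_if_trace_skew)
  fix G :: "'m cmatrix" assume G: "skew G"
  have "0 = trace (K ** commutator (H j) (commutator G (Y j)))"
    using trace_commutant[OF K maximal_tuple_first_order[OF max rel j G]] by simp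
  also have "\<dots> = trace (commutator K (H j) ** commutator G (Y j))"
    by (rule trace_commutator)
  also have "\<dots> = - trace (commutator K (H j) ** commutator (Y j) G)"
    by (simp add: commutator_def matrix_ring_simps trace_sub)
  also have "\<dots> = - trace (commutator (commutator K (H j)) (Y j) ** G)"
    by (simp add: trace_commutator)
  finally show "trace (commutator (commutator K (H j)) (Y j) ** G) = 0" by simp
qed

section \<open>Counting dimensions in an off-diagonal block\<close>

definition unit_matrix :: "'m \<Rightarrow> 'm \<Rightarrow> 'm::finite cmatrix" where
  "unit_matrix a b = (\<chi> r s. if r = a \<and> s = b then 1 else 0)"

lemma sum_unit_matrix:
  fixes U :: "'m::finite cmatrix"
  shows "(\<Sum>p\<in>S. mat (c p) ** (U ** unit_matrix (fst p) (snd p) ** U\<^sup>H)) =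
    U ** (\<chi> a b. if (a, b) \<in> S then c (a, b) else 0) ** U\<^sup>H"
proof -
  have "(\<chi> a b. if (a, b) \<in> S then c (a, b) else 0) = (\<Sum>p\<in>S. mat (c p) ** unit_matrix (fst p) (snd p))"
  proof (unfold vec_eq_iff, intro allI)
    fix r s
    have "(\<Sum>p\<in>S. mat (c p) ** unit_matrix (fst p) (snd p)) $ r $ s =
        (\<Sum>p\<in>S. if p = (r, s) then c (r, s) else 0)"
      unfolding sum_component by (intro sum.cong refl) (auto simp: unit_matrix_def prod_eq_iff)
    then show "(\<chi> a b. if (a, b) \<in> S then c (a, b) else 0) $ r $ s =
        (\<Sum>p\<in>S. mat (c p) ** unit_matrix (fst p) (snd p)) $ r $ s"
      by simp
  qed
  then show ?thesis
    by (simp add: matrix_mul_sum_left matrix_mul_sum_right matrix_mul_assoc mat_commute)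
qed

lemma conj_mat:
  assumes "unitary U"
  shows "U ** mat c ** U\<^sup>H = mat c" "U\<^sup>H ** mat c ** U = mat c"
  using assms unfolding mat_commute[of U] mat_commute[of "U\<^sup>H"]
  by (simp_all flip: matrix_mul_assoc)

lemma matrix_inj_unitary:
  assumes "unitary U" "U ** A ** U\<^sup>H = U ** B ** U\<^sup>H"
  shows "A = B"
proof -
  have "A = U\<^sup>H ** (U ** A ** U\<^sup>H) ** U"
    using assms(1) by (simp add: matrix_mul_assoc)
  also have "\<dots> = B"
    unfolding assms(2) using assms(1) by (simp add: matrix_mul_assoc)
  finally show ?thesis .
qed

text \<open>Functional calculus does not depend on the diagonalization: the transition matrix W can
  have a nonzero entry only where d_a = e_b, and there f takes the same value. This identifies one
  projection across the different eigenbases of the tuple.\<close>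

lemma diag_function_unique:
  assumes U: "unitary U" "unitary V"
    and eq: "U ** diag_matrix d ** U\<^sup>H = V ** diag_matrix e ** V\<^sup>H"
  shows "U ** diag_matrix (f \<circ> d) ** U\<^sup>H = V ** diag_matrix (f \<circ> e) ** V\<^sup>H"
proof -
  define W where "W = U\<^sup>H ** V"
  have "diag_matrix d ** W = U\<^sup>H ** (U ** diag_matrix d ** U\<^sup>H) ** V"
    using U by (simp add: W_def matrix_mul_assoc)
  also have "\<dots> = W ** diag_matrix e"
    unfolding eq using U by (simp add: W_def matrix_mul_assoc)
  finally have "d a * W $ a $ b = W $ a $ b * e b" for a b
    by (metis diag_mul_nth mul_diag_nth)
  then have "f (d a) * W $ a $ b = W $ a $ b * f (e b)" for a b
    by (metis mult.commute mult_cancel_right)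
  then have "diag_matrix (f \<circ> d) ** W = W ** diag_matrix (f \<circ> e)"
    by (simp add: vec_eq_iff)
  then have "U ** (diag_matrix (f \<circ> d) ** W) ** V\<^sup>H = U ** (W ** diag_matrix (f \<circ> e)) ** V\<^sup>H"
    by simp
  then show ?thesis
    using U by (simp add: W_def matrix_mul_assoc)
qed

lemma card_Compl_add: "card (- E) + card E = CARD('m)" for E :: "'m::finite set"
  using card_Un_disjoint[of "- E" E] by simp

text \<open>The matrix units at the positions \<open>J i\<close>, written in the i-th eigenbasis,
  form a basis of [P M (1 - P), Y_i]. Maximality makes their union over all i independent, and they
  all lie in the single block P M (1 - P).\<close>

lemma block_count:
  fixes X Y :: "nat \<Rightarrow> 'm::finite cmatrix"
  assumes max: "maximal_tuple k X Y" and k: "1 \<le> k"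
    and U: "\<And>i. i < k \<Longrightarrow> unitary (U i)"
    and Y: "\<And>i. i < k \<Longrightarrow> Y i = U i ** diag_matrix (d i) ** (U i)\<^sup>H"
    and P: "\<And>i. i < k \<Longrightarrow> P = U i ** diag_matrix (\<lambda>a. if a \<in> E i then 1 else 0) ** (U i)\<^sup>H"
  shows "\<And>i. i < k \<Longrightarrow> card (E i) = card (E 0)"
    and "(\<Sum>i<k. card {(a, b). a \<in> E i \<and> b \<notin> E i \<and> d i a \<noteq> d i b}) \<le> card (E 0) * card (- E 0)"
proof -
  show card: "card (E i) = card (E 0)" if "i < k" for i
  proof -
    have tr: "trace P = of_nat (card (E i))" if "i < k" for i
      unfolding P[OF that] trace_conj_unitary[OF U[OF that]]
      by (simp add: trace_def diag_nth sum.If_cases)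
    have "(of_nat (card (E i)) :: complex) = of_nat (card (E 0))"
      using tr[OF that] tr[of 0] k by simp
    then show ?thesis by (simp only: of_nat_eq_iff)
  qed
  define \<epsilon> :: "nat \<Rightarrow> 'm \<Rightarrow> complex" where "\<epsilon> i a = (if a \<in> E i then 1 else 0)" for i a
  have P': "P = U i ** diag_matrix (\<epsilon> i) ** (U i)\<^sup>H" if "i < k" for i
    unfolding P[OF that] \<epsilon>_def ..
  have PY: "commutator P (Y i) = 0" if "i < k" for i
  proof -
    have "P ** Y i = U i ** (diag_matrix (\<epsilon> i) ** diag_matrix (d i)) ** (U i)\<^sup>H"
      unfolding P'[OF that] Y[OF that] using U[OF that] by (simp add: matrix_mul_assoc)
    moreover have "Y i ** P = U i ** (diag_matrix (d i) ** diag_matrix (\<epsilon> i)) ** (U i)\<^sup>H"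
      unfolding P'[OF that] Y[OF that] using U[OF that] by (simp add: matrix_mul_assoc)
    moreover have "diag_matrix (\<epsilon> i) ** diag_matrix (d i) = diag_matrix (d i) ** diag_matrix (\<epsilon> i)"
      by (simp add: vec_eq_iff diag_nth)
    ultimately show ?thesis by (simp add: commutator_def)
  qed
  define e where "e i p = U i ** unit_matrix (fst p) (snd p) ** (U i)\<^sup>H" for i p
  \<comment> \<open>At position (a, b), commuting with the i-th entry multiplies by d_b - d_a. These
    are the positions of the block where that factor is nonzero.\<close>
  define J where "J i = {(a, b). a \<in> E i \<and> b \<notin> E i \<and> d i a \<noteq> d i b}" for i
  define T where "T = e 0 ` (E 0 \<times> - E 0)"
  have Pblock: "P ** (U i ** M ** (U i)\<^sup>H) = U i ** M ** (U i)\<^sup>H"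
    "(U i ** M ** (U i)\<^sup>H) ** P = 0"
    if i: "i < k" and M: "\<And>a b. M $ a $ b \<noteq> 0 \<Longrightarrow> a \<in> E i \<and> b \<notin> E i" for i M
  proof -
    have "P ** (U i ** M ** (U i)\<^sup>H) = U i ** (diag_matrix (\<epsilon> i) ** M) ** (U i)\<^sup>H"
      unfolding P'[OF i] using U[OF i] by (simp add: matrix_mul_assoc)
    moreover have "diag_matrix (\<epsilon> i) ** M = M"
      using M by (auto simp: vec_eq_iff \<epsilon>_def)
    ultimately show "P ** (U i ** M ** (U i)\<^sup>H) = U i ** M ** (U i)\<^sup>H" by simp
    have "(U i ** M ** (U i)\<^sup>H) ** P = U i ** (M ** diag_matrix (\<epsilon> i)) ** (U i)\<^sup>H"
      unfolding P'[OF i] using U[OF i] by (simp add: matrix_mul_assoc)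
    moreover have "M ** diag_matrix (\<epsilon> i) = 0"
      using M by (auto simp: vec_eq_iff \<epsilon>_def)
    ultimately show "(U i ** M ** (U i)\<^sup>H) ** P = 0" by simp
  qed
  \<comment> \<open>The conditions PH = H and HP = 0 describe the block without reference to a
    basis, so elements coming from any eigenbasis can be expanded in the units for index 0.\<close>
  have span: "H \<in> cmat.span T" if H: "P ** H = H" "H ** P = 0" for H
  proof -
    have 0: "0 < k" using k by simp
    define M where "M = (U 0)\<^sup>H ** H ** U 0"
    have HM: "H = U 0 ** M ** (U 0)\<^sup>H"
      using U[OF 0] by (simp add: M_def matrix_mul_assoc)
    have "diag_matrix (\<epsilon> 0) ** M = (U 0)\<^sup>H ** (P ** H) ** U 0"
      unfolding P'[OF 0] M_def using U[OF 0] by (simp add: matrix_mul_assoc)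
    also have "\<dots> = M" by (simp add: H M_def)
    finally have 1: "\<epsilon> 0 a * M $ a $ b = M $ a $ b" for a b
      by (metis diag_mul_nth)
    have "M ** diag_matrix (\<epsilon> 0) = (U 0)\<^sup>H ** (H ** P) ** U 0"
      unfolding P'[OF 0] M_def using U[OF 0] by (simp add: matrix_mul_assoc)
    also have "\<dots> = 0" by (simp add: H)
    finally have 2: "M $ a $ b * \<epsilon> 0 b = 0" for a b
      by (metis mul_diag_nth zero_index)
    have M1: "M $ a $ b = 0" if "a \<notin> E 0" for a b
      using 1[of a b] that by (simp add: \<epsilon>_def)
    have M2: "M $ a $ b = 0" if "b \<in> E 0" for a b
      using 2[of a b] that by (simp add: \<epsilon>_def)
    have "M = (\<chi> a b. if (a, b) \<in> E 0 \<times> - E 0 then M $ fst (a, b) $ snd (a, b) else 0)"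
      using M1 M2 unfolding vec_eq_iff by auto
    then have "H = U 0 ** (\<chi> a b. if (a, b) \<in> E 0 \<times> - E 0 then M $ fst (a, b) $ snd (a, b) else 0) ** (U 0)\<^sup>H"
      using HM by simp
    also have "\<dots> = (\<Sum>p\<in>E 0 \<times> - E 0. mat (M $ fst p $ snd p) ** e 0 p)"
      unfolding e_def by (rule sum_unit_matrix[symmetric])
    also have "\<dots> \<in> cmat.span T"
      by (intro cmat.span_sum cmat.span_scale cmat.span_base) (simp add: T_def)
    finally show ?thesis .
  qed
  have unit_nz: "a \<in> E i \<and> b \<notin> E i"
    if "p \<in> J i" "unit_matrix (fst p) (snd p) $ a $ b \<noteq> (0::complex)" for a b i p
    using that by (auto simp: unit_matrix_def J_def split: if_splits)
  have "card (Sigma {..<k} J) \<le> card T"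
  proof (rule independent_family_card_le[where f = "\<lambda>(i, p). e i p"])
    show "finite (Sigma {..<k} J)"
      by (intro finite_SigmaI) (auto intro: finite_subset[OF subset_UNIV])
    show "finite T" by (simp add: T_def)
    show "(case x of (i, p) \<Rightarrow> e i p) \<in> cmat.span T" if "x \<in> Sigma {..<k} J" for x
      using that unfolding e_def by (auto intro!: span Pblock dest: unit_nz)
  next
    fix c assume c: "(\<Sum>x\<in>Sigma {..<k} J. mat (c x) ** (case x of (i, p) \<Rightarrow> e i p)) = 0"
    define M where "M i = (\<chi> a b. if (a, b) \<in> J i then c (i, (a, b)) else 0)" for i
    \<comment> \<open>Division by the eigenvalue difference solves [H_i, Y_i] = M_i inside the
      block, so the assumed linear relation becomes a relation between commutators.\<close>
    define H where "H i = (\<chi> a b. if (a, b) \<in> J i then c (i, (a, b)) / (d i b - d i a) else 0)" for i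
    have comm: "commutator (U i ** H i ** (U i)\<^sup>H) (Y i) = U i ** M i ** (U i)\<^sup>H" if i: "i < k" for i
    proof -
      have "commutator (U i ** H i ** (U i)\<^sup>H) (Y i) =
          U i ** (H i ** diag_matrix (d i) - diag_matrix (d i) ** H i) ** (U i)\<^sup>H"
        unfolding Y[OF i] commutator_def using U[OF i] by (simp add: matrix_ring_simps)
      moreover have "H i ** diag_matrix (d i) - diag_matrix (d i) ** H i = M i"
        by (auto simp: vec_eq_iff H_def M_def J_def field_simps)
      ultimately show ?thesis by simp
    qed
    have "(\<Sum>i<k. commutator (U i ** H i ** (U i)\<^sup>H) (Y i)) = (\<Sum>i<k. U i ** M i ** (U i)\<^sup>H)"
      by (intro sum.cong refl comm) simp
    also have "\<dots> = (\<Sum>i<k. \<Sum>p\<in>J i. mat (c (i, p)) ** e i p)"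
      unfolding e_def M_def sum_unit_matrix ..
    also have "\<dots> = (\<Sum>x\<in>Sigma {..<k} J. mat (c x) ** (case x of (i, p) \<Rightarrow> e i p))"
      by (subst sum.Sigma) (auto intro: finite_subset[OF subset_UNIV] sum.cong)
    finally have rel: "(\<Sum>i<k. commutator (U i ** H i ** (U i)\<^sup>H) (Y i)) = 0"
      by (simp add: c)
    show "\<forall>x\<in>Sigma {..<k} J. c x = 0"
    proof (clarify, goal_cases)
      case (1 i a b)
      then have i: "i < k" by simp
      have HE: "a \<in> E i \<and> b \<notin> E i" if "H i $ a $ b \<noteq> 0" for a b
        using that by (auto simp: H_def J_def split: if_splits)
      \<comment> \<open>Since [P, H_i] = H_i, the first-order condition for K = P says that each
        [H_i, Y_i] vanishes separately.\<close>
      have "commutator P (U i ** H i ** (U i)\<^sup>H) = U i ** H i ** (U i)\<^sup>H"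
        unfolding commutator_def using Pblock[OF i HE] by simp
      then have "U i ** M i ** (U i)\<^sup>H = U i ** 0 ** (U i)\<^sup>H"
        using maximal_tuple_commutant[OF max rel PY i] comm[OF i] by simp
      then have "M i = 0"
        using matrix_inj_unitary[OF U[OF i]] by blast
      then have "M i $ a $ b = 0" by simp
      then show ?case using 1 by (simp add: M_def)
    qed
  qed
  also have "card T \<le> card (E 0 \<times> - E 0)"
    unfolding T_def by (rule card_image_le) simp
  also have "card (Sigma {..<k} J) = (\<Sum>i<k. card (J i))"
    by (rule card_SigmaI) (auto intro: finite_subset[OF subset_UNIV])
  finally show "(\<Sum>i<k. card {(a, b). a \<in> E i \<and> b \<notin> E i \<and> d i a \<noteq> d i b}) \<le> card (E 0) * card (- E 0)"
    by (simp add: card_cartesian_product J_def)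
qed

text \<open>A nonscalar Hermitian K commuting with the tuple turns both the block estimate and the
  hypothesis on the multiplicities into equalities; the rest classifies the equality case.\<close>

theorem maximal_tuple_irreducible:
  fixes X Y :: "nat \<Rightarrow> 'm::finite cmatrix"
  assumes max: "maximal_tuple k X Y" and k: "1 \<le> k"
    and nX: "\<And>i. i < k \<Longrightarrow> normal (X i)"
    and sum_le: "(\<Sum>i<k. real (max_eig_mult (X i))) \<le> (real k - 1) * CARD('m)"
    and exc: "\<not> exceptional_pair (nonscalar_entries (map X [0..<k]))"
    and K: "K\<^sup>H = K" "\<And>i. i < k \<Longrightarrow> K ** Y i = Y i ** K"
  shows "K \<in> range mat"
proof (rule ccontr)
  assume nonscalar: "K \<notin> range mat"
  have orb: "Y i \<in> SU_orbit (X i)" if "i < k" for i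
    using max that by (simp add: maximal_tuple_def)
  have nY: "normal (Y i)" if "i < k" for i
    using normal_orbit nX orb that by blast
  have "\<exists>U d \<kappa>. unitary U \<and> Y i = U ** diag_matrix d ** U\<^sup>H \<and> K = U ** diag_matrix \<kappa> ** U\<^sup>H"
    if "i < k" for i
    by (rule commuting_diagonalization[of "Y i" K]) (use nY[OF that] K that in \<open>auto simp: normal_def\<close>)
  then obtain U d \<kappa> where U: "\<And>i. i < k \<Longrightarrow> unitary (U i)"
    and Y: "\<And>i. i < k \<Longrightarrow> Y i = U i ** diag_matrix (d i) ** (U i)\<^sup>H"
    and K\<kappa>: "\<And>i. i < k \<Longrightarrow> K = U i ** diag_matrix (\<kappa> i) ** (U i)\<^sup>H"
    by metis
  \<comment> \<open>An eigenvalue of K, read off at an arbitrary index; since it occurs,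
    \<open>E 0\<close> is nonempty.\<close>
  define z where "z = \<kappa> 0 undefined"
  define E where "E i = {a. \<kappa> i a = z}" for i
  define f :: "complex \<Rightarrow> complex" where "f x = (if x = z then 1 else 0)" for x
  \<comment> \<open>The spectral projection of K for the eigenvalue z.\<close>
  define P where "P = U 0 ** diag_matrix (f \<circ> \<kappa> 0) ** (U 0)\<^sup>H"
  have "P = U i ** diag_matrix (f \<circ> \<kappa> i) ** (U i)\<^sup>H" if "i < k" for i
    unfolding P_def by (rule diag_function_unique) (use U K\<kappa> that k in auto)
  moreover have "f \<circ> \<kappa> i = (\<lambda>a. if a \<in> E i then 1 else 0)" for i
    by (auto simp: f_def E_def)
  ultimately have P: "P = U i ** diag_matrix (\<lambda>a. if a \<in> E i then 1 else 0) ** (U i)\<^sup>H" if "i < k" for i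
    using that by simp
  have block1: "card (E i) = card (E 0)" if "i < k" for i
    by (rule block_count(1)[OF max k _ _ _ that, of U d P]) (use U Y P in blast)+
  have block2: "(\<Sum>i<k. card {(a, b). a \<in> E i \<and> b \<notin> E i \<and> d i a \<noteq> d i b}) \<le> card (E 0) * card (- E 0)"
    by (rule block_count(2)[OF max k, of U d P]) (use U Y P in blast)+
  define m where "m = real CARD('m)"
  define p where "p = real (card (E 0))"
  define r where "r = real (card (- E 0))"
  define q where "q i = max_eig_mult (X i)" for i
  define N where "N i = real (card {(a, b). a \<in> E i \<and> b \<notin> E i \<and> d i a = d i b})" for i
  have cardE: "real (card (E i)) = p" "real (card (- E i)) = r" if "i < k" for i
    using block1[OF that] card_Compl_add[of "E i"] card_Compl_add[of "E 0"]
    by (simp_all add: p_def r_def)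
  have mpr: "m = p + r"
    using card_Compl_add[of "E 0"] by (simp add: m_def p_def r_def)
  have p: "p \<ge> 1"
    unfolding p_def by (auto simp: E_def z_def Suc_le_eq card_gt_0_iff)
  have r: "r \<ge> 1"
  proof -
    have "E 0 \<noteq> UNIV"
    proof
      assume "E 0 = UNIV"
      then have "\<kappa> 0 = (\<lambda>_. z)" by (auto simp: E_def)
      then have "diag_matrix (\<kappa> 0) = (mat z :: 'm cmatrix)"
        by (simp add: vec_eq_iff diag_nth mat_nth)
      then have "K = mat z"
        using K\<kappa>[of 0] U[of 0] k by (simp add: conj_mat)
      then show False using nonscalar by blast
    qed
    then have "- E 0 \<noteq> {}" by blast
    then show ?thesis
      unfolding r_def by (simp add: Suc_le_eq card_gt_0_iff)
  qed
  have eigY: "eig_mult (Y i) c = eig_mult (X i) c" "eigenvalues (Y i) = eigenvalues (X i)"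
    "max_eig_mult (Y i) = q i" if "i < k" for i c
    using eig_mult_orbit[OF nX[OF that] orb[OF that]] eigenvalues_orbit[OF nX[OF that] orb[OF that]]
      max_eig_mult_orbit[OF nX[OF that] orb[OF that]] by (simp_all add: q_def)
  have q: "card {j. d i j = c} \<le> q i" if "i < k" for i c
    using card_le_max_eig_mult[OF U[OF that] Y[OF that]] eigY(3)[OF that] by simp
  have Nle: "m * N i \<le> q i * p * r" if "i < k" for i
    using level_set_count_le[of "d i" "q i" "E i", OF q[OF that]] cardE[OF that]
    by (simp add: N_def m_def)
  have J: "real (card {(a, b). a \<in> E i \<and> b \<notin> E i \<and> d i a \<noteq> d i b}) = p * r - N i" if "i < k" for i
  proof -
    have "E i \<times> - E i = {(a, b). a \<in> E i \<and> b \<notin> E i \<and> d i a \<noteq> d i b} \<union>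
        {(a, b). a \<in> E i \<and> b \<notin> E i \<and> d i a = d i b}"
      by auto
    moreover have "card (\<dots>) = card {(a, b). a \<in> E i \<and> b \<notin> E i \<and> d i a \<noteq> d i b} +
        card {(a, b). a \<in> E i \<and> b \<notin> E i \<and> d i a = d i b}"
      by (rule card_Un_disjoint) (auto intro: finite_subset[OF subset_UNIV])
    ultimately have "real (card (E i \<times> - E i)) = real (card {(a, b). a \<in> E i \<and> b \<notin> E i \<and> d i a \<noteq> d i b}) + N i"
      by (simp add: N_def)
    then show ?thesis
      using cardE[OF that] by (simp add: card_cartesian_product)
  qed
  have "real (\<Sum>i<k. card {(a, b). a \<in> E i \<and> b \<notin> E i \<and> d i a \<noteq> d i b}) \<le> p * r"
    using block2 unfolding p_def r_def of_nat_mult[symmetric] of_nat_le_iff .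
  moreover have "real (\<Sum>i<k. card {(a, b). a \<in> E i \<and> b \<notin> E i \<and> d i a \<noteq> d i b}) = (\<Sum>i<k. p * r - N i)"
    unfolding of_nat_sum by (intro sum.cong refl J) simp
  ultimately have "k * (p * r) - (\<Sum>i<k. N i) \<le> p * r"
    by (simp add: sum_subtractf)
  then have "m * (k * (p * r) - (\<Sum>i<k. N i)) \<le> m * (p * r)"
    unfolding m_def by (intro mult_left_mono) auto
  then have 1: "(real k - 1) * m * (p * r) \<le> (\<Sum>i<k. m * N i)"
    unfolding sum_distrib_left[symmetric] by (simp add: algebra_simps)
  have 2: "(\<Sum>i<k. q i * p * r) = (\<Sum>i<k. real (q i)) * (p * r)"
    by (simp add: sum_distrib_right mult.assoc)
  have 3: "(\<Sum>i<k. real (q i)) * (p * r) \<le> (real k - 1) * m * (p * r)"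
    using sum_le p r unfolding q_def m_def by (intro mult_right_mono) auto
  \<comment> \<open>Maximality bounds the sum of the \<open>N i\<close> from below by (k - 1) p r;
    the level set estimate and the hypothesis bound it from above by the same number. Hence every
    single estimate is an equality.\<close>
  have "(\<Sum>i<k. q i * p * r - m * N i) \<le> 0"
    using 1 2 3 unfolding sum_subtractf by linarith
  then have "(\<Sum>i<k. q i * p * r - m * N i) = 0"
    by (intro antisym sum_nonneg) (use Nle in auto)
  then have eqN: "m * N i = q i * p * r" if "i < k" for i
    using that by (subst (asm) sum_nonneg_eq_0_iff) (use Nle in auto)
  then have "(\<Sum>i<k. m * N i) = (\<Sum>i<k. q i * p * r)"
    by (intro sum.cong refl) simp
  then have "(real k - 1) * m * (p * r) \<le> (\<Sum>i<k. real (q i)) * (p * r)"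
    using 1 2 by linarith
  moreover have "p * r > 0" using p r by simp
  ultimately have sum_eq: "(\<Sum>i<k. real (q i)) = (real k - 1) * m"
    using 3 p r by auto
  have level: "card {l. d i l = d i j} = q i \<and>
      r * card {l \<in> E i. d i l = d i j} = p * card {l \<in> - E i. d i l = d i j}" if "i < k" for i j
    using level_set_count_eq[of "d i" "q i" "E i", OF q[OF that]] cardE[OF that] eqN[OF that] p r
    by (simp add: N_def m_def)
  have card_range: "card (range (d i)) * q i = CARD('m)" if "i < k" for i
  proof -
    have "(\<Sum>c\<in>range (d i). \<Sum>l\<in>{l \<in> UNIV. d i l = c}. 1::nat) = (\<Sum>l\<in>(UNIV :: 'm set). 1)"
      by (rule sum.group) auto
    moreover have "(\<Sum>l\<in>{l \<in> UNIV. d i l = c}. 1::nat) = q i" if "c \<in> range (d i)" for c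
      using level[OF \<open>i < k\<close>] that by auto
    ultimately show ?thesis by simp
  qed
  have q1: "q i \<ge> 1" if "i < k" for i
    using card_range[OF that] by (cases "q i") auto
  have scalar: "real (q i) = m" if i: "i < k" and "X i \<in> range mat" for i
  proof -
    obtain c where "X i = mat c" using \<open>X i \<in> range mat\<close> by blast
    then have "range (d i) \<subseteq> {c}"
      using eigenvalues_mat[where 'm = 'm and c = c] eigenvalues_diag[OF U[OF i] Y[OF i]] eigY(2)[OF i] by simp
    then have "card (range (d i)) = 1"
      by (metis UNIV_not_empty image_is_empty is_singletonI is_singleton_altdef subset_singletonD)
    then show ?thesis using card_range[OF i] by (simp add: m_def)
  qed
  have nonsc: "card (range (d i)) \<ge> 2" if i: "i < k" and "X i \<notin> range mat" for i
  proof (rule ccontr)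
    assume "\<not> card (range (d i)) \<ge> 2"
    moreover have "card (range (d i)) \<noteq> 0"
      using card_range[OF i] by (metis mult_is_0 zero_less_card_finite less_irrefl)
    ultimately have "card (range (d i)) = 1" by linarith
    then obtain c where "range (d i) = {c}"
      by (auto simp: card_1_singleton_iff)
    then have "diag_matrix (d i) = (mat c :: 'm cmatrix)"
      by (force simp: vec_eq_iff diag_nth mat_nth)
    then have Yc: "Y i = mat c"
      using Y[OF i] U[OF i] by (simp add: conj_mat)
    obtain V where V: "unitary V" "Y i = V ** X i ** V\<^sup>H"
      using orb[OF i] by (auto simp: SU_orbit_iff)
    have "X i = V\<^sup>H ** Y i ** V"
      using V(1) unfolding V(2) by (simp add: matrix_mul_assoc)
    also have "\<dots> = mat c"
      using V(1) unfolding Yc by (simp add: conj_mat)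
    finally show False using \<open>X i \<notin> range mat\<close> by blast
  qed
  define I where "I = {i. i < k \<and> X i \<notin> range mat}"
  have finI: "finite I" by (simp add: I_def)
  \<comment> \<open>A nonscalar entry has at least two eigenvalues, all of multiplicity q_i, so q_i
    is at most m / 2.\<close>
  have half: "m / 2 \<le> m - q i \<and> m - q i < m" if "i \<in> I" for i
  proof -
    have "2 * q i \<le> card (range (d i)) * q i"
      using nonsc[of i] that unfolding I_def by (intro mult_right_mono) blast+
    then have "2 * q i \<le> CARD('m)"
      using card_range[of i] that unfolding I_def mem_Collect_eq by linarith
    then have "2 * real (q i) \<le> m"
      unfolding m_def by linarith
    then show ?thesis using q1[of i] that by (simp add: I_def field_simps)
  qed
  \<comment> \<open>Scalar entries contribute 0 and each nonscalar one at least m / 2 but less than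
    m, so exactly two entries are nonscalar and each contributes m / 2.\<close>
  have "(\<Sum>i<k. m - q i) = m"
    using sum_eq by (simp add: sum_subtractf algebra_simps)
  moreover have "(\<Sum>i<k. m - q i) = (\<Sum>i\<in>I. m - q i)"
    by (intro sum.mono_neutral_right) (use scalar in \<open>auto simp: I_def\<close>)
  ultimately have sumI: "(\<Sum>i\<in>I. m - q i) = m" by simp
  have m0: "m > 0" using mpr p r by simp
  have "card I * (m / 2) \<le> m"
    using sum_bounded_below[of I "m / 2" "\<lambda>i. m - q i"] half sumI by simp
  then have "card I \<le> 2" using m0 by (simp add: field_simps)
  moreover have "card I \<noteq> 0"
    using sumI m0 finI by auto
  moreover have "card I \<noteq> 1"
  proof
    assume "card I = 1"
    then obtain i where "I = {i}" by (auto simp: card_1_singleton_iff)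
    then show False using sumI half[of i] by simp
  qed
  ultimately have cardI: "card I = 2" by linarith
  have q_half: "2 * q i = CARD('m)" if "i \<in> I" for i
  proof -
    have "(\<Sum>i\<in>I. (m - q i) - m / 2) = 0"
      using sumI cardI by (simp add: sum_subtractf)
    then have "(m - q i) - m / 2 = 0"
      using that half finI by (subst (asm) sum_nonneg_eq_0_iff) auto
    then show ?thesis by (simp add: m_def)
  qed
  have "exceptional_pair (nonscalar_entries (map X [0..<k]))"
    unfolding exceptional_pair_def
  proof
    have "length (nonscalar_entries (map X [0..<k])) = card {i. i < k \<and> map X [0..<k] ! i \<notin> range mat}"
      unfolding nonscalar_entries_def by (simp add: length_filter_conv_card)
    also have "{i. i < k \<and> map X [0..<k] ! i \<notin> range mat} = I"
      by (auto simp: I_def)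
    finally show "length (nonscalar_entries (map X [0..<k])) = 2"
      by (simp add: cardI)
    show "\<forall>A\<in>set (nonscalar_entries (map X [0..<k])). two_equal_eigenvalues A"
    proof
      fix A assume "A \<in> set (nonscalar_entries (map X [0..<k]))"
      then obtain i where i: "i \<in> I" and A: "A = X i"
        by (auto simp: nonscalar_entries_def I_def)
      have ik: "i < k" using i by (simp add: I_def)
      have eA: "eigenvalues A = range (d i)"
        unfolding A eigY(2)[OF ik, symmetric] by (rule eigenvalues_diag[OF U[OF ik] Y[OF ik]])
      have mult: "eig_mult A c = q i" if "c \<in> eigenvalues A" for c
        using that level[OF ik] unfolding eA
        unfolding A eigY(1)[OF ik, symmetric] eig_mult_diag[OF U[OF ik] Y[OF ik]] by auto
      have "card (range (d i)) * q i = 2 * q i"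
        using card_range[OF ik] q_half[OF i] by simp
      then have card2: "card (eigenvalues A) = 2"
        using q1[OF ik] by (simp add: eA)
      \<comment> \<open>For q_i = 1 we get m = 2 and p = r = 1, and the ratio condition would split
        a one-element level set into two halves of equal size.\<close>
      have "2 \<le> q i"
      proof (rule ccontr)
        assume "\<not> 2 \<le> q i"
        then have qi: "q i = 1" using q1[OF ik] by simp
        then have "m = 2" using q_half[OF i] by (simp add: m_def)
        then have pr1: "p = 1" "r = 1" using mpr p r by simp_all
        let ?j = undefined
        have "{l. d i l = d i ?j} = {l \<in> E i. d i l = d i ?j} \<union> {l \<in> - E i. d i l = d i ?j}" by auto
        then have "card {l. d i l = d i ?j} = card {l \<in> E i. d i l = d i ?j} + card {l \<in> - E i. d i l = d i ?j}"
          by (simp only:) (subst card_Un_disjoint, auto)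
        then show False
          using level[OF ik, of ?j] pr1 qi by simp presburger
      qed
      then show "two_equal_eigenvalues A"
        unfolding two_equal_eigenvalues_def using card2 mult q_half[OF i] by simp
    qed
  qed
  then show False using exc by blast
qed

subsection \<open>Open subsets from irreducible tuples\<close>

lemma su_algebra_iff: "X \<in> su_algebra \<longleftrightarrow> skew X \<and> trace X = 0"
  by (simp add: su_algebra_def skew_def)

lemma trace_adj: "trace (K\<^sup>H) = cnj (trace K)"
  by (simp add: trace_def)

lemma trace_scaleR: "trace (r *\<^sub>R K) = r *\<^sub>R trace (K :: 'm::finite cmatrix)"
  by (simp add: trace_def scaleR_sum_right)

lemma trace_mat: "trace (mat c :: 'm::finite cmatrix) = of_nat (CARD('m)) * c"
  by (simp add: trace_def mat_nth)

lemma subspace_su_algebra: "subspace (su_algebra :: 'm::finite cmatrix set)"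
  unfolding subspace_def
proof (intro conjI ballI allI)
  show "(0 :: 'm cmatrix) \<in> su_algebra"
    by (simp add: su_algebra_iff trace_def)
next
  fix x y :: "'m cmatrix" assume "x \<in> su_algebra" "y \<in> su_algebra"
  then show "x + y \<in> su_algebra"
    by (simp add: su_algebra_iff skew_def adj_simps trace_add)
next
  fix c and x :: "'m cmatrix" assume "x \<in> su_algebra"
  then show "c *\<^sub>R x \<in> su_algebra"
    by (simp add: su_algebra_iff skew_def adj_simps trace_scaleR)
qed

lemma skew_conj: "skew K \<Longrightarrow> skew (A ** K ** A\<^sup>H)" "skew K \<Longrightarrow> skew (A\<^sup>H ** K ** A)"
  by (simp_all add: skew_def adj_simps matrix_mul_assoc matrix_mul_minus_left matrix_mul_minus_right)

lemma su_algebra_conj: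
  assumes "unitary U" "K \<in> su_algebra"
  shows "U ** K ** U\<^sup>H \<in> su_algebra" "U\<^sup>H ** K ** U \<in> su_algebra"
proof -
  have "skew K" "trace K = 0" using assms(2) by (auto simp: su_algebra_iff)
  then show "U ** K ** U\<^sup>H \<in> su_algebra" "U\<^sup>H ** K ** U \<in> su_algebra"
    unfolding su_algebra_iff
    using skew_conj[of K U] trace_conj_unitary[OF assms(1), of K]
      trace_conj_unitary[OF unitary_adj[OF assms(1)], of K] by auto
qed

lemma su_algebra_commutator:
  assumes "skew A" "skew B"
  shows "commutator A B \<in> su_algebra"
  using assms trace_mul_sym[of A B]
  by (simp add: su_algebra_iff skew_def commutator_def adj_simps matrix_ring_simps trace_sub)

section \<open>Projection of the matrix space onto the Lie algebra\<close>

definition im_trace :: "'m::finite cmatrix \<Rightarrow> real" where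
  "im_trace K = Im (trace K) / CARD('m)"

definition herm_part :: "'m::finite cmatrix \<Rightarrow> 'm cmatrix" where
  "herm_part K = (1/2) *\<^sub>R (K + K\<^sup>H)"

text \<open>Every matrix is uniquely a Hermitian matrix plus an imaginary scalar plus an element of
  \<open>su_algebra\<close>; this is the projection to the last summand. It allows maps with
  parameters in the Lie algebra to be defined on a full Euclidean space.\<close>

definition su_part :: "'m::finite cmatrix \<Rightarrow> 'm cmatrix" where
  "su_part K = K - herm_part K - mat (\<i> * im_trace K)"

lemma mat_scaleR: "mat (r *\<^sub>R c) = r *\<^sub>R (mat c :: 'm::finite cmatrix)"
  by (simp add: vec_eq_iff mat_nth)

lemma bounded_linear_mat: "bounded_linear (mat :: complex \<Rightarrow> 'm::finite cmatrix)"
  by (rule linear_conv_bounded_linear[THEN iffD1]) (auto intro!: linearI simp: mat_add mat_scaleR)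

lemma bounded_linear_im_trace: "bounded_linear (im_trace :: 'm::finite cmatrix \<Rightarrow> real)"
  by (rule linear_conv_bounded_linear[THEN iffD1])
    (auto intro!: linearI simp: im_trace_def trace_add trace_scaleR add_divide_distrib)

lemma bounded_linear_herm_part: "bounded_linear (herm_part :: 'm::finite cmatrix \<Rightarrow> 'm cmatrix)"
  unfolding herm_part_def
  by (intro bounded_linear_const_scaleR bounded_linear_add bounded_linear_ident bounded_linear_adj)

lemma linear_su_part: "linear (su_part :: 'm::finite cmatrix \<Rightarrow> 'm cmatrix)"
proof -
  have "bounded_linear (su_part :: 'm cmatrix \<Rightarrow> 'm cmatrix)"
    unfolding su_part_def
    by (intro bounded_linear_sub bounded_linear_ident bounded_linear_herm_part
        bounded_linear_compose[OF bounded_linear_mat]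
        bounded_linear_compose[OF bounded_linear_mult_right]
        bounded_linear_compose[OF bounded_linear_of_real] bounded_linear_im_trace)
  then show ?thesis by (rule bounded_linear.linear)
qed

lemma su_part_in: "su_part K \<in> su_algebra"
proof -
  define S where "S = (1/2) *\<^sub>R (K - K\<^sup>H)"
  have eq: "su_part K = S - mat (\<i> * im_trace K)"
    by (simp add: su_part_def herm_part_def S_def vec_eq_iff) (simp add: field_simps)
  have "skew S"
    unfolding S_def skew_def adj_scaleR adj_diff adj_adj by (simp flip: scaleR_minus_right)
  then have "skew (su_part K)"
    unfolding eq skew_def adj_diff by (simp add: vec_eq_iff mat_nth)
  moreover have "trace S = \<i> * Im (trace K)"
    by (simp add: S_def trace_scaleR trace_sub trace_adj complex_eq_iff)
  then have "trace (su_part K) = 0"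
    unfolding eq trace_sub trace_mat by (simp add: im_trace_def)
  ultimately show ?thesis by (simp add: su_algebra_iff)
qed

lemma su_part_id: "K \<in> su_algebra \<Longrightarrow> su_part K = K"
  by (simp add: su_algebra_iff skew_def su_part_def herm_part_def im_trace_def)

lemma su_part_idem: "su_part (K - su_part K) = 0"
  using linear_diff[OF linear_su_part, of K "su_part K"] su_part_id[OF su_part_in, of K] by simp

lemma skew_su_part: "skew (su_part K)"
  using su_part_in by (auto simp: su_algebra_iff)

text \<open>Domain and target have equal dimension, so an injective derivative is invertible. Away
  from 0 only continuity is needed.\<close>

lemma open_image_injective_derivative:
  fixes F :: "'a::euclidean_space \<Rightarrow> 'a"
  assumes "continuous_on UNIV F" and der: "(F has_derivative F') (at 0)"
    and inj: "\<And>K. F' K = 0 \<Longrightarrow> K = 0" and S: "open S" "0 \<in> S"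
  shows "F 0 \<in> interior (F ` S)"
proof -
  have lin: "linear F'"
    using der by (rule has_derivative_linear)
  then have "inj F'"
    using inj linear_injective_0 by blast
  then obtain g where g: "linear g" "\<forall>x. F' (g x) = x"
    using linear_injective_isomorphism[OF lin] by metis
  show ?thesis
  proof (rule sussmann_open_mapping[OF open_UNIV assms(1) _ der])
    show "bounded_linear g" using g(1) by (simp add: linear_conv_bounded_linear)
    show "F' \<circ> g = id" using g(2) by (simp add: fun_eq_iff)
    show "0 \<in> interior S" using S by (simp add: interior_open)
  qed auto
qed

text \<open>By Schur's lemma this is irreducibility if \<open>S\<close> consists of normal matrices.\<close>

definition irreducible_set :: "'m::finite cmatrix set \<Rightarrow> bool" where
  "irreducible_set S \<longleftrightarrow> (\<forall>K. K\<^sup>H = K \<longrightarrow> (\<forall>Y\<in>S. K ** Y = Y ** K) \<longrightarrow> K \<in> range mat)"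

text \<open>Multiplying K by i gives a Hermitian matrix with the same commutation relations; it is
  scalar by irreducibility and has trace 0.\<close>

lemma irreducible_set_su:
  fixes K :: "'m::finite cmatrix"
  assumes irr: "irreducible_set S" and K: "K \<in> su_algebra" and comm: "\<And>Y. Y \<in> S \<Longrightarrow> K ** Y = Y ** K"
  shows "K = 0"
proof -
  have "(mat \<i> ** K)\<^sup>H = mat \<i> ** K"
    using K by (simp add: vec_eq_iff su_algebra_iff skew_def)
  moreover have "(mat \<i> ** K) ** Y = Y ** (mat \<i> ** K)" if "Y \<in> S" for Y
  proof -
    have "(mat \<i> ** K) ** Y = mat \<i> ** (Y ** K)"
      using comm[OF that] by (simp flip: matrix_mul_assoc)
    also have "\<dots> = Y ** (mat \<i> ** K)"
      by (simp add: matrix_mul_assoc mat_commute)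
    finally show ?thesis .
  qed
  ultimately have "mat \<i> ** K \<in> range mat"
    using irr unfolding irreducible_set_def by blast
  then obtain c where c: "mat \<i> ** K = mat c" by blast
  have "trace (mat \<i> ** K) = \<i> * trace K"
    by (simp add: trace_def sum_distrib_left)
  then have "trace (mat c :: 'm cmatrix) = 0"
    using K c by (simp add: su_algebra_iff)
  then have "c = 0" by (simp add: trace_mat)
  then have "\<i> * K $ a $ b = 0" for a b
    using c by (metis mat_mul_nth mat_0 zero_index)
  then show "K = 0" by (simp add: vec_eq_iff)
qed

text \<open>The adjoint of bracketing with Y is bracketing with the conjugate transpose of Y. The
  increments in the next theorem are taken from this formula.\<close>

lemma commutator_inner: "commutator G Y \<bullet> K = G \<bullet> commutator K (Y\<^sup>H)"
  by (simp add: commutator_def inner_diff_left inner_diff_right inner_mul_left[of Y] inner_mul_right[of G])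

text \<open>Each Y is rotated by the adjoint of its own infinitesimal action applied to K. Then the
  derivative D satisfies <D K, K> = 2 times the sum of |G Y K|^2 for K in the Lie algebra, so its
  kernel there commutes with all Y and vanishes by irreducibility.\<close>

theorem orbit_sum_open:
  fixes Xs Ys :: "'m::finite cmatrix list"
  assumes orb: "list_all2 (\<lambda>Y X. Y \<in> SU_orbit X) Ys Xs"
    and su: "\<And>Y. Y \<in> set Ys \<Longrightarrow> Y \<in> su_algebra" and irr: "irreducible_set (set Ys)"
  shows "contains_nonempty_open_of su_algebra (orbit_sum Xs)"
proof -
  have skew: "skew Y" if "Y \<in> set Ys" for Y
    using su[OF that] by (simp add: su_algebra_iff)
  define G where "G Y K = commutator (su_part K) (Y\<^sup>H)" for Y K :: "'m cmatrix"
  have linG: "linear (G Y)" for Y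
    unfolding G_def commutator_def
    by (intro linearI) (simp_all add: linear_add[OF linear_su_part] linear_scale[OF linear_su_part]
        matrix_ring_simps scaleR_diff_right)
  have skY: "skew (Y\<^sup>H)" if "Y \<in> set Ys" for Y
    using skew[OF that] by (simp add: skew_def adj_minus)
  \<comment> \<open>Outside the tuple the increment is set to 0, which makes it skew-Hermitian for
    every Y and permits the inductions over the list below.\<close>
  define G0 where "G0 Y = (if Y \<in> set Ys then G Y else (\<lambda>_. 0))" for Y
  have skG: "skew (G0 Y K)" for Y K
    using su_algebra_commutator[OF skew_su_part skY, of Y K] by (simp add: G0_def G_def su_algebra_iff)
  have linG0: "linear (G0 Y)" for Y
    using linG by (simp add: G0_def linear_zero)
  define \<Phi> where "\<Phi> K = (\<Sum>Y\<leftarrow>Ys. rotate_by (G0 Y K) Y)" for K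
  define D where "D K = (\<Sum>Y\<leftarrow>Ys. 2 *\<^sub>R (G0 Y K ** Y - Y ** G0 Y K))" for K
  have cont: "continuous_on UNIV \<Phi>"
    unfolding \<Phi>_def
  proof (induction Ys)
    case (Cons Y Ys)
    show ?case
      using Cons by (simp add: continuous_on_add continuous_on_rotate_by[OF linG0 skG])
  qed simp
  have der: "(\<Phi> has_derivative D) (at 0)"
    unfolding \<Phi>_def D_def
  proof (induction Ys)
    case (Cons Y Ys)
    show ?case
      using has_derivative_add[OF has_derivative_rotate_by[OF linG0 skG] Cons] by simp
  qed simp
  \<comment> \<open>The second summand supplies the directions complementary to
    \<open>su_algebra\<close>. It has to vanish when F K lies in \<open>su_algebra\<close>, and then
    F K is a sum of orbit elements.\<close>
  define F where "F K = \<Phi> K + (K - su_part K)" for K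
  have bl: "bounded_linear (su_part :: 'm cmatrix \<Rightarrow> _)"
    using linear_su_part by (simp add: linear_conv_bounded_linear)
  have contF: "continuous_on UNIV F"
    unfolding F_def by (intro continuous_intros cont linear_continuous_on bl)
  have derF: "(F has_derivative (\<lambda>K. D K + (K - su_part K))) (at 0)"
    unfolding F_def
    by (intro has_derivative_add der has_derivative_diff has_derivative_ident
        bounded_linear_imp_has_derivative bl)
  have D_sum: "D K = (\<Sum>Y\<leftarrow>Ys. 2 *\<^sub>R commutator (G Y K) Y)" for K
    unfolding D_def by (intro arg_cong[where f = sum_list] map_cong refl) (simp add: G0_def commutator_def)
  have D_su: "D K \<in> su_algebra" for K
  proof -
    have "(\<Sum>Y\<leftarrow>Zs. 2 *\<^sub>R commutator (G Y K) Y) \<in> su_algebra" if "set Zs \<subseteq> set Ys" for Zs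
      using that
    proof (induction Zs)
      case Nil
      then show ?case using subspace_0[OF subspace_su_algebra] by simp
    next
      case (Cons Y Zs)
      have "skew (G Y K)" using skG[of Y K] Cons.prems by (simp add: G0_def)
      then have "commutator (G Y K) Y \<in> su_algebra"
        using su_algebra_commutator[OF _ skew] Cons.prems by simp
      then show ?case
        using Cons by (auto intro!: subspace_add subspace_scale subspace_su_algebra)
    qed
    then show ?thesis unfolding D_sum by blast
  qed
  have "K = 0" if 0: "D K + (K - su_part K) = 0" for K
  proof -
    have "su_part (D K + (K - su_part K)) = D K"
      by (simp add: linear_add[OF linear_su_part] su_part_id[OF D_su] su_part_idem)
    then have DK: "D K = 0" unfolding 0 linear_0[OF linear_su_part] by simp
    then have K: "su_part K = K" using 0 by simp
    have "D K \<bullet> K = (\<Sum>Y\<leftarrow>Ys. 2 * (norm (G Y K))\<^sup>2)"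
    proof -
      have "(\<Sum>Y\<leftarrow>Zs. 2 *\<^sub>R commutator (G Y K) Y) \<bullet> K = (\<Sum>Y\<leftarrow>Zs. 2 * (norm (G Y K))\<^sup>2)" for Zs
        by (induction Zs) (simp_all add: inner_add_left commutator_inner G_def K power2_norm_eq_inner)
      then show ?thesis unfolding D_sum .
    qed
    then have "(\<Sum>Y\<leftarrow>Ys. 2 * (norm (G Y K))\<^sup>2) = 0" using DK by simp
    then have "2 * (norm (G Y K))\<^sup>2 = 0" if "Y \<in> set Ys" for Y
      using that by (subst (asm) sum_list_nonneg_eq_0_iff) auto
    then have GY: "G Y K = 0" if "Y \<in> set Ys" for Y
      using that by simp
    have "K ** Y = Y ** K" if "Y \<in> set Ys" for Y
    proof -
      have "Y\<^sup>H = - Y" using skew[OF that] by (simp add: skew_def)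
      then show ?thesis
        using GY[OF that] unfolding G_def K commutator_def
        by (simp add: matrix_mul_minus_left matrix_mul_minus_right)
    qed
    then show "K = 0"
      using irreducible_set_su[OF irr, of K] su_part_in[of K] K by simp
  qed
  then have "F 0 \<in> interior (F ` UNIV)"
    using open_image_injective_derivative[OF contF derF _ open_UNIV] by blast
  moreover have "F K \<in> orbit_sum Xs" if "F K \<in> su_algebra \<or> K = 0" for K
  proof -
    have rot: "list_all2 (\<lambda>Y X. Y \<in> SU_orbit X) (map (\<lambda>Y. rotate_by (G0 Y K) Y) Ys) Xs"
      unfolding list_all2_map1 using orb by (rule list_all2_mono) (rule rotate_by_in_orbit[OF skG])
    then have "\<Phi> K \<in> orbit_sum Xs"
      unfolding orbit_sum_def \<Phi>_def by blast
    moreover have "K - su_part K = 0"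
    proof (cases "K = 0")
      case True
      then show ?thesis using linear_0[OF linear_su_part] by simp
    next
      case False
      then have FK: "F K \<in> su_algebra" using that by blast
      have \<Phi>: "\<Phi> K \<in> su_algebra"
      proof -
        have "(\<Sum>Y\<leftarrow>Zs. rotate_by (G0 Y K) Y) \<in> su_algebra" if "set Zs \<subseteq> set Ys" for Zs
          using that
        proof (induction Zs)
          case (Cons Y Zs)
          then have "rotate_by (G0 Y K) Y \<in> su_algebra"
            unfolding rotate_by_def using su_algebra_conj(1)[OF unitary_cayley[OF skG]] su by simp
          then show ?case
            using Cons subspace_add[OF subspace_su_algebra] by simp
        qed (simp add: subspace_0[OF subspace_su_algebra])
        then show ?thesis by (simp add: \<Phi>_def)
      qed
      then have "K - su_part K \<in> su_algebra"
        using FK subspace_diff[OF subspace_su_algebra FK \<Phi>] by (simp add: F_def)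
      then show ?thesis using su_part_id su_part_idem by metis
    qed
    ultimately show ?thesis by (simp add: F_def)
  qed
  moreover have "F 0 \<in> su_algebra"
  proof -
    have "F 0 = sum_list Ys"
      using linear_0[OF linear_su_part] by (simp add: F_def \<Phi>_def linear_0[OF linG0])
    also have "\<dots> \<in> su_algebra"
    proof -
      have "sum_list Zs \<in> su_algebra" if "set Zs \<subseteq> su_algebra" for Zs :: "'m cmatrix list"
        using that by (induction Zs)
          (simp_all add: subspace_0[OF subspace_su_algebra] subspace_add[OF subspace_su_algebra])
      then show ?thesis using su by blast
    qed
    finally show ?thesis .
  qed
  moreover have "F K \<in> orbit_sum Xs" if "F K \<in> interior (range F)" "F K \<in> su_algebra" for K
    using that calculation(2) by blast
  ultimately have "su_algebra \<inter> interior (range F) \<noteq> {}" "su_algebra \<inter> interior (range F) \<subseteq> orbit_sum Xs"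
    using interior_subset[of "range F"] by (blast, fastforce)
  then show ?thesis
    unfolding contains_nonempty_open_of_def by (metis openin_open_Int open_interior)
qed

fun twisted_product :: "'m::finite cmatrix list \<Rightarrow> 'm cmatrix \<Rightarrow> 'm cmatrix" where
  "twisted_product [] K = mat 1"
| "twisted_product (y # ys) K = rotate_by (K - y\<^sup>H ** K ** y) y ** twisted_product ys (y\<^sup>H ** K ** y)"

text \<open>The derivative of \<open>twisted_product\<close> at \<open>0\<close>, translated back to the identity from the right. The
  increments are chosen as adjoints of the partial derivatives, so that it is positive semidefinite.\<close>

fun twisted_deriv :: "'m::finite cmatrix list \<Rightarrow> 'm cmatrix \<Rightarrow> 'm cmatrix" where
  "twisted_deriv [] K = 0"
| "twisted_deriv (y # ys) K = 2 *\<^sub>R ((K - y\<^sup>H ** K ** y) - y ** (K - y\<^sup>H ** K ** y) ** y\<^sup>H) +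
     y ** twisted_deriv ys (y\<^sup>H ** K ** y) ** y\<^sup>H"

lemma linear_conj_diff:
  assumes "linear L"
  shows "linear (\<lambda>x. L x - y\<^sup>H ** L x ** (y :: 'm::finite cmatrix))" "linear (\<lambda>x. y\<^sup>H ** L x ** (y :: 'm::finite cmatrix))"
  by (intro linearI; simp add: linear_add[OF assms] linear_scale[OF assms] matrix_ring_simps
      scaleR_diff_right)+

lemma skew_conj_diff: "skew K \<Longrightarrow> skew (K - y\<^sup>H ** K ** y)"
  by (simp add: skew_def adj_simps matrix_ring_simps)

lemma twisted_product_0: "twisted_product ys 0 = foldr (**) ys (mat 1)"
  by (induction ys) simp_all

lemma continuous_on_twisted_product:
  fixes L :: "'a::euclidean_space \<Rightarrow> 'm::finite cmatrix"
  assumes "linear L" "\<And>x. skew (L x)"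
  shows "continuous_on UNIV (\<lambda>x. twisted_product ys (L x))"
  using assms
proof (induction ys arbitrary: L)
  case (Cons y ys)
  show ?case
    unfolding twisted_product.simps
    by (intro continuous_intros continuous_on_rotate_by Cons.IH linear_conj_diff Cons.prems
        skew_conj_diff skew_conj(2))
qed simp

lemma has_derivative_twisted_product:
  fixes L :: "'a::euclidean_space \<Rightarrow> 'm::finite cmatrix"
  assumes "linear L" "\<And>x. skew (L x)" "\<forall>y\<in>set ys. unitary y"
  shows "((\<lambda>x. twisted_product ys (L x)) has_derivative
    (\<lambda>x. twisted_deriv ys (L x) ** foldr (**) ys (mat 1))) (at 0)"
  using assms
proof (induction ys arbitrary: L)
  case (Cons y ys)
  let ?G = "\<lambda>x. L x - y\<^sup>H ** L x ** y" and ?K = "\<lambda>x. y\<^sup>H ** L x ** y" and ?z = "foldr (**) ys (mat 1)"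
  have y: "unitary y" using Cons.prems(3) by simp
  have L0: "L 0 = 0" using Cons.prems(1) by (rule linear_0)
  have "((\<lambda>x. rotate_by (?G x) y) has_derivative (\<lambda>x. 2 *\<^sub>R (?G x ** y - y ** ?G x))) (at 0)"
    by (rule has_derivative_rotate_by[OF linear_conj_diff(1)[OF Cons.prems(1)] skew_conj_diff[OF Cons.prems(2)]])
  moreover have "((\<lambda>x. twisted_product ys (?K x)) has_derivative (\<lambda>x. twisted_deriv ys (?K x) ** ?z)) (at 0)"
    by (intro Cons.IH linear_conj_diff(2) skew_conj(2)) (use Cons.prems in auto)
  ultimately have "((\<lambda>x. rotate_by (?G x) y ** twisted_product ys (?K x)) has_derivative
      (\<lambda>x. rotate_by (?G 0) y ** (twisted_deriv ys (?K x) ** ?z) +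
        2 *\<^sub>R (?G x ** y - y ** ?G x) ** twisted_product ys (?K 0))) (at 0)"
    by (rule has_derivative_cmatrix_mul)
  moreover have "rotate_by (?G 0) y ** (twisted_deriv ys (?K x) ** ?z) +
        2 *\<^sub>R (?G x ** y - y ** ?G x) ** twisted_product ys (?K 0) =
      twisted_deriv (y # ys) (L x) ** foldr (**) (y # ys) (mat 1)" for x
  proof -
    have "(A - y ** A ** y\<^sup>H) ** y = A ** y - y ** A" for A
      using y by (simp add: matrix_mul_diff_right)
    then have "(2 *\<^sub>R (A - y ** A ** y\<^sup>H) + y ** B ** y\<^sup>H) ** y = 2 *\<^sub>R (A ** y - y ** A) + y ** B" for A B
      using y by (simp only: matrix_mul_add_right matrix_mul_scaleR_left unitary_cancel)
    then have "(2 *\<^sub>R (A - y ** A ** y\<^sup>H) + y ** B ** y\<^sup>H) ** (y ** ?z) =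
        y ** (B ** ?z) + 2 *\<^sub>R (A ** y - y ** A) ** ?z" for A B
      by (simp only: matrix_mul_assoc matrix_mul_add_right add.commute)
    then show ?thesis
      by (simp add: L0 twisted_product_0)
  qed
  ultimately show ?case by simp
qed simp

lemma twisted_deriv_su:
  "K \<in> su_algebra \<Longrightarrow> \<forall>y\<in>set ys. unitary y \<Longrightarrow> twisted_deriv ys K \<in> su_algebra"
proof (induction ys arbitrary: K)
  case Nil
  then show ?case using subspace_0[OF subspace_su_algebra] by simp
next
  case (Cons y ys)
  have y: "unitary y" using Cons.prems by simp
  have K: "y\<^sup>H ** K ** y \<in> su_algebra"
    by (rule su_algebra_conj(2)[OF y Cons.prems(1)])
  show ?case
    unfolding twisted_deriv.simps
    by (intro subspace_add subspace_scale subspace_diff subspace_su_algebra su_algebra_conj(1) y K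
        Cons.IH Cons.prems) (use Cons.prems in auto)
qed

text \<open>The inner product telescopes to a sum of 2 |K - K'|^2 over successive conjugates K' of K
  by the factors. If it is 0 then no conjugation changes K, so K commutes with every factor.\<close>

lemma twisted_deriv_inner:
  assumes "\<forall>y\<in>set ys. unitary y"
  shows "K \<bullet> twisted_deriv ys K \<ge> 0 \<and> (K \<bullet> twisted_deriv ys K = 0 \<longrightarrow> (\<forall>y\<in>set ys. K ** y = y ** K))"
  using assms
proof (induction ys arbitrary: K)
  case (Cons y ys)
  have y: "unitary y" using Cons.prems by simp
  define K' where "K' = y\<^sup>H ** K ** y"
  have conj: "K \<bullet> (y ** A ** y\<^sup>H) = K' \<bullet> A" for A
  proof -
    have "K \<bullet> (y ** A ** y\<^sup>H) = (y ** A) \<bullet> (K ** y)"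
      unfolding inner_commute[of K] by (subst inner_mul_right) simp
    also have "\<dots> = A \<bullet> (y\<^sup>H ** (K ** y))"
      by (rule inner_mul_left)
    finally show ?thesis
      by (simp add: K'_def inner_commute matrix_mul_assoc)
  qed
  have "K \<bullet> twisted_deriv (y # ys) K = 2 * (norm (K - K'))\<^sup>2 + K' \<bullet> twisted_deriv ys K'"
    by (simp add: inner_add_right inner_diff_right conj K'_def[symmetric] power2_norm_eq_inner
        inner_diff_left inner_commute)
  moreover have IH: "K' \<bullet> twisted_deriv ys K' \<ge> 0"
    "K' \<bullet> twisted_deriv ys K' = 0 \<Longrightarrow> \<forall>y\<in>set ys. K' ** y = y ** K'"
    using Cons.IH[of K'] Cons.prems by auto
  moreover have "(norm (K - K'))\<^sup>2 \<ge> 0" by simp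
  moreover have "\<forall>y\<in>set (y # ys). K ** y = y ** K" if "K \<bullet> twisted_deriv (y # ys) K = 0"
  proof -
    have "(norm (K - K'))\<^sup>2 = 0" "K' \<bullet> twisted_deriv ys K' = 0"
      using that calculation by linarith+
    then have K: "K = K'" and ys: "\<forall>y\<in>set ys. K' ** y = y ** K'"
      using IH(2) by auto
    have "y ** K = y ** (y\<^sup>H ** K ** y)"
      using K by (simp add: K'_def)
    also have "\<dots> = K ** y"
      using y by (simp add: matrix_mul_assoc)
    finally show ?thesis using ys K by simp
  qed
  ultimately show ?case by simp
qed simp

lemma unitary_foldr: "\<forall>y\<in>set ys. unitary y \<Longrightarrow> unitary (foldr (**) ys (mat 1))"
  by (induction ys) (auto intro: unitary_mul simp: unitary_def[of "mat 1"])

lemma twisted_product_in: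
  assumes "list_all2 (\<lambda>Y X. Y \<in> SU_orbit X) ys xs" "skew K"
  shows "twisted_product ys K \<in> class_product xs"
proof -
  have "\<exists>zs. list_all2 (\<lambda>Y X. Y \<in> SU_orbit X) zs xs \<and> twisted_product ys K = foldr (**) zs (mat 1)"
    using assms
  proof (induction ys xs arbitrary: K rule: list_all2_induct)
    case (Cons y ys x xs)
    then obtain zs where zs: "list_all2 (\<lambda>Y X. Y \<in> SU_orbit X) zs xs"
      "twisted_product ys (y\<^sup>H ** K ** y) = foldr (**) zs (mat 1)"
      using skew_conj(2) by blast
    have "rotate_by (K - y\<^sup>H ** K ** y) y \<in> SU_orbit x"
      using Cons by (intro rotate_by_in_orbit skew_conj_diff)
    then show ?case
      using zs by (intro exI[of _ "rotate_by (K - y\<^sup>H ** K ** y) y # zs"]) simp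
  qed simp
  then show ?thesis unfolding class_product_def by blast
qed

lemma SU_orbit_SU: "x \<in> SU_group \<Longrightarrow> y \<in> SU_orbit x \<Longrightarrow> y \<in> SU_group"
proof -
  assume x: "x \<in> SU_group" and "y \<in> SU_orbit x"
  then obtain U where U: "unitary U" "y = U ** x ** U\<^sup>H" by (auto simp: SU_orbit_iff)
  have "det U * det (U\<^sup>H) = 1"
    using U(1) by (simp flip: det_mul)
  then have "det y = 1"
    using x by (simp add: U(2) det_mul SU_group_iff)
  moreover have "unitary y"
    unfolding U(2) using x U(1) by (intro unitary_mul unitary_adj) (simp_all add: SU_group_iff)
  ultimately show ?thesis by (simp add: SU_group_iff)
qed

lemma class_product_SU:
  assumes "set xs \<subseteq> SU_group"
  shows "class_product xs \<subseteq> SU_group"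
proof
  fix z assume "z \<in> class_product xs"
  then obtain ys where ys: "list_all2 (\<lambda>Y X. Y \<in> SU_orbit X) ys xs" and z: "z = foldr (**) ys (mat 1)"
    by (auto simp: class_product_def)
  from ys assms show "z \<in> SU_group"
    unfolding z
  proof (induction ys xs rule: list_all2_induct)
    case Nil
    then show ?case by (simp add: SU_group_iff unitary_def)
  next
    case (Cons y ys x xs)
    then have "y \<in> SU_group" "foldr (**) ys (mat 1) \<in> SU_group"
      using SU_orbit_SU by auto
    then show ?case by (simp add: SU_group_iff unitary_mul det_mul)
  qed
qed

text \<open>The scheme of \<open>orbit_sum_open\<close>, with a Hermitian factor and a phase as
  complementary coordinates. Membership in the group must force both to be trivial, which holds only
  near 0.\<close>

theorem class_product_open:
  fixes xs ys :: "'m::finite cmatrix list"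
  assumes orb: "list_all2 (\<lambda>Y X. Y \<in> SU_orbit X) ys xs"
    and xs: "set xs \<subseteq> SU_group" and irr: "irreducible_set (set ys)"
  shows "contains_nonempty_open_of SU_group (class_product xs)"
proof -
  have ySU: "y \<in> SU_group" if "y \<in> set ys" for y
    using orb xs that SU_orbit_SU by (metis (no_types, lifting) in_set_conv_nth list_all2_conv_all_nth nth_mem subsetD)
  then have uni: "\<forall>y\<in>set ys. unitary y" by (simp add: SU_group_iff)
  define z where "z = foldr (**) ys (mat 1)"
  have z: "unitary z" unfolding z_def by (rule unitary_foldr[OF uni])
  define \<Phi> where "\<Phi> K = twisted_product ys (su_part K)" for K
  define D where "D K = twisted_deriv ys (su_part K)" for K
  define c where "c K = exp (\<i> * of_real (im_trace K))" for K :: "'m cmatrix"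
  \<comment> \<open>To first order at 0, the extra factor adds the Hermitian part and the imaginary
    scalar of K, that is, \<open>K - su_part K\<close>.\<close>
  define F where "F K = \<Phi> K ** ((mat 1 + herm_part K) ** mat (c K))" for K
  have \<Phi>0: "\<Phi> 0 = z"
    unfolding \<Phi>_def z_def linear_0[OF linear_su_part] by (rule twisted_product_0)
  have h0: "herm_part 0 = (0 :: 'm cmatrix)" and t0: "im_trace (0 :: 'm cmatrix) = 0"
    by (simp_all add: herm_part_def im_trace_def trace_def)
  have cont_c: "continuous_on UNIV c"
    unfolding c_def by (intro continuous_intros linear_continuous_on bounded_linear_im_trace)
  have cont: "continuous_on UNIV F"
    unfolding F_def \<Phi>_def
    by (intro continuous_intros continuous_on_twisted_product linear_su_part skew_su_part
        linear_continuous_on bounded_linear_herm_part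
        bounded_linear.continuous_on[OF bounded_linear_mat] cont_c)
  have der_c: "(c has_derivative (\<lambda>K. \<i> * of_real (im_trace K))) (at 0)"
  proof -
    have "((\<lambda>K. \<i> * of_real (im_trace K)) has_derivative (\<lambda>K :: 'm cmatrix. \<i> * of_real (im_trace K))) (at 0)"
      by (intro bounded_linear_imp_has_derivative bounded_linear_compose[OF bounded_linear_mult_right]
          bounded_linear_compose[OF bounded_linear_of_real] bounded_linear_im_trace)
    moreover have "(exp has_derivative (*) (exp (\<i> * of_real (im_trace (0 :: 'm cmatrix)))))
        (at (\<i> * of_real (im_trace (0 :: 'm cmatrix))))"
      using DERIV_exp unfolding has_field_derivative_def .
    ultimately have "(c has_derivative (\<lambda>K. exp (\<i> * of_real (im_trace (0 :: 'm cmatrix))) * (\<i> * of_real (im_trace K)))) (at 0)"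
      unfolding c_def by (rule has_derivative_compose)
    then show ?thesis by (simp add: t0)
  qed
  have der_\<Phi>: "(\<Phi> has_derivative (\<lambda>K. D K ** z)) (at 0)"
    unfolding \<Phi>_def D_def z_def
    by (intro has_derivative_twisted_product linear_su_part skew_su_part uni)
  have der: "(F has_derivative (\<lambda>K. z ** ((mat 1 + herm_part 0) ** mat (\<i> * of_real (im_trace K)) +
      (0 + herm_part K) ** mat (c 0)) + (D K ** z) ** ((mat 1 + herm_part 0) ** mat (c 0)))) (at 0)"
    unfolding F_def \<Phi>0[symmetric]
    by (intro has_derivative_cmatrix_mul has_derivative_add has_derivative_const
        bounded_linear_imp_has_derivative bounded_linear_herm_part
        bounded_linear.has_derivative[OF bounded_linear_mat] der_c der_\<Phi>[folded \<Phi>0])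
  have "K = 0" if "z ** ((mat 1 + herm_part 0) ** mat (\<i> * of_real (im_trace K)) +
      (0 + herm_part K) ** mat (c 0)) + (D K ** z) ** ((mat 1 + herm_part 0) ** mat (c 0)) = 0" for K
  proof -
    have "z ** (K - su_part K) + D K ** z = 0"
      using that by (simp add: h0 t0 c_def su_part_def add.commute)
    then have "z\<^sup>H ** (z ** (K - su_part K) + D K ** z) = 0" by simp
    then have eq: "(K - su_part K) + z\<^sup>H ** D K ** z = 0"
      using z by (simp add: matrix_add_ldistrib matrix_mul_assoc)
    have Dsu: "z\<^sup>H ** D K ** z \<in> su_algebra"
      unfolding D_def by (intro su_algebra_conj(2)[OF z] twisted_deriv_su su_part_in uni)
    have "su_part ((K - su_part K) + z\<^sup>H ** D K ** z) = z\<^sup>H ** D K ** z"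
      by (simp add: linear_add[OF linear_su_part] su_part_id[OF Dsu] su_part_idem)
    then have D0: "z\<^sup>H ** D K ** z = 0"
      unfolding eq linear_0[OF linear_su_part] by simp
    then have K: "su_part K = K" using eq by simp
    have "z ** (z\<^sup>H ** D K ** z) ** z\<^sup>H = 0" using D0 by simp
    then have "D K = 0" using z by (simp add: matrix_mul_assoc)
    then have "\<forall>y\<in>set ys. K ** y = y ** K"
      using twisted_deriv_inner[OF uni, of K] by (simp add: D_def K)
    then show "K = 0"
      using irreducible_set_su[OF irr, of K] su_part_in[of K] K by simp
  qed
  note int = open_image_injective_derivative[OF cont der this]
  obtain B where B: "\<And>A A'. norm (A ** A') \<le> norm (A :: 'm cmatrix) * norm (A' :: 'm cmatrix) * B" "B > 0"
    using bounded_bilinear.pos_bounded[OF bounded_bilinear_cmatrix_mul] by auto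
  \<comment> \<open>The first bound excludes nonzero Hermitian h with (1 + h)^2 = 1, the second
    excludes phases that are nontrivial m-th roots of unity.\<close>
  define S where "S = {K :: 'm cmatrix. norm (herm_part K) * B < 2 \<and> \<bar>CARD('m) * im_trace K\<bar> < 1}"
  have "open S"
    unfolding S_def
    by (intro open_Collect_conj open_Collect_less continuous_intros linear_continuous_on
        bounded_linear_herm_part bounded_linear_im_trace)
  moreover have "0 \<in> S" by (simp add: S_def h0 t0)
  ultimately have F0: "F 0 \<in> interior (F ` S)"
    using int by blast
  have "F K \<in> class_product xs" if K: "K \<in> S" and FK: "F K \<in> SU_group" for K
  proof -
    have \<Phi>: "\<Phi> K \<in> class_product xs"
      unfolding \<Phi>_def by (rule twisted_product_in[OF orb skew_su_part])
    then have \<Phi>SU: "unitary (\<Phi> K)" "det (\<Phi> K) = 1"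
      using class_product_SU[OF xs] by (auto simp: SU_group_iff)
    let ?h = "herm_part K"
    have cc: "cnj (c K) * c K = 1"
      unfolding c_def by (simp add: exp_cnj flip: exp_add)
    have hh: "?h\<^sup>H = ?h"
      by (simp add: herm_part_def adj_simps add.commute)
    have "unitary ((\<Phi> K)\<^sup>H ** F K)"
      using FK \<Phi>SU by (intro unitary_mul unitary_adj) (auto simp: SU_group_iff)
    then have "unitary ((mat 1 + ?h) ** mat (c K))"
      using \<Phi>SU by (simp add: F_def matrix_mul_assoc)
    then have "((mat 1 + ?h) ** mat (c K))\<^sup>H ** ((mat 1 + ?h) ** mat (c K)) = mat 1"
      unfolding unitary_def by (rule conjunct1)
    moreover have "((mat 1 + ?h) ** mat (c K))\<^sup>H ** ((mat 1 + ?h) ** mat (c K)) =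
        mat (cnj (c K)) ** ((mat 1 + ?h) ** (mat 1 + ?h)) ** mat (c K)"
      by (simp add: adj_mul adj_add hh matrix_mul_assoc)
    moreover have "\<dots> = mat (cnj (c K) * c K) ** ((mat 1 + ?h) ** (mat 1 + ?h))"
      unfolding mat_commute[of "mat (cnj (c K)) ** ((mat 1 + ?h) ** (mat 1 + ?h))"]
      by (simp only: matrix_mul_assoc mat_mul_mat mult.commute)
    ultimately have "(mat 1 + ?h) ** (mat 1 + ?h) = mat 1"
      unfolding cc by simp
    \<comment> \<open>With the submultiplicativity constant B this gives 2 |h| <= B |h|^2, which on
      S is possible only for h = 0.\<close>
    then have "2 *\<^sub>R ?h = - (?h ** ?h)"
      by (simp add: matrix_ring_simps scaleR_2 eq_neg_iff_add_eq_0 algebra_simps)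
    then have "2 * norm ?h = norm (?h ** ?h)"
      by (metis abs_numeral norm_minus_cancel norm_scaleR)
    also have "\<dots> \<le> norm ?h * (norm ?h * B)"
      using B(1)[of ?h ?h] by (simp add: mult.assoc)
    finally have "norm ?h * (2 - norm ?h * B) \<le> 0" by (simp add: algebra_simps)
    then have h: "?h = 0"
      using K by (auto simp: S_def mult_le_0_iff)
    then have Feq: "F K = mat (c K) ** \<Phi> K" unfolding F_def mat_commute[symmetric] by simp
    then have "c K ^ CARD('m) = 1"
      using FK \<Phi>SU(2) by (simp add: SU_group_iff det_mat_mul)
    then have "exp (\<i> * of_real (CARD('m) * im_trace K)) = 1"
      unfolding c_def by (simp add: mult_ac flip: exp_of_nat_mult)
    then obtain n :: int where n: "CARD('m) * im_trace K = of_int (2 * n) * pi"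
      by (auto simp: exp_eq_1)
    have "\<bar>of_int (2 * n) * pi\<bar> < 1"
      using K n by (simp add: S_def)
    have "n = 0"
    proof (rule ccontr)
      assume "n \<noteq> 0"
      then have "\<bar>real_of_int (2 * n)\<bar> \<ge> 1" by linarith
      then have "1 * 1 \<le> \<bar>real_of_int (2 * n)\<bar> * pi"
        using pi_ge_two by (intro mult_mono) auto
      then show False using \<open>\<bar>of_int (2 * n) * pi\<bar> < 1\<close> by (simp add: abs_mult)
    qed
    then have "im_trace K = 0" using n by simp
    then have "c K = 1" by (simp add: c_def)
    then show ?thesis using Feq \<Phi> by simp
  qed
  moreover have "F 0 \<in> SU_group"
  proof -
    have "F 0 = z" by (simp add: F_def \<Phi>0 h0 c_def t0)
    moreover have "z \<in> class_product xs" unfolding class_product_def z_def using orb by blast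
    ultimately show ?thesis using class_product_SU[OF xs] by blast
  qed
  ultimately have "SU_group \<inter> interior (F ` S) \<noteq> {}" "SU_group \<inter> interior (F ` S) \<subseteq> class_product xs"
    using F0 interior_subset[of "F ` S"] by blast+
  then show ?thesis
    unfolding contains_nonempty_open_of_def by (metis openin_open_Int open_interior)
qed

subsection \<open>Spectra of generic matrices\<close>

text \<open>The codimension of an intersection is at most the sum of the codimensions. The bound is
  stated over the integers because it may be negative. The function c selects one number for each
  matrix, and the sum and the product act as scalars on the intersection.\<close>

lemma common_eigenspace:
  fixes Ys Xs :: "'m::finite cmatrix list"
  assumes "list_all2 (\<lambda>Y X. Y \<in> SU_orbit X) Ys Xs" "\<forall>X\<in>set Xs. normal X"
  shows "\<exists>V. vec.subspace V \<and>
    int (vec.dim V) \<ge> int CARD('m) - (\<Sum>X\<leftarrow>Xs. int CARD('m) - int (eig_mult X (c X))) \<and>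
    (\<forall>v\<in>V. sum_list Ys *v v = (\<Sum>X\<leftarrow>Xs. c X) *s v \<and>
      foldr (**) Ys (mat 1) *v v = (\<Prod>X\<leftarrow>Xs. c X) *s v)"
  using assms
proof (induction Ys Xs rule: list_all2_induct)
  case Nil
  show ?case
    by (rule exI[of _ UNIV]) (simp add: vec_dim_card card_cart_basis vec.subspace_UNIV)
next
  case (Cons Y Ys X Xs)
  then obtain V where V: "vec.subspace V"
    "int (vec.dim V) \<ge> int CARD('m) - (\<Sum>X\<leftarrow>Xs. int CARD('m) - int (eig_mult X (c X)))"
    "\<And>v. v \<in> V \<Longrightarrow> sum_list Ys *v v = (\<Sum>X\<leftarrow>Xs. c X) *s v"
    "\<And>v. v \<in> V \<Longrightarrow> foldr (**) Ys (mat 1) *v v = (\<Prod>X\<leftarrow>Xs. c X) *s v"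
    by auto
  define E where "E = {v. Y *v v = c X *s v}"
  have E: "vec.subspace E"
    unfolding E_def vec.subspace_def
    by (auto simp: matrix_vector_right_distrib matrix_vector_scale vec.scale_right_distrib mult.commute)
  have dE: "vec.dim E = eig_mult X (c X)"
    using eig_mult_orbit[of X Y "c X"] Cons by (simp add: E_def eig_mult_def)
  have "vec.dim E + vec.dim V \<le> CARD('m) + vec.dim (E \<inter> V)"
    using vec.dim_sums_Int[OF E V(1)] cdim_le[of "{x + y |x y. x \<in> E \<and> y \<in> V}"] by linarith
  then have "int (vec.dim (E \<inter> V)) \<ge>
      int CARD('m) - (\<Sum>X\<leftarrow>X # Xs. int CARD('m) - int (eig_mult X (c X)))"
    using V(2) dE by simp
  moreover have "sum_list (Y # Ys) *v v = (\<Sum>X\<leftarrow>X # Xs. c X) *s v \<and>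
      foldr (**) (Y # Ys) (mat 1) *v v = (\<Prod>X\<leftarrow>X # Xs. c X) *s v" if "v \<in> E \<inter> V" for v
    using that V(3,4)[of v]
    by (auto simp: E_def matrix_vector_mult_add_rdistrib vec.scale_left_distrib matrix_vector_scale
        mult.commute simp flip: matrix_vector_mul_assoc)
  ultimately show ?case
    using vec.subspace_inter[OF E V(1)] by blast
qed

lemma max_eig_mult_attained:
  assumes "normal X"
  obtains c where "eig_mult X c = max_eig_mult X"
proof -
  obtain V d where V: "unitary V" "X = V ** diag_matrix d ** V\<^sup>H"
    using normal_diagonalization assms unfolding normal_def by blast
  have "max_eig_mult X \<in> eig_mult X ` eigenvalues X"
    unfolding max_eig_mult_def eigenvalues_diag[OF V] by (intro Max_in) auto
  then show thesis using that by auto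
qed

text \<open>For eigenvalues of greatest multiplicity, \<open>large\<close> says that the
  codimensions of the eigenspaces add up to less than m, so a common eigenvector remains. Its
  eigenvalue depends on the orbits alone.\<close>

lemma common_eigenvalue:
  fixes Xs :: "'m::finite cmatrix list"
  assumes nX: "\<forall>X\<in>set Xs. normal X"
    and large: "(\<Sum>X\<leftarrow>Xs. real (max_eig_mult X) / real CARD('m)) > real (length Xs) - 1"
  shows "\<exists>l. \<forall>Z\<in>orbit_sum Xs. l \<in> eigenvalues Z" "\<exists>l. \<forall>Z\<in>class_product Xs. l \<in> eigenvalues Z"
proof -
  have "\<exists>c. normal X \<longrightarrow> eig_mult X c = max_eig_mult X" for X :: "'m cmatrix"
    using max_eig_mult_attained[of X] by blast
  then obtain c where c: "\<And>X :: 'm cmatrix. normal X \<Longrightarrow> eig_mult X (c X) = max_eig_mult X"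
    by metis
  define m where "m = int CARD('m)"
  have eq: "(\<Sum>X\<leftarrow>Xs. m - int (eig_mult X (c X))) = (\<Sum>X\<leftarrow>Xs. m - int (max_eig_mult X))"
    using nX c by (intro arg_cong[where f = sum_list] map_cong) auto
  have "real_of_int (\<Sum>X\<leftarrow>Xs. m - int (max_eig_mult X)) =
      real CARD('m) * (length Xs - (\<Sum>X\<leftarrow>Xs. real (max_eig_mult X) / real CARD('m)))"
  proof (induction Xs)
    case (Cons X Xs)
    have "real CARD('m) * (real (max_eig_mult X) / real CARD('m)) = max_eig_mult X" by simp
    then show ?case using Cons by (simp add: m_def algebra_simps)
  qed simp
  also have "\<dots> < real CARD('m) * 1"
    using large by (intro mult_strict_left_mono) auto
  finally have small: "(\<Sum>X\<leftarrow>Xs. m - int (eig_mult X (c X))) < m"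
    unfolding eq by (simp add: m_def)
  have *: "(\<Sum>X\<leftarrow>Xs. c X) \<in> eigenvalues (sum_list Ys) \<and> (\<Prod>X\<leftarrow>Xs. c X) \<in> eigenvalues (foldr (**) Ys (mat 1))"
    if Ys: "list_all2 (\<lambda>Y X. Y \<in> SU_orbit X) Ys Xs" for Ys
  proof -
    obtain V where V: "vec.subspace V"
      "int (vec.dim V) \<ge> m - (\<Sum>X\<leftarrow>Xs. m - int (eig_mult X (c X)))"
      "\<forall>v\<in>V. sum_list Ys *v v = (\<Sum>X\<leftarrow>Xs. c X) *s v \<and>
        foldr (**) Ys (mat 1) *v v = (\<Prod>X\<leftarrow>Xs. c X) *s v"
      using common_eigenspace[OF Ys nX, of c] unfolding m_def by blast
    have "vec.dim V \<noteq> 0" using V(2) small by linarith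
    then obtain v where "v \<in> V" "v \<noteq> 0"
      using vec.dim_eq_0[of V] by (metis insertI1 subsetI singletonD)
    then show ?thesis using V(3) unfolding eigenvalues_def by blast
  qed
  show "\<exists>l. \<forall>Z\<in>orbit_sum Xs. l \<in> eigenvalues Z"
    using * by (intro exI[of _ "\<Sum>X\<leftarrow>Xs. c X"]) (auto simp: orbit_sum_def)
  show "\<exists>l. \<forall>Z\<in>class_product Xs. l \<in> eigenvalues Z"
    using * by (intro exI[of _ "\<Prod>X\<leftarrow>Xs. c X"]) (auto simp: class_product_def)
qed

section \<open>Perturbing a spectrum inside a relatively open set\<close>

lemma continuous_on_diag_matrix:
  assumes "\<And>i. continuous_on S (\<lambda>t. d t i)"
  shows "continuous_on S (\<lambda>t. diag_matrix (d t))"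
  unfolding diag_matrix_def
proof (intro continuous_on_vec_lambda)
  fix i j show "continuous_on S (\<lambda>t. if i = j then d t i else 0)"
    using assms by (cases "i = j") auto
qed

lemma openin_curve:
  fixes g :: "real \<Rightarrow> 'a::topological_space"
  assumes U: "openin (top_of_set M) U" and g: "continuous_on UNIV g" "\<And>t. g t \<in> M" "g 0 \<in> U"
  obtains \<delta> where "\<delta> > 0" "\<And>t. \<bar>t\<bar> < \<delta> \<Longrightarrow> g t \<in> U"
proof -
  obtain T where T: "open T" "U = M \<inter> T"
    using U by (auto simp: openin_open)
  have "open (g -` T)"
    using g(1) T(1) by (simp add: open_vimage)
  moreover have "0 \<in> g -` T" using g(3) T(2) by simp
  ultimately obtain \<delta> where "\<delta> > 0" "ball 0 \<delta> \<subseteq> g -` T"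
    using openE by blast
  then show thesis
    using that[of \<delta>] g(2) T(2) by (auto simp: subset_iff)
qed

lemma finite_affine: "b \<noteq> 0 \<Longrightarrow> finite {t :: real. a + of_real t * b = (c :: complex)}"
  by (rule finite_subset[of _ "{Re ((c - a) / b)}"]) (auto simp: field_simps)

text \<open>All angles involved differ by at most 1, less than a full turn, so at most one t solves
  the equation.\<close>

lemma finite_phase:
  fixes a c :: complex and \<beta> :: real
  assumes "a \<noteq> 0" "\<beta> \<noteq> 0" and small: "\<delta> * \<bar>\<beta>\<bar> \<le> 1"
  shows "finite {t. 0 < t \<and> t < \<delta> \<and> a * exp (\<i> * of_real (t * \<beta>)) = c}" (is "finite ?S")
proof (cases "?S = {}")
  case False
  then obtain s where s: "s \<in> ?S" by blast
  have "t = s" if t: "t \<in> ?S" for t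
  proof -
    have "exp (\<i> * of_real (t * \<beta>)) = exp (\<i> * of_real (s * \<beta>))"
      using s t assms(1) by (auto simp: mult_left_cancel)
    then obtain n :: int where "\<i> * of_real (t * \<beta>) = \<i> * of_real (s * \<beta>) + (of_int (2 * n) * pi) * \<i>"
      unfolding exp_eq by blast
    then have n: "(t - s) * \<beta> = of_int (2 * n) * pi"
      by (simp add: complex_eq_iff algebra_simps)
    have "\<bar>(t - s) * \<beta>\<bar> \<le> 1"
    proof -
      have "\<bar>t - s\<bar> \<le> \<delta>" using s t by auto
      then have "\<bar>t - s\<bar> * \<bar>\<beta>\<bar> \<le> \<delta> * \<bar>\<beta>\<bar>" by (intro mult_right_mono) auto
      then show ?thesis using small by (simp add: abs_mult)
    qed
    then have le: "\<bar>of_int (2 * n)\<bar> * pi \<le> 1" unfolding n by (simp add: abs_mult)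
    have "n = 0"
    proof (rule ccontr)
      assume "n \<noteq> 0"
      then have "\<bar>real_of_int (2 * n)\<bar> \<ge> 1" by linarith
      then have "1 * pi \<le> \<bar>real_of_int (2 * n)\<bar> * pi" by (intro mult_right_mono) auto
      then show False using le pi_gt3 by linarith
    qed
    then show ?thesis using n assms(2) by simp
  qed
  then have "?S \<subseteq> {s}" by blast
  then show ?thesis using finite_subset by blast
next
  case True
  then show ?thesis by (simp only: finite.emptyI)
qed

text \<open>A traceless real diagonal direction. For m >= 2 no entry is 0, and for m >= 3 no sum of
  its j-th entry with any entry is 0: these sums are 2 - m and 2 - 2 m.\<close>

definition weight :: "'m::finite \<Rightarrow> 'm \<Rightarrow> real" where
  "weight j l = (if l = j then 1 - real CARD('m) else 1)"

lemma sum_weight: "(\<Sum>l\<in>UNIV. weight j (l :: 'm::finite)) = 0"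
proof -
  have "(\<Sum>l\<in>UNIV. weight j l) = (\<Sum>l\<in>UNIV. 1 - (if l = j then real CARD('m) else 0))"
    by (intro sum.cong refl) (auto simp: weight_def)
  then show ?thesis by (simp add: sum_subtractf)
qed

lemma weight_nonzero: "2 \<le> CARD('m::finite) \<Longrightarrow> weight j (l :: 'm) \<noteq> 0"
  by (auto simp: weight_def)

lemma weight_sum_nonzero: "3 \<le> CARD('m::finite) \<Longrightarrow> weight j j + weight j (l :: 'm) \<noteq> 0"
  by (auto simp: weight_def)

lemma weight_bound: "\<bar>weight j l\<bar> \<le> CARD('m)" "\<bar>weight j j + weight j l\<bar> \<le> 2 * CARD('m)"
  for j l :: "'m::finite"
proof -
  have "CARD('m) \<ge> 1" by (simp add: Suc_le_eq)
  then have "1 \<le> real CARD('m)" by linarith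
  then show "\<bar>weight j l\<bar> \<le> CARD('m)" "\<bar>weight j j + weight j l\<bar> \<le> 2 * CARD('m)"
    unfolding weight_def by (cases "l = j"; simp only: if_True if_False refl abs_le_iff; linarith)+
qed

lemma exists_avoiding:
  fixes B :: "'i \<Rightarrow> real set"
  assumes "\<delta> > 0" "finite I" "\<And>i. i \<in> I \<Longrightarrow> finite {t \<in> B i. 0 < t \<and> t < \<delta>}"
  obtains t where "0 < t" "t < \<delta>" "\<And>i. i \<in> I \<Longrightarrow> t \<notin> B i"
proof -
  have "finite (\<Union>i\<in>I. {t \<in> B i. 0 < t \<and> t < \<delta>})"
    using assms(2,3) by blast
  moreover have "infinite {0<..<\<delta>}" using assms(1) by simp
  ultimately have "\<not> {0<..<\<delta>} \<subseteq> (\<Union>i\<in>I. {t \<in> B i. 0 < t \<and> t < \<delta>})"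
    using finite_subset by blast
  then obtain t where "t \<in> {0<..<\<delta>}" "t \<notin> (\<Union>i\<in>I. {t \<in> B i. 0 < t \<and> t < \<delta>})" by blast
  then show thesis using that[of t] by auto
qed

lemma normal_su: "X \<in> su_algebra \<Longrightarrow> normal X"
  by (simp add: su_algebra_iff skew_def normal_def matrix_ring_simps)

lemma normal_SU: "X \<in> SU_group \<Longrightarrow> normal X"
  by (simp add: SU_group_iff normal_def)

text \<open>Moving the eigenvalues of a point of U along \<open>weight j\<close> stays in the Lie
  algebra, and each unwanted coincidence is a nonconstant affine equation in t. Finitely many bad
  parameters cannot fill an interval. For m = 2 the vanishing trace alone pairs the two eigenvalues,
  hence the restriction on the last claim.\<close>

lemma su_generic:
  fixes U :: "'m::finite cmatrix set"
  assumes m: "2 \<le> CARD('m)" and U: "U \<noteq> {}" "openin (top_of_set su_algebra) U" and F: "finite F"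
  obtains Z x where "Z \<in> U" "eigenvalues Z \<inter> F = {}" "x \<in> eigenvalues Z"
    "3 \<le> CARD('m) \<Longrightarrow> \<forall>y\<in>eigenvalues Z. x + y \<noteq> s"
proof -
  obtain Z0 where Z0: "Z0 \<in> U" using U(1) by blast
  then have su: "Z0 \<in> su_algebra" using U(2) openin_imp_subset by blast
  obtain V z where V: "unitary V" "Z0 = V ** diag_matrix z ** V\<^sup>H"
    using normal_diagonalization normal_su[OF su] unfolding normal_def by blast
  define j :: 'm where "j = undefined"
  define w where "w l = \<i> * of_real (weight j l)" for l
  define d where "d t l = z l + of_real t * w l" for t l
  define g where "g t = V ** diag_matrix (d t) ** V\<^sup>H" for t
  have cont: "continuous_on UNIV g"
    unfolding g_def d_def by (intro continuous_intros continuous_on_diag_matrix)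
  have W: "V ** diag_matrix w ** V\<^sup>H \<in> su_algebra"
  proof (rule su_algebra_conj(1)[OF V(1)])
    have "trace (diag_matrix w) = (\<Sum>l\<in>UNIV. \<i> * of_real (weight j l))"
      by (simp add: trace_def diag_nth w_def)
    also have "\<dots> = \<i> * of_real (\<Sum>l\<in>UNIV. weight j l)"
      by (simp add: sum_distrib_left)
    finally have "trace (diag_matrix w) = 0" by (simp add: sum_weight)
    then show "diag_matrix w \<in> su_algebra"
      by (simp add: su_algebra_iff skew_def adj_diag) (simp add: vec_eq_iff diag_nth w_def)
  qed
  have g: "g t = Z0 + t *\<^sub>R (V ** diag_matrix w ** V\<^sup>H)" for t
  proof -
    have "diag_matrix (d t) = diag_matrix z + t *\<^sub>R diag_matrix w"
      by (auto simp: vec_eq_iff diag_nth d_def) (simp add: scaleR_conv_of_real)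
    then show ?thesis by (simp add: g_def V(2) matrix_ring_simps)
  qed
  have gsu: "g t \<in> su_algebra" for t
    unfolding g by (intro subspace_add subspace_scale subspace_su_algebra su W)
  obtain \<delta> where \<delta>: "\<delta> > 0" "\<And>t. \<bar>t\<bar> < \<delta> \<Longrightarrow> g t \<in> U"
    by (rule openin_curve[OF U(2) cont gsu]) (use g Z0 in auto)
  \<comment> \<open>The bad parameters: \<open>Inl\<close> when an eigenvalue meets F,
    \<open>Inr\<close> when an eigenvalue and the one at j add up to s.\<close>
  define B where "B i = (case i of Inl (l, f) \<Rightarrow> {t. d t l = f} | Inr l \<Rightarrow> {t. d t j + d t l = s})" for i :: "'m \<times> complex + 'm"
  define I :: "('m \<times> complex + 'm) set" where "I = Inl ` (UNIV \<times> F) \<union> (if 3 \<le> CARD('m) then range Inr else {})"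
  have "finite {t \<in> B i. 0 < t \<and> t < \<delta>}" if "i \<in> I" for i
  proof -
    have "finite (B i)"
    proof (cases i)
      case (Inl p)
      obtain l f where p: "p = (l, f)" by force
      have "w l \<noteq> 0" using weight_nonzero[OF m] by (simp add: w_def)
      then show ?thesis using finite_affine[of "w l" "z l" f] by (simp add: B_def Inl p d_def)
    next
      case (Inr l)
      then have "3 \<le> CARD('m)" using that by (auto simp: I_def split: if_splits)
      then have "w j + w l \<noteq> 0"
        using weight_sum_nonzero[of j l] by (simp add: w_def flip: distrib_left of_real_add)
      then show ?thesis
        using finite_affine[of "w j + w l" "z j + z l" s] by (simp add: B_def Inr d_def algebra_simps)
    qed
    then show ?thesis by simp
  qed
  moreover have "finite I" using F by (simp add: I_def)
  ultimately obtain t where t: "0 < t" "t < \<delta>" "\<And>i. i \<in> I \<Longrightarrow> t \<notin> B i"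
    using exists_avoiding[OF \<delta>(1), of I B] by metis
  have eig: "eigenvalues (g t) = range (d t)"
    by (rule eigenvalues_diag[OF V(1) g_def])
  show thesis
  proof (rule that[of "g t" "d t j"])
    show "g t \<in> U" using \<delta>(2) t by simp
    have "d t l \<noteq> f" if "f \<in> F" for l f
      using t(3)[of "Inl (l, f)"] that by (simp add: I_def B_def)
    then show "eigenvalues (g t) \<inter> F = {}" unfolding eig by blast
    show "d t j \<in> eigenvalues (g t)" unfolding eig by blast
    assume "3 \<le> CARD('m)"
    then have "d t j + d t l \<noteq> s" for l
      using t(3)[of "Inr l"] by (simp add: I_def B_def)
    then show "\<forall>y\<in>eigenvalues (g t). d t j + y \<noteq> s" unfolding eig by blast
  qed
qed

text \<open>The multiplicative version: the eigenvalues are turned by phases with exponents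
  \<open>weight j\<close>, whose vanishing sum preserves the determinant.\<close>

lemma SU_generic:
  fixes U :: "'m::finite cmatrix set"
  assumes m: "2 \<le> CARD('m)" and U: "U \<noteq> {}" "openin (top_of_set SU_group) U" and F: "finite F"
  obtains Z x where "Z \<in> U" "eigenvalues Z \<inter> F = {}" "x \<in> eigenvalues Z"
    "3 \<le> CARD('m) \<Longrightarrow> \<forall>y\<in>eigenvalues Z. x * y \<noteq> s"
proof -
  obtain Z0 where Z0: "Z0 \<in> U" using U(1) by blast
  then have SU: "Z0 \<in> SU_group" using U(2) openin_imp_subset by blast
  obtain V z where V: "unitary V" "Z0 = V ** diag_matrix z ** V\<^sup>H"
    using normal_diagonalization normal_SU[OF SU] unfolding normal_def by blast
  have z0: "z l \<noteq> 0" for l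
  proof -
    have "diag_matrix z = V\<^sup>H ** Z0 ** V"
      using V(1) unfolding V(2) by (simp add: matrix_mul_assoc)
    then have "unitary (diag_matrix z)"
      using V(1) SU by (auto intro!: unitary_mul unitary_adj simp: SU_group_iff)
    then have "(\<Prod>l\<in>UNIV. z l) \<noteq> 0"
      using norm_det_unitary[of "diag_matrix z"] unfolding det_diag_matrix by fastforce
    then show ?thesis by (metis UNIV_I finite prod_zero_iff)
  qed
  define j :: 'm where "j = undefined"
  define p where "p t l = exp (\<i> * of_real (t * weight j l))" for t l
  define d where "d t l = z l * p t l" for t l
  define g where "g t = V ** diag_matrix (d t) ** V\<^sup>H" for t
  have cont: "continuous_on UNIV g"
    unfolding g_def d_def p_def by (intro continuous_intros continuous_on_diag_matrix)
  have up: "unitary (diag_matrix (p t))" for t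
  proof (rule unitaryI)
    have "cnj (p t l) * p t l = 1" for l
      by (simp add: p_def exp_cnj flip: exp_add)
    then show "(diag_matrix (p t))\<^sup>H ** diag_matrix (p t) = mat 1"
      by (simp add: adj_diag vec_eq_iff diag_nth mat_nth)
  qed
  have dp: "det (diag_matrix (p t)) = 1" for t
  proof -
    have "det (diag_matrix (p t)) = exp (\<Sum>l\<in>UNIV. \<i> * of_real (t * weight j l))"
      by (simp add: det_diag_matrix p_def exp_sum)
    also have "(\<Sum>l\<in>UNIV. \<i> * of_real (t * weight j l)) = \<i> * of_real (t * (\<Sum>l\<in>UNIV. weight j l))"
      by (simp add: sum_distrib_left)
    finally show ?thesis by (simp add: sum_weight)
  qed
  have dV: "det V * det (V\<^sup>H) = 1"
    using V(1) by (simp flip: det_mul)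
  have g: "g t = Z0 ** (V ** diag_matrix (p t) ** V\<^sup>H)" for t
  proof -
    have "diag_matrix (d t) = diag_matrix z ** diag_matrix (p t)"
      by (simp add: vec_eq_iff diag_nth d_def)
    then show ?thesis using V(1) by (simp add: g_def V(2) matrix_mul_assoc)
  qed
  have gSU: "g t \<in> SU_group" for t
  proof -
    have "unitary (g t)"
      unfolding g using V(1) SU up by (intro unitary_mul unitary_adj) (auto simp: SU_group_iff)
    moreover have "det (g t) = 1"
      using SU dV by (simp add: g det_mul dp SU_group_iff)
    ultimately show ?thesis by (simp add: SU_group_iff)
  qed
  have "d 0 = z" by (rule ext) (simp add: d_def p_def)
  then have g0: "g 0 = Z0" by (simp add: g_def V(2))
  obtain \<delta>' where \<delta>': "\<delta>' > 0" "\<And>t. \<bar>t\<bar> < \<delta>' \<Longrightarrow> g t \<in> U"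
    by (rule openin_curve[OF U(2) cont gSU]) (use g0 Z0 in auto)
  \<comment> \<open>The exponents, and their sums with the exponent at j, are at most 2 m in
    absolute value, so this interval keeps every rotation within the range of
    \<open>finite_phase\<close>.\<close>
  define \<delta> where "\<delta> = min \<delta>' (1 / (2 * CARD('m)))"
  have \<delta>: "\<delta> > 0" "\<delta> \<le> \<delta>'" "\<delta> * (2 * CARD('m)) \<le> 1"
  proof -
    show "\<delta> > 0" "\<delta> \<le> \<delta>'" using \<delta>'(1) by (simp_all add: \<delta>_def)
    have "\<delta> \<le> 1 / (2 * CARD('m))" by (simp add: \<delta>_def)
    then show "\<delta> * (2 * CARD('m)) \<le> 1" by (simp add: field_simps)
  qed
  have small: "\<delta> * \<bar>\<beta>\<bar> \<le> 1" if "\<bar>\<beta>\<bar> \<le> 2 * CARD('m)" for \<beta> :: real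
    using mult_left_mono[OF that, of \<delta>] \<delta> by linarith
  define B where "B i = (case i of Inl (l, f) \<Rightarrow> {t. d t l = f} | Inr l \<Rightarrow> {t. d t j * d t l = s})" for i :: "'m \<times> complex + 'm"
  define I :: "('m \<times> complex + 'm) set" where "I = Inl ` (UNIV \<times> F) \<union> (if 3 \<le> CARD('m) then range Inr else {})"
  have "finite {t \<in> B i. 0 < t \<and> t < \<delta>}" if "i \<in> I" for i
  proof (cases i)
    case (Inl q)
    obtain l f where q: "q = (l, f)" by force
    have "finite {t. 0 < t \<and> t < \<delta> \<and> z l * exp (\<i> * of_real (t * weight j l)) = f}"
      using weight_bound(1)[of j l] by (intro finite_phase z0 weight_nonzero m small) linarith
    then show ?thesis
      by (rule rev_finite_subset) (auto simp: B_def Inl q d_def p_def)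
  next
    case (Inr l)
    then have m3: "3 \<le> CARD('m)" using that by (auto simp: I_def split: if_splits)
    have "finite {t. 0 < t \<and> t < \<delta> \<and> (z j * z l) * exp (\<i> * of_real (t * (weight j j + weight j l))) = s}"
      using z0 weight_bound(2)[of j l] by (intro finite_phase weight_sum_nonzero m3 small) auto
    moreover have "d t j * d t l = (z j * z l) * exp (\<i> * of_real (t * (weight j j + weight j l)))" for t
      by (simp add: d_def p_def distrib_left exp_add)
    ultimately show ?thesis
      by (elim rev_finite_subset) (auto simp: B_def Inr)
  qed
  moreover have "finite I" using F by (simp add: I_def)
  ultimately obtain t where t: "0 < t" "t < \<delta>" "\<And>i. i \<in> I \<Longrightarrow> t \<notin> B i"
    using exists_avoiding[OF \<delta>(1), of I B] by metis
  have eig: "eigenvalues (g t) = range (d t)"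
    by (rule eigenvalues_diag[OF V(1) g_def])
  show thesis
  proof (rule that[of "g t" "d t j"])
    show "g t \<in> U" using \<delta>' \<delta> t by simp
    have "d t l \<noteq> f" if "f \<in> F" for l f
      using t(3)[of "Inl (l, f)"] that by (simp add: I_def B_def)
    then show "eigenvalues (g t) \<inter> F = {}" unfolding eig by blast
    show "d t j \<in> eigenvalues (g t)" unfolding eig by blast
    assume "3 \<le> CARD('m)"
    then have "d t j * d t l \<noteq> s" for l
      using t(3)[of "Inr l"] by (simp add: I_def B_def)
    then show "\<forall>y\<in>eigenvalues (g t). d t j * y \<noteq> s" unfolding eig by blast
  qed
qed

subsection \<open>Exceptional pairs\<close>

lemma two_eigenvalues_quadratic:
  fixes A :: "'m::finite cmatrix"
  assumes "normal A" "card (eigenvalues A) = 2"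
  obtains a1 a2 where "eigenvalues A = {a1, a2}" "A ** A = mat (a1 + a2) ** A - mat (a1 * a2)"
proof -
  obtain V d where V: "unitary V" "A = V ** diag_matrix d ** V\<^sup>H"
    using normal_diagonalization assms(1) unfolding normal_def by blast
  obtain a1 a2 where a: "eigenvalues A = {a1, a2}"
    using assms(2) by (meson card_2_iff)
  then have d: "d l = a1 \<or> d l = a2" for l
    unfolding eigenvalues_diag[OF V] by blast
  have "d l * d l = (a1 + a2) * d l - a1 * a2" for l
    using d[of l] by (auto simp: algebra_simps)
  then have "diag_matrix d ** diag_matrix d = mat (a1 + a2) ** diag_matrix d - mat (a1 * a2)"
    by (simp add: vec_eq_iff diag_nth mat_nth)
  then have "V ** (diag_matrix d ** diag_matrix d) ** V\<^sup>H =
      V ** (mat (a1 + a2) ** diag_matrix d - mat (a1 * a2)) ** V\<^sup>H" by simp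
  also have "\<dots> = V ** mat (a1 + a2) ** diag_matrix d ** V\<^sup>H - V ** mat (a1 * a2) ** V\<^sup>H"
    by (simp only: matrix_mul_diff_left matrix_mul_diff_right matrix_mul_assoc)
  also have "\<dots> = mat (a1 + a2) ** A - mat (a1 * a2)"
    unfolding conj_mat[OF V(1)] unfolding mat_commute[of V] V(2) by (simp only: matrix_mul_assoc)
  finally have "A ** A = mat (a1 + a2) ** A - mat (a1 * a2)"
    using V(1) by (simp add: V(2) matrix_mul_assoc)
  with a show thesis by (rule that)
qed

text \<open>If A has two eigenvalues, [A, B] has no diagonal blocks with respect to its eigenspaces
  and exchanges them. Here t and e are the sum and the product of the eigenvalues.\<close>

lemma quadratic_commutator:
  fixes A B :: "'m::finite cmatrix"
  assumes "A ** A = mat t ** A - mat e"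
  shows "A ** commutator A B = mat t ** commutator A B - commutator A B ** A"
    and "A ** commutator A B ** A = mat e ** commutator A B"
proof -
  have 1: "A ** commutator A B = (A ** A) ** B - A ** B ** A"
    by (simp add: commutator_def matrix_ring_simps)
  have 2: "commutator A B ** A = A ** B ** A - B ** (A ** A)"
    by (simp add: commutator_def matrix_ring_simps)
  have Be: "B ** mat e = mat e ** B" and Bt: "B ** (mat t ** A) = mat t ** (B ** A)"
    by (simp_all only: mat_commute[of B] matrix_mul_assoc)
  have 3: "B ** (A ** A) = mat t ** (B ** A) - mat e ** B"
    unfolding assms matrix_mul_diff_left Be Bt ..
  have 4: "(A ** A) ** B = mat t ** (A ** B) - mat e ** B"
    unfolding assms matrix_mul_diff_right matrix_mul_assoc ..
  show eq: "A ** commutator A B = mat t ** commutator A B - commutator A B ** A"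
    unfolding 1 2 3 4 unfolding commutator_def matrix_mul_diff_left by simp
  have "A ** commutator A B ** A = mat t ** (commutator A B ** A) - commutator A B ** (A ** A)"
    unfolding eq by (simp add: matrix_ring_simps)
  also have "\<dots> = mat e ** commutator A B"
    unfolding assms matrix_mul_diff_left
    by (simp only: mat_commute[of "commutator A B"] matrix_mul_assoc) simp
  finally show "A ** commutator A B ** A = mat e ** commutator A B" .
qed

lemma quadratic_eigenvector:
  fixes A :: "'m::finite cmatrix"
  assumes A: "A ** A = mat (a1 + a2) ** A - mat (a1 * a2)" and v: "v \<noteq> 0"
  obtains a p q where "a = a1 \<or> a = a2" "p *s v + q *s (A *v v) \<noteq> 0"
    "A *v (p *s v + q *s (A *v v)) = a *s (p *s v + q *s (A *v v))"
proof (cases "A *v v = a2 *s v")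
  case True
  then show thesis
    using that[of a2 1 0] v by simp
next
  case False
  have AA: "A *v (A *v v) = (a1 + a2) *s (A *v v) - (a1 * a2) *s v"
    using arg_cong[OF A, of "\<lambda>M. M *v v"]
    by (simp add: matrix_vector_mult_diff_rdistrib flip: matrix_vector_mul_assoc)
  show thesis
  \<comment> \<open>The witness is (A - a2) v, which A - a1 annihilates.\<close>
  proof (rule that[of a1 "- a2" 1])
    show "- a2 *s v + 1 *s (A *v v) \<noteq> 0"
    proof
      assume "- a2 *s v + 1 *s (A *v v) = 0"
      moreover have "- a2 *s v + 1 *s (A *v v) = A *v v - a2 *s v"
        by (simp add: vec_eq_iff)
      ultimately show False using False by simp
    qed
    show "A *v (- a2 *s v + 1 *s (A *v v)) = a1 *s (- a2 *s v + 1 *s (A *v v))"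
      by (simp add: matrix_vector_right_distrib matrix_vector_scale AA vec_eq_iff algebra_simps)
  qed simp
qed

text \<open>K = [A, B] satisfies (A + B) K = (a1 + a2 + b1 + b2) K - K (A + B), so K v is an
  eigenvector for the reflected eigenvalue unless K v = 0. In that case B acts on the span of v and
  A v as a scalar minus A, so an eigenvector of A in this span is one of B as well, and x is among
  four explicit values. The scalar s stands for the scalar entries of the tuple.\<close>

lemma sum_spectrum_pairing:
  fixes A B :: "'m::finite cmatrix"
  assumes A: "A ** A = mat (a1 + a2) ** A - mat (a1 * a2)"
    and B: "B ** B = mat (b1 + b2) ** B - mat (b1 * b2)" "eigenvalues B = {b1, b2}"
    and x: "x \<in> eigenvalues (A + B + mat s)"
  shows "x \<in> (\<lambda>(a, b). a + b + s) ` ({a1, a2} \<times> {b1, b2}) \<or>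
    (\<exists>y\<in>eigenvalues (A + B + mat s). x + y = a1 + a2 + b1 + b2 + 2 * s)"
proof -
  obtain v where v: "v \<noteq> 0" "(A + B + mat s) *v v = x *s v"
    using x by (auto simp: eigenvalues_def)
  define n where "n = x - s"
  have Bv: "B *v v = n *s v - A *v v"
    using v(2) by (simp add: matrix_vector_mult_add_rdistrib n_def vec_eq_iff algebra_simps)
  let ?K = "commutator A B"
  have KBA: "commutator B A = - ?K" by (simp add: commutator_def)
  have "B ** ?K = mat (b1 + b2) ** ?K - ?K ** B"
    using quadratic_commutator(1)[OF B(1), of A] unfolding KBA
    by (simp add: matrix_mul_minus_left matrix_mul_minus_right algebra_simps)
  then have "(A + B) ** ?K = mat (a1 + a2) ** ?K + mat (b1 + b2) ** ?K - ?K ** (A + B)"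
    using quadratic_commutator(1)[OF A, of B] by (simp add: matrix_ring_simps algebra_simps)
  then have "((A + B) ** ?K) *v v = (mat (a1 + a2) ** ?K + mat (b1 + b2) ** ?K - ?K ** (A + B)) *v v"
    by simp
  moreover have "(?K ** (A + B)) *v v = n *s (?K *v v)"
    by (simp add: matrix_vector_mult_add_rdistrib Bv matrix_vector_scale flip: matrix_vector_mul_assoc)
  ultimately have AB: "(A + B) *v (?K *v v) = (a1 + a2) *s (?K *v v) + (b1 + b2) *s (?K *v v) - n *s (?K *v v)"
    by (simp add: matrix_vector_mult_add_rdistrib matrix_vector_mult_diff_rdistrib
        flip: matrix_vector_mul_assoc)
  show ?thesis
  proof (cases "?K *v v = 0")
    case False
    define y where "y = a1 + a2 + b1 + b2 + s - n"
    have "(A + B + mat s) *v (?K *v v) = (A + B) *v (?K *v v) + s *s (?K *v v)"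
      by (simp only: matrix_vector_mult_add_rdistrib mat_vector)
    also have "\<dots> = y *s (?K *v v)"
      unfolding AB by (simp add: y_def vec_eq_iff algebra_simps)
    finally have "y \<in> eigenvalues (A + B + mat s)"
      using False by (auto simp: eigenvalues_def)
    then show ?thesis by (auto simp: y_def n_def intro!: disjI2 bexI[of _ y])
  next
    case True
    then have "A *v (B *v v) = B *v (A *v v)"
      by (simp add: commutator_def matrix_vector_mult_diff_rdistrib matrix_vector_mul_assoc)
    then have BA: "B *v (A *v v) = n *s (A *v v) - A *v (A *v v)"
      unfolding Bv by (simp add: matrix_vector_mult_diff_distrib matrix_vector_scale)
    obtain a p q where a: "a = a1 \<or> a = a2" and u: "p *s v + q *s (A *v v) \<noteq> 0"
      "A *v (p *s v + q *s (A *v v)) = a *s (p *s v + q *s (A *v v))"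
      using quadratic_eigenvector[OF A v(1)] by blast
    let ?u = "p *s v + q *s (A *v v)"
    have "B *v ?u = n *s ?u - A *v ?u"
      by (simp add: matrix_vector_right_distrib matrix_vector_scale Bv BA vec_eq_iff algebra_simps)
    then have "B *v ?u = (n - a) *s ?u"
      unfolding u(2) by (simp add: vec_eq_iff algebra_simps)
    then have "n - a \<in> {b1, b2}"
      using u(1) B(2) unfolding eigenvalues_def by blast
    then have "x = a + (n - a) + s" "a \<in> {a1, a2}" "n - a \<in> {b1, b2}"
      using a by (auto simp: n_def)
    then show ?thesis by (intro disjI1 image_eqI[of _ _ "(a, n - a)"]) auto
  qed
qed

text \<open>With K = [A, B], the identities A K A = a1 a2 K and B K B = b1 b2 K combine so that A K
  v is an eigenvector of A B for the eigenvalue a1 a2 b1 b2 / n, when A B v = n v and K v is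
  nonzero. If K v = 0, then B A is the scalar n on the span of v and A v, and an eigenvector of A
  there is again common to A and B.\<close>

lemma product_spectrum_pairing:
  fixes A B :: "'m::finite cmatrix"
  assumes A: "A ** A = mat (a1 + a2) ** A - mat (a1 * a2)" and a0: "a1 \<noteq> 0" "a2 \<noteq> 0"
    and B: "B ** B = mat (b1 + b2) ** B - mat (b1 * b2)" "eigenvalues B = {b1, b2}"
      and b0: "b1 \<noteq> 0" "b2 \<noteq> 0" and s: "s \<noteq> 0"
    and x: "x \<in> eigenvalues (mat s ** (A ** B))"
  shows "x \<in> (\<lambda>(a, b). s * a * b) ` ({a1, a2} \<times> {b1, b2}) \<or>
    (\<exists>y\<in>eigenvalues (mat s ** (A ** B)). x * y = s * s * a1 * a2 * b1 * b2)"
proof -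
  obtain v where v: "v \<noteq> 0" "(mat s ** (A ** B)) *v v = x *s v"
    using x by (auto simp: eigenvalues_def)
  define n where "n = x / s"
  have xs: "x = s * n" using s by (simp add: n_def)
  have ABv: "A *v (B *v v) = n *s v"
  proof -
    have "s *s (A *v (B *v v)) = s *s (n *s v)"
      using v(2) by (simp add: xs flip: matrix_vector_mul_assoc)
    then show ?thesis using s by (simp add: vec.scale_left_imp_eq)
  qed
  have AA: "A *v (A *v w) = (a1 + a2) *s (A *v w) - (a1 * a2) *s w" for w
    using arg_cong[OF A, of "\<lambda>M. M *v w"]
    by (simp add: matrix_vector_mult_diff_rdistrib flip: matrix_vector_mul_assoc)
  have BB: "B *v (B *v w) = (b1 + b2) *s (B *v w) - (b1 * b2) *s w" for w
    using arg_cong[OF B(1), of "\<lambda>M. M *v w"]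
    by (simp add: matrix_vector_mult_diff_rdistrib flip: matrix_vector_mul_assoc)
  have Ainj: "w = 0" if "A *v w = 0" for w
    using AA[of w] a0 unfolding that by simp
  have Binj: "w = 0" if "B *v w = 0" for w
    using BB[of w] b0 unfolding that by simp
  have n0: "n \<noteq> 0"
  proof
    assume "n = 0"
    then have "A *v (B *v v) = 0" using ABv by simp
    then show False using Ainj Binj v(1) by blast
  qed
  let ?K = "commutator A B" and ?e = "a1 * a2 * (b1 * b2)"
  have KBA: "commutator B A = - ?K" by (simp add: commutator_def)
  have BKB: "B ** ?K ** B = mat (b1 * b2) ** ?K"
    using quadratic_commutator(2)[OF B(1), of A] unfolding KBA
    by (simp add: matrix_mul_minus_left matrix_mul_minus_right)
  have AKAw: "A *v (?K *v (A *v w)) = (a1 * a2) *s (?K *v w)" for w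
    using arg_cong[OF quadratic_commutator(2)[OF A, of B], of "\<lambda>M. M *v w"]
    by (simp flip: matrix_vector_mul_assoc)
  have BKBw: "B *v (?K *v (B *v w)) = (b1 * b2) *s (?K *v w)" for w
    using arg_cong[OF BKB, of "\<lambda>M. M *v w"] by (simp flip: matrix_vector_mul_assoc)
  show ?thesis
  proof (cases "?K *v v = 0")
    case False
    define y where "y = s * (?e / n)"
    have nz: "A *v (?K *v v) \<noteq> 0" using False Ainj by blast
    have "n *s (A *v (B *v (A *v (?K *v v)))) = A *v (B *v (A *v (?K *v (A *v (B *v v)))))"
      unfolding ABv by (simp only: matrix_vector_scale)
    also have "\<dots> = ?e *s (A *v (?K *v v))"
      unfolding AKAw by (simp only: matrix_vector_scale BKBw vec.scale_scale)
    finally have "A *v (B *v (A *v (?K *v v))) = (?e / n) *s (A *v (?K *v v))"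
      using n0 by (simp add: vec_eq_iff field_simps)
    then have "(mat s ** (A ** B)) *v (A *v (?K *v v)) = y *s (A *v (?K *v v))"
      by (simp add: y_def flip: matrix_vector_mul_assoc)
    then have "y \<in> eigenvalues (mat s ** (A ** B))"
      using nz unfolding eigenvalues_def by blast
    moreover have "x * y = s * s * a1 * a2 * b1 * b2"
      using n0 by (simp add: xs y_def field_simps)
    ultimately show ?thesis by blast
  next
    case True
    then have BAv: "B *v (A *v v) = n *s v"
      using ABv by (simp add: commutator_def matrix_vector_mult_diff_rdistrib flip: matrix_vector_mul_assoc)
    have BAAv: "B *v (A *v (A *v v)) = n *s (A *v v)"
    proof -
      have "A *v (A *v (B *v v)) = (a1 + a2) *s (A *v (B *v v)) - (a1 * a2) *s (B *v v)"
        by (rule AA)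
      then have "n *s (A *v v) = (a1 + a2) *s (n *s v) - (a1 * a2) *s (B *v v)"
        unfolding ABv matrix_vector_scale .
      moreover have "B *v (A *v (A *v v)) = (a1 + a2) *s (n *s v) - (a1 * a2) *s (B *v v)"
        unfolding AA by (simp only: matrix_vector_mult_diff_distrib matrix_vector_scale BAv)
      ultimately show ?thesis by simp
    qed
    obtain a p q where a: "a = a1 \<or> a = a2" and u: "p *s v + q *s (A *v v) \<noteq> 0"
      "A *v (p *s v + q *s (A *v v)) = a *s (p *s v + q *s (A *v v))"
      using quadratic_eigenvector[OF A v(1)] by blast
    let ?u = "p *s v + q *s (A *v v)"
    have "a \<noteq> 0" using a a0 by auto
    have "a *s (B *v ?u) = B *v (A *v ?u)"
      unfolding u(2) by (simp only: matrix_vector_scale)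
    also have "\<dots> = n *s ?u"
      by (simp add: matrix_vector_right_distrib matrix_vector_scale BAv BAAv vec_eq_iff algebra_simps)
    finally have "B *v ?u = (n / a) *s ?u"
      using \<open>a \<noteq> 0\<close> by (simp add: vec_eq_iff field_simps)
    then have "n / a \<in> {b1, b2}"
      using u(1) B(2) unfolding eigenvalues_def by blast
    moreover have "x = s * a * (n / a)" using \<open>a \<noteq> 0\<close> by (simp add: xs)
    moreover have "a \<in> {a1, a2}" using a by blast
    ultimately show ?thesis by (intro disjI1 image_eqI[of _ _ "(a, n / a)"]) auto
  qed
qed

text \<open>One criterion for both obstructions. A constant eigenvalue put into F makes the
  hypothesis vacuous; for exceptional pairs, F collects the eigenvalues from common eigenvectors and
  s is the sum of paired eigenvalues.\<close>

lemma su_not_open: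
  fixes S :: "'m::finite cmatrix set"
  assumes "2 \<le> CARD('m)" "finite F"
    and "\<And>Z x. Z \<in> S \<Longrightarrow> x \<in> eigenvalues Z \<Longrightarrow> eigenvalues Z \<inter> F = {} \<Longrightarrow>
      3 \<le> CARD('m) \<and> (\<exists>y\<in>eigenvalues Z. x + y = s)"
  shows "\<not> contains_nonempty_open_of su_algebra S"
proof
  assume "contains_nonempty_open_of su_algebra S"
  then obtain U where U: "U \<noteq> {}" "openin (top_of_set su_algebra) U" "U \<subseteq> S"
    by (auto simp: contains_nonempty_open_of_def)
  obtain Z x where "Z \<in> U" "eigenvalues Z \<inter> F = {}" "x \<in> eigenvalues Z"
    "3 \<le> CARD('m) \<Longrightarrow> \<forall>y\<in>eigenvalues Z. x + y \<noteq> s"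
    by (rule su_generic[OF assms(1) U(1,2) assms(2)]) blast
  then show False using assms(3)[of Z x] U(3) by blast
qed

lemma SU_not_open:
  fixes S :: "'m::finite cmatrix set"
  assumes "2 \<le> CARD('m)" "finite F"
    and "\<And>Z x. Z \<in> S \<Longrightarrow> x \<in> eigenvalues Z \<Longrightarrow> eigenvalues Z \<inter> F = {} \<Longrightarrow>
      3 \<le> CARD('m) \<and> (\<exists>y\<in>eigenvalues Z. x * y = s)"
  shows "\<not> contains_nonempty_open_of SU_group S"
proof
  assume "contains_nonempty_open_of SU_group S"
  then obtain U where U: "U \<noteq> {}" "openin (top_of_set SU_group) U" "U \<subseteq> S"
    by (auto simp: contains_nonempty_open_of_def)
  obtain Z x where "Z \<in> U" "eigenvalues Z \<inter> F = {}" "x \<in> eigenvalues Z"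
    "3 \<le> CARD('m) \<Longrightarrow> \<forall>y\<in>eigenvalues Z. x * y \<noteq> s"
    by (rule SU_generic[OF assms(1) U(1,2) assms(2)]) blast
  then show False using assms(3)[of Z x] U(3) by blast
qed

section \<open>Splitting off scalar entries, and the exceptional pairs\<close>

lemma scalar_orbit: "Y \<in> SU_orbit (mat c) \<Longrightarrow> Y = mat c"
  by (auto simp: SU_orbit_iff conj_mat)

text \<open>Scalar entries are fixed by conjugation, so their total s is one constant for all
  choices of orbit elements.\<close>

lemma strip_scalars_sum:
  fixes Xs :: "'m::finite cmatrix list"
  shows "\<exists>s. \<forall>Ys. list_all2 (\<lambda>Y X. Y \<in> SU_orbit X) Ys Xs \<longrightarrow>
    (\<exists>Zs. list_all2 (\<lambda>Y X. Y \<in> SU_orbit X) Zs (nonscalar_entries Xs) \<and> sum_list Ys = sum_list Zs + mat s)"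
proof (induction Xs)
  case Nil
  show ?case by (rule exI[of _ 0]) (simp add: nonscalar_entries_def)
next
  case (Cons X Xs)
  then obtain s where s: "\<And>Ys. list_all2 (\<lambda>Y X. Y \<in> SU_orbit X) Ys Xs \<Longrightarrow>
    \<exists>Zs. list_all2 (\<lambda>Y X. Y \<in> SU_orbit X) Zs (nonscalar_entries Xs) \<and> sum_list Ys = sum_list Zs + mat s"
    by blast
  show ?case
  proof (cases "X \<in> range mat")
    case True
    then obtain c where c: "X = mat c" by blast
    have "\<exists>Zs. list_all2 (\<lambda>Y X. Y \<in> SU_orbit X) Zs (nonscalar_entries (X # Xs)) \<and>
        sum_list Ys = sum_list Zs + mat (c + s)"
      if Ys: "list_all2 (\<lambda>Y X. Y \<in> SU_orbit X) Ys (X # Xs)" for Ys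
    proof -
      obtain Y Ys' where Y: "Ys = Y # Ys'" "Y \<in> SU_orbit X" "list_all2 (\<lambda>Y X. Y \<in> SU_orbit X) Ys' Xs"
        using Ys by (auto simp: list_all2_Cons2)
      obtain Zs where Zs: "list_all2 (\<lambda>Y X. Y \<in> SU_orbit X) Zs (nonscalar_entries Xs)" "sum_list Ys' = sum_list Zs + mat s"
        using s[OF Y(3)] by blast
      have "Y = mat c" using Y(2) scalar_orbit by (simp add: c)
      then have "sum_list Ys = sum_list Zs + mat (c + s)"
        by (simp add: Y(1) Zs(2) flip: mat_add)
      then show ?thesis using Zs(1) True by (auto simp: nonscalar_entries_def)
    qed
    then show ?thesis by blast
  next
    case False
    have "\<exists>Zs. list_all2 (\<lambda>Y X. Y \<in> SU_orbit X) Zs (nonscalar_entries (X # Xs)) \<and>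
        sum_list Ys = sum_list Zs + mat s"
      if Ys: "list_all2 (\<lambda>Y X. Y \<in> SU_orbit X) Ys (X # Xs)" for Ys
    proof -
      obtain Y Ys' where Y: "Ys = Y # Ys'" "Y \<in> SU_orbit X" "list_all2 (\<lambda>Y X. Y \<in> SU_orbit X) Ys' Xs"
        using Ys by (auto simp: list_all2_Cons2)
      obtain Zs where Zs: "list_all2 (\<lambda>Y X. Y \<in> SU_orbit X) Zs (nonscalar_entries Xs)" "sum_list Ys' = sum_list Zs + mat s"
        using s[OF Y(3)] by blast
      show ?thesis
        by (rule exI[of _ "Y # Zs"]) (use Zs Y False in \<open>simp add: nonscalar_entries_def add.assoc\<close>)
    qed
    then show ?thesis by blast
  qed
qed

text \<open>Scalars commute past all other factors and can be collected in front; determinant one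
  makes their product nonzero.\<close>

lemma strip_scalars_product:
  fixes Xs :: "'m::finite cmatrix list"
  assumes "set Xs \<subseteq> SU_group"
  shows "\<exists>s. s \<noteq> 0 \<and> (\<forall>Ys. list_all2 (\<lambda>Y X. Y \<in> SU_orbit X) Ys Xs \<longrightarrow>
    (\<exists>Zs. list_all2 (\<lambda>Y X. Y \<in> SU_orbit X) Zs (nonscalar_entries Xs) \<and>
      foldr (**) Ys (mat 1) = mat s ** foldr (**) Zs (mat 1)))"
  using assms
proof (induction Xs)
  case Nil
  show ?case by (rule exI[of _ 1]) (simp add: nonscalar_entries_def)
next
  case (Cons X Xs)
  then obtain s where s0: "s \<noteq> 0" and s: "\<And>Ys. list_all2 (\<lambda>Y X. Y \<in> SU_orbit X) Ys Xs \<Longrightarrow>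
    \<exists>Zs. list_all2 (\<lambda>Y X. Y \<in> SU_orbit X) Zs (nonscalar_entries Xs) \<and>
      foldr (**) Ys (mat 1) = mat s ** foldr (**) Zs (mat 1)"
    by auto
  show ?case
  proof (cases "X \<in> range mat")
    case True
    then obtain c where c: "X = mat c" by blast
    have "c \<noteq> 0"
    proof
      assume "c = 0"
      then have "det X = 0" using det_mat_mul[of 0 "mat 1 :: 'm cmatrix"] by (simp add: c)
      then show False using Cons.prems by (simp add: SU_group_iff)
    qed
    have "\<exists>Zs. list_all2 (\<lambda>Y X. Y \<in> SU_orbit X) Zs (nonscalar_entries (X # Xs)) \<and>
        foldr (**) Ys (mat 1) = mat (c * s) ** foldr (**) Zs (mat 1)"
      if Ys: "list_all2 (\<lambda>Y X. Y \<in> SU_orbit X) Ys (X # Xs)" for Ys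
    proof -
      obtain Y Ys' where Y: "Ys = Y # Ys'" "Y \<in> SU_orbit X" "list_all2 (\<lambda>Y X. Y \<in> SU_orbit X) Ys' Xs"
        using Ys by (auto simp: list_all2_Cons2)
      obtain Zs where Zs: "list_all2 (\<lambda>Y X. Y \<in> SU_orbit X) Zs (nonscalar_entries Xs)"
        "foldr (**) Ys' (mat 1) = mat s ** foldr (**) Zs (mat 1)"
        using s[OF Y(3)] by blast
      have "Y = mat c" using Y(2) scalar_orbit by (simp add: c)
      then have "foldr (**) Ys (mat 1) = mat (c * s) ** foldr (**) Zs (mat 1)"
        by (simp add: Y(1) Zs(2) matrix_mul_assoc flip: mat_mul_mat)
      then show ?thesis using Zs(1) True by (auto simp: nonscalar_entries_def)
    qed
    then show ?thesis using s0 \<open>c \<noteq> 0\<close> by (intro exI[of _ "c * s"]) simp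
  next
    case False
    have "\<exists>Zs. list_all2 (\<lambda>Y X. Y \<in> SU_orbit X) Zs (nonscalar_entries (X # Xs)) \<and>
        foldr (**) Ys (mat 1) = mat s ** foldr (**) Zs (mat 1)"
      if Ys: "list_all2 (\<lambda>Y X. Y \<in> SU_orbit X) Ys (X # Xs)" for Ys
    proof -
      obtain Y Ys' where Y: "Ys = Y # Ys'" "Y \<in> SU_orbit X" "list_all2 (\<lambda>Y X. Y \<in> SU_orbit X) Ys' Xs"
        using Ys by (auto simp: list_all2_Cons2)
      obtain Zs where Zs: "list_all2 (\<lambda>Y X. Y \<in> SU_orbit X) Zs (nonscalar_entries Xs)"
        "foldr (**) Ys' (mat 1) = mat s ** foldr (**) Zs (mat 1)"
        using s[OF Y(3)] by blast
      have "foldr (**) Ys (mat 1) = mat s ** foldr (**) (Y # Zs) (mat 1)"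
        using mat_commute[of Y s] by (simp add: Y(1) Zs(2) matrix_mul_assoc)
      moreover have "list_all2 (\<lambda>Y X. Y \<in> SU_orbit X) (Y # Zs) (nonscalar_entries (X # Xs))"
        using Zs(1) Y(2) False by (simp add: nonscalar_entries_def)
      ultimately show ?thesis by blast
    qed
    then show ?thesis using s0 by blast
  qed
qed

lemma two_equal_card:
  assumes "two_equal_eigenvalues (A :: 'm::finite cmatrix)"
  shows "4 \<le> CARD('m)"
proof -
  have "eigenvalues A \<noteq> {}"
    using assms by (auto simp: two_equal_eigenvalues_def)
  then obtain c where "c \<in> eigenvalues A" by blast
  then have "2 \<le> eig_mult A c" "2 * eig_mult A c = CARD('m)"
    using assms by (auto simp: two_equal_eigenvalues_def)
  then show ?thesis by linarith
qed

lemma list_of_length_two: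
  assumes "length xs = 2"
  obtains x y where "xs = [x, y]"
  using assms by (auto simp: numeral_2_eq_2 length_Suc_conv)

lemma exceptional_sum_not_open:
  fixes Xs :: "'m::finite cmatrix list"
  assumes m: "2 \<le> CARD('m)" and nX: "\<forall>X\<in>set Xs. normal X" and exc: "exceptional_pair (nonscalar_entries Xs)"
  shows "\<not> contains_nonempty_open_of su_algebra (orbit_sum Xs)"
proof -
  obtain X W where XW: "nonscalar_entries Xs = [X, W]"
    using exc list_of_length_two unfolding exceptional_pair_def by blast
  then have two: "two_equal_eigenvalues X" "two_equal_eigenvalues W"
    using exc by (simp_all add: exceptional_pair_def)
  have "set (nonscalar_entries Xs) \<subseteq> set Xs" by (auto simp: nonscalar_entries_def)
  then have nor: "normal X" "normal W" using nX XW by auto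
  obtain a1 a2 where a: "eigenvalues X = {a1, a2}"
    using two(1) by (meson card_2_iff two_equal_eigenvalues_def)
  obtain b1 b2 where b: "eigenvalues W = {b1, b2}"
    using two(2) by (meson card_2_iff two_equal_eigenvalues_def)
  obtain s where s: "\<And>Ys. list_all2 (\<lambda>Y X. Y \<in> SU_orbit X) Ys Xs \<Longrightarrow>
    \<exists>Zs. list_all2 (\<lambda>Y X. Y \<in> SU_orbit X) Zs (nonscalar_entries Xs) \<and> sum_list Ys = sum_list Zs + mat s"
    using strip_scalars_sum by blast
  define F where "F = (\<lambda>(a, b). a + b + s) ` ({a1, a2} \<times> {b1, b2})"
  show ?thesis
  proof (rule su_not_open[OF m, where F = F and s = "a1 + a2 + b1 + b2 + 2 * s"])
    show "finite F" by (simp add: F_def)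
    fix Z x assume Z: "Z \<in> orbit_sum Xs" and x: "x \<in> eigenvalues Z" "eigenvalues Z \<inter> F = {}"
    obtain A B where A: "A \<in> SU_orbit X" and B: "B \<in> SU_orbit W" and Zeq: "Z = A + B + mat s"
    proof -
      obtain Ys where "list_all2 (\<lambda>Y X. Y \<in> SU_orbit X) Ys Xs" "Z = sum_list Ys"
        using Z by (auto simp: orbit_sum_def)
      then show thesis using s[of Ys] that unfolding XW by (auto simp: list_all2_Cons2)
    qed
    obtain a1' a2' where A': "eigenvalues A = {a1', a2'}" "A ** A = mat (a1' + a2') ** A - mat (a1' * a2')"
      using two_eigenvalues_quadratic[OF normal_orbit[OF nor(1) A]] two(1) eigenvalues_orbit[OF nor(1) A]
      unfolding two_equal_eigenvalues_def by metis
    obtain b1' b2' where B': "eigenvalues B = {b1', b2'}" "B ** B = mat (b1' + b2') ** B - mat (b1' * b2')"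
      using two_eigenvalues_quadratic[OF normal_orbit[OF nor(2) B]] two(2) eigenvalues_orbit[OF nor(2) B]
      unfolding two_equal_eigenvalues_def by metis
    have ab: "{a1', a2'} = {a1, a2}" "{b1', b2'} = {b1, b2}"
      using A'(1) B'(1) a b eigenvalues_orbit[OF nor(1) A] eigenvalues_orbit[OF nor(2) B] by auto
    \<comment> \<open>The eigenvalues of A and X agree only as unordered pairs, and likewise for B
      and W; their sums do not depend on the order.\<close>
    have sums: "a1' + a2' = a1 + a2" "b1' + b2' = b1 + b2"
      using ab by (auto simp: doubleton_eq_iff)
    have "x \<in> (\<lambda>(a, b). a + b + s) ` ({a1', a2'} \<times> {b1', b2'}) \<or>
      (\<exists>y\<in>eigenvalues (A + B + mat s). x + y = a1' + a2' + b1' + b2' + 2 * s)"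
      using sum_spectrum_pairing[OF A'(2) B'(2,1)] x(1) unfolding Zeq by blast
    moreover have "x \<notin> F" using x by blast
    ultimately have "\<exists>y\<in>eigenvalues Z. x + y = (a1' + a2') + (b1' + b2') + 2 * s"
      unfolding F_def Zeq ab by (simp add: add.assoc)
    then show "3 \<le> CARD('m) \<and> (\<exists>y\<in>eigenvalues Z. x + y = a1 + a2 + b1 + b2 + 2 * s)"
      using two_equal_card[OF two(1)] unfolding sums by (simp add: add.assoc)
  qed
qed

lemma SU_eigenvalue_nonzero: "X \<in> SU_group \<Longrightarrow> 0 \<notin> eigenvalues X"
proof
  assume X: "X \<in> SU_group" and "0 \<in> eigenvalues X"
  then obtain v where v: "v \<noteq> 0" "X *v v = 0" by (auto simp: eigenvalues_def)
  then have "X\<^sup>H *v (X *v v) = 0" by simp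
  then show False
    using X v(1) by (simp add: matrix_vector_mul_assoc SU_group_iff)
qed

lemma exceptional_product_not_open:
  fixes Xs :: "'m::finite cmatrix list"
  assumes m: "2 \<le> CARD('m)" and SU: "set Xs \<subseteq> SU_group" and exc: "exceptional_pair (nonscalar_entries Xs)"
  shows "\<not> contains_nonempty_open_of SU_group (class_product Xs)"
proof -
  obtain X W where XW: "nonscalar_entries Xs = [X, W]"
    using exc list_of_length_two unfolding exceptional_pair_def by blast
  then have two: "two_equal_eigenvalues X" "two_equal_eigenvalues W"
    using exc by (simp_all add: exceptional_pair_def)
  have "set (nonscalar_entries Xs) \<subseteq> set Xs" by (auto simp: nonscalar_entries_def)
  then have XWSU: "X \<in> SU_group" "W \<in> SU_group" using SU XW by auto
  then have nor: "normal X" "normal W" using normal_SU by auto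
  obtain a1 a2 where a: "eigenvalues X = {a1, a2}"
    using two(1) by (meson card_2_iff two_equal_eigenvalues_def)
  obtain b1 b2 where b: "eigenvalues W = {b1, b2}"
    using two(2) by (meson card_2_iff two_equal_eigenvalues_def)
  obtain s where s0: "s \<noteq> 0" and s: "\<And>Ys. list_all2 (\<lambda>Y X. Y \<in> SU_orbit X) Ys Xs \<Longrightarrow>
    \<exists>Zs. list_all2 (\<lambda>Y X. Y \<in> SU_orbit X) Zs (nonscalar_entries Xs) \<and>
      foldr (**) Ys (mat 1) = mat s ** foldr (**) Zs (mat 1)"
    using strip_scalars_product[OF SU] by blast
  define F where "F = (\<lambda>(a, b). s * a * b) ` ({a1, a2} \<times> {b1, b2})"
  show ?thesis
  proof (rule SU_not_open[OF m, where F = F and s = "s * s * (a1 * a2) * (b1 * b2)"])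
    show "finite F" by (simp add: F_def)
    fix Z x assume Z: "Z \<in> class_product Xs" and x: "x \<in> eigenvalues Z" "eigenvalues Z \<inter> F = {}"
    obtain A B where A: "A \<in> SU_orbit X" and B: "B \<in> SU_orbit W" and Zeq: "Z = mat s ** (A ** B)"
    proof -
      obtain Ys where "list_all2 (\<lambda>Y X. Y \<in> SU_orbit X) Ys Xs" "Z = foldr (**) Ys (mat 1)"
        using Z by (auto simp: class_product_def)
      then show thesis using s[of Ys] that unfolding XW by (auto simp: list_all2_Cons2)
    qed
    obtain a1' a2' where A': "eigenvalues A = {a1', a2'}" "A ** A = mat (a1' + a2') ** A - mat (a1' * a2')"
      using two_eigenvalues_quadratic[OF normal_orbit[OF nor(1) A]] two(1) eigenvalues_orbit[OF nor(1) A]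
      unfolding two_equal_eigenvalues_def by metis
    obtain b1' b2' where B': "eigenvalues B = {b1', b2'}" "B ** B = mat (b1' + b2') ** B - mat (b1' * b2')"
      using two_eigenvalues_quadratic[OF normal_orbit[OF nor(2) B]] two(2) eigenvalues_orbit[OF nor(2) B]
      unfolding two_equal_eigenvalues_def by metis
    have ab: "{a1', a2'} = {a1, a2}" "{b1', b2'} = {b1, b2}"
      using A'(1) B'(1) a b eigenvalues_orbit[OF nor(1) A] eigenvalues_orbit[OF nor(2) B] by auto
    have prods: "a1' * a2' = a1 * a2" "b1' * b2' = b1 * b2"
      using ab by (auto simp: doubleton_eq_iff)
    have "0 \<notin> {a1', a2'}" "0 \<notin> {b1', b2'}"
      using SU_eigenvalue_nonzero XWSU a b ab by auto
    then have nz: "a1' \<noteq> 0" "a2' \<noteq> 0" "b1' \<noteq> 0" "b2' \<noteq> 0" by auto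
    have "x \<in> (\<lambda>(a, b). s * a * b) ` ({a1', a2'} \<times> {b1', b2'}) \<or>
      (\<exists>y\<in>eigenvalues (mat s ** (A ** B)). x * y = s * s * a1' * a2' * b1' * b2')"
      using product_spectrum_pairing[OF A'(2) nz(1,2) B'(2,1) nz(3,4) s0] x(1) unfolding Zeq by blast
    moreover have "x \<notin> F" using x by blast
    ultimately have "\<exists>y\<in>eigenvalues Z. x * y = s * s * (a1' * a2') * (b1' * b2')"
      unfolding F_def Zeq ab by (simp add: mult.assoc)
    then show "3 \<le> CARD('m) \<and> (\<exists>y\<in>eigenvalues Z. x * y = s * s * (a1 * a2) * (b1 * b2))"
      using two_equal_card[OF two(1)] unfolding prods by simp
  qed
qed

section \<open>Irreducible tuples for lists of orbits, and the equivalence\<close>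

lemma irreducible_orbit_tuple:
  fixes Xs :: "'m::finite cmatrix list"
  assumes nX: "\<forall>X\<in>set Xs. normal X" and k: "1 \<le> length Xs"
    and le: "(\<Sum>X\<leftarrow>Xs. real (max_eig_mult X) / real CARD('m)) \<le> real (length Xs) - 1"
    and exc: "\<not> exceptional_pair (nonscalar_entries Xs)"
  obtains Ys where "list_all2 (\<lambda>Y X. Y \<in> SU_orbit X) Ys Xs" "irreducible_set (set Ys)"
proof -
  define k where "k = length Xs"
  obtain Y where Y: "maximal_tuple k ((!) Xs) Y"
    using maximal_tuple_exists by blast
  have "(\<Sum>i<k. real (max_eig_mult (Xs ! i))) = (\<Sum>X\<leftarrow>Xs. real (max_eig_mult X))"
    unfolding k_def by (simp add: sum_list_sum_nth atLeast0LessThan)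
  also have "\<dots> = CARD('m) * (\<Sum>X\<leftarrow>Xs. real (max_eig_mult X) / real CARD('m))"
    by (simp flip: sum_list_const_mult)
  also have "\<dots> \<le> CARD('m) * (real k - 1)"
    using le unfolding k_def by (intro mult_left_mono) auto
  finally have sum_le: "(\<Sum>i<k. real (max_eig_mult (Xs ! i))) \<le> (real k - 1) * CARD('m)"
    by (simp add: mult.commute)
  have map: "map ((!) Xs) [0..<k] = Xs"
    unfolding k_def by (rule map_nth)
  have irr: "K \<in> range mat" if "K\<^sup>H = K" "\<And>i. i < k \<Longrightarrow> K ** Y i = Y i ** K" for K
    by (rule maximal_tuple_irreducible[OF Y _ _ sum_le _ that]) (use k nX exc map in \<open>auto simp: k_def\<close>)
  show thesis
  proof (rule that[of "map Y [0..<k]"])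
    show "list_all2 (\<lambda>Y X. Y \<in> SU_orbit X) (map Y [0..<k]) Xs"
      using Y by (auto simp: list_all2_conv_all_nth k_def maximal_tuple_def)
    show "irreducible_set (set (map Y [0..<k]))"
      unfolding irreducible_set_def using irr by auto
  qed
qed

lemma su_algebra_orbit: "X \<in> su_algebra \<Longrightarrow> Y \<in> SU_orbit X \<Longrightarrow> Y \<in> su_algebra"
  using su_algebra_conj(1) by (auto simp: SU_orbit_iff)

theorem theorem1p1:
  fixes k :: nat
  assumes "2 \<le> CARD('m::finite)" and "1 \<le> k"
  shows "(\<forall>Xs :: 'm cmatrix list. length Xs = k \<and> set Xs \<subseteq> su_algebra \<longrightarrow>
            (contains_nonempty_open_of su_algebra (orbit_sum Xs) \<longleftrightarrow>
               (\<Sum>X\<leftarrow>Xs. real (max_eig_mult X) / real CARD('m)) \<le> real k - 1 \<and>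
               \<not> exceptional_pair (nonscalar_entries Xs))) \<and>
         (\<forall>xs :: 'm cmatrix list. length xs = k \<and> set xs \<subseteq> SU_group \<longrightarrow>
            (contains_nonempty_open_of SU_group (class_product xs) \<longleftrightarrow>
               (\<Sum>x\<leftarrow>xs. real (max_eig_mult x) / real CARD('m)) \<le> real k - 1 \<and>
               \<not> exceptional_pair (nonscalar_entries xs)))"
proof (intro conjI allI impI)
  fix Xs :: "'m cmatrix list" assume Xs: "length Xs = k \<and> set Xs \<subseteq> su_algebra"
  then have nX: "\<forall>X\<in>set Xs. normal X" using normal_su by blast
  show "contains_nonempty_open_of su_algebra (orbit_sum Xs) \<longleftrightarrow>
      (\<Sum>X\<leftarrow>Xs. real (max_eig_mult X) / real CARD('m)) \<le> real k - 1 \<and>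
      \<not> exceptional_pair (nonscalar_entries Xs)"
  proof (intro iffI conjI)
    assume op: "contains_nonempty_open_of su_algebra (orbit_sum Xs)"
    show "(\<Sum>X\<leftarrow>Xs. real (max_eig_mult X) / real CARD('m)) \<le> real k - 1"
    proof (rule ccontr)
      assume "\<not> ?thesis"
      then have large: "(\<Sum>X\<leftarrow>Xs. real (max_eig_mult X) / real CARD('m)) > real (length Xs) - 1"
        using Xs by linarith
      obtain l where l: "\<forall>Z\<in>orbit_sum Xs. l \<in> eigenvalues Z"
        using common_eigenvalue(1)[OF nX large] by blast
      \<comment> \<open>Every Z in the sum has the eigenvalue l, so none has a spectrum avoiding
        {l}.\<close>
      have "\<not> contains_nonempty_open_of su_algebra (orbit_sum Xs)"
        by (rule su_not_open[OF assms(1), of "{l}"]) (use l in auto)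
      then show False using op by blast
    qed
    show "\<not> exceptional_pair (nonscalar_entries Xs)"
      using exceptional_sum_not_open[OF assms(1) nX] op by blast
  next
    assume *: "(\<Sum>X\<leftarrow>Xs. real (max_eig_mult X) / real CARD('m)) \<le> real k - 1 \<and>
      \<not> exceptional_pair (nonscalar_entries Xs)"
    obtain Ys where Ys: "list_all2 (\<lambda>Y X. Y \<in> SU_orbit X) Ys Xs" "irreducible_set (set Ys)"
      by (rule irreducible_orbit_tuple[OF nX]) (use assms(2) * Xs in auto)
    have "Y \<in> su_algebra" if Y: "Y \<in> set Ys" for Y
    proof -
      obtain i where i: "i < length Ys" "Y = Ys ! i"
        using Y by (metis in_set_conv_nth)
      then have "Y \<in> SU_orbit (Xs ! i)" "Xs ! i \<in> set Xs"
        using list_all2_nthD[OF Ys(1) i(1)] list_all2_lengthD[OF Ys(1)] by auto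
      then show ?thesis using su_algebra_orbit Xs by blast
    qed
    then show "contains_nonempty_open_of su_algebra (orbit_sum Xs)"
      using orbit_sum_open[OF Ys(1) _ Ys(2)] by blast
  qed
next
  fix xs :: "'m cmatrix list" assume xs: "length xs = k \<and> set xs \<subseteq> SU_group"
  then have nx: "\<forall>x\<in>set xs. normal x" using normal_SU by blast
  show "contains_nonempty_open_of SU_group (class_product xs) \<longleftrightarrow>
      (\<Sum>x\<leftarrow>xs. real (max_eig_mult x) / real CARD('m)) \<le> real k - 1 \<and>
      \<not> exceptional_pair (nonscalar_entries xs)"
  proof (intro iffI conjI)
    assume op: "contains_nonempty_open_of SU_group (class_product xs)"
    show "(\<Sum>x\<leftarrow>xs. real (max_eig_mult x) / real CARD('m)) \<le> real k - 1"
    proof (rule ccontr)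
      assume "\<not> ?thesis"
      then have large: "(\<Sum>x\<leftarrow>xs. real (max_eig_mult x) / real CARD('m)) > real (length xs) - 1"
        using xs by linarith
      obtain p where p: "\<forall>Z\<in>class_product xs. p \<in> eigenvalues Z"
        using common_eigenvalue(2)[OF nx large] by blast
      have "\<not> contains_nonempty_open_of SU_group (class_product xs)"
        by (rule SU_not_open[OF assms(1), of "{p}"]) (use p in auto)
      then show False using op by blast
    qed
    show "\<not> exceptional_pair (nonscalar_entries xs)"
      using exceptional_product_not_open[OF assms(1)] xs op by blast
  next
    assume *: "(\<Sum>x\<leftarrow>xs. real (max_eig_mult x) / real CARD('m)) \<le> real k - 1 \<and>
      \<not> exceptional_pair (nonscalar_entries xs)"
    obtain ys where ys: "list_all2 (\<lambda>Y X. Y \<in> SU_orbit X) ys xs" "irreducible_set (set ys)"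
      by (rule irreducible_orbit_tuple[OF nx]) (use assms(2) * xs in auto)
    then show "contains_nonempty_open_of SU_group (class_product xs)"
      using class_product_open xs by blast
  qed
qed

end
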